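(* For the single load minimal cache demand problem (with loads given as finite-precision binary numbers), for each pair $(\alpha,\beta)\in\{(2,1),(\frac32,2),(\frac43,3)\}$ there is a polynomial-time algorithm that, given jobs, a number of cores $c$ and a cache bound $K$, returns a cache partition and job assignment using $c$ cores and at most $\beta K$ cache whose makespan is at most $\alpha\, m_{opt}$, where $m_{opt}$ is the minimum makespan of a solution using $c$ cores and at most $K$ cache.
   Context: Single load minimal cache demand problem: each job $j$ has a load $a_j>0$ and a minimal cache demand $x_j\ge0$. A solution is a cache partition $p$ giving $p(i)\ge0$ cache to each of the $c$ cores (cache used $=\sum_ip(i)$) and an assignment $S$ of jobs to cores such that $p(S(j))\ge x_j$ for every job $j$; the makespan is the maximum over cores of the total load $\sum_{j:S(j)=i}a_j$. *)

theory Defs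
  imports "HOL-Library.Log_Nat" "HOL-Computational_Algebra.Polynomial"
begin

section \<open>The single load minimal cache demand problem\<close>

text \<open>
  Jobs are \<open>{..<n}\<close> with loads \<open>a\<close> and minimal cache demands \<open>x\<close>, cores are \<open>{..<c}\<close>.
  Only the values of a partition \<open>p\<close> on \<open>{..<c}\<close> and of an assignment \<open>S\<close> on \<open>{..<n}\<close> matter.
\<close>

definition solution ::
  "nat \<Rightarrow> (nat \<Rightarrow> real) \<Rightarrow> nat \<Rightarrow> real \<Rightarrow> (nat \<Rightarrow> real) \<Rightarrow> (nat \<Rightarrow> nat) \<Rightarrow> bool" where
  "solution n x c K p S \<longleftrightarrow>
     (\<forall>i<c. 0 \<le> p i) \<and> (\<Sum>i<c. p i) \<le> K \<and> (\<forall>j<n. S j < c \<and> x j \<le> p (S j))"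

definition makespan :: "nat \<Rightarrow> (nat \<Rightarrow> real) \<Rightarrow> nat \<Rightarrow> (nat \<Rightarrow> nat) \<Rightarrow> real" where
  "makespan n a c S = Max ((\<lambda>i. \<Sum>j | j < n \<and> S j = i. a j) ` {..<c})"

definition feasible :: "nat \<Rightarrow> (nat \<Rightarrow> real) \<Rightarrow> nat \<Rightarrow> real \<Rightarrow> bool" where
  "feasible n x c K \<longleftrightarrow> (\<exists>p S. solution n x c K p S)"

text \<open>Unspecified if there is no solution.\<close>

definition m_opt :: "nat \<Rightarrow> (nat \<Rightarrow> real) \<Rightarrow> (nat \<Rightarrow> real) \<Rightarrow> nat \<Rightarrow> real \<Rightarrow> real" where
  "m_opt n a x c K = (LEAST m. \<exists>p S. solution n x c K p S \<and> m = makespan n a c S)"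

text \<open>The minimum is attained whenever there is a solution, so \<open>LEAST\<close> is meaningful.\<close>

lemma m_opt_attained:
  assumes "feasible n x c K"
  shows "\<exists>p S. solution n x c K p S \<and> makespan n a c S = m_opt n a x c K"
    and "solution n x c K p S \<Longrightarrow> m_opt n a x c K \<le> makespan n a c S"
proof -
  define M where "M = {m. \<exists>p S. solution n x c K p S \<and> m = makespan n a c S}"
  have restr: "makespan n a c S = makespan n a c (\<lambda>j. if j < n then S j else 0)" for S
    unfolding makespan_def by (intro arg_cong[of _ _ Max] image_cong sum.cong) auto
  let ?F = "{f. (\<forall>j. (j \<in> {..<n} \<longrightarrow> f j \<in> {..<c}) \<and> (j \<notin> {..<n} \<longrightarrow> f j = (0::nat)))}"
  have "M \<subseteq> makespan n a c ` ?F"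
  proof
    fix m assume "m \<in> M"
    then obtain p S where "solution n x c K p S" "m = makespan n a c S"
      unfolding M_def by blast
    then show "m \<in> makespan n a c ` ?F"
      by (intro image_eqI[where x = "\<lambda>j. if j < n then S j else 0"])
        (auto simp: restr[of S, symmetric] solution_def)
  qed
  moreover have "finite ?F"
    by (rule finite_set_of_finite_funs) auto
  ultimately have fin: "finite M"
    by (rule finite_subset[OF _ finite_imageI])
  have ne: "M \<noteq> {}"
    using assms unfolding feasible_def M_def by blast
  have "m_opt n a x c K = (LEAST m. m \<in> M)"
    unfolding m_opt_def M_def by simp
  also have "\<dots> = Min M"
    using fin ne by (intro Least_equality) auto
  finally have eq: "m_opt n a x c K = Min M" .
  from Min_in[OF fin ne] show "\<exists>p S. solution n x c K p S \<and> makespan n a c S = m_opt n a x c K"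
    unfolding eq by (smt (verit) M_def mem_Collect_eq)
  show "m_opt n a x c K \<le> makespan n a c S" if "solution n x c K p S"
    unfolding eq using fin that by (intro Min_le) (auto simp: M_def)
qed


section \<open>Instances with finite-precision binary numbers\<close>

text \<open>
  \<open>(m, e)\<close> is the fixed-point binary number with digit string \<open>m\<close>, the last \<open>e\<close> digits of which
  are behind the binary point. Its length counts \<open>e\<close> itself, not the length of \<open>e\<close>:
  \<open>(1, e)\<close> is written with \<open>e\<close> digits behind the point.
\<close>

type_synonym binnum = "nat \<times> nat"

definition bin_val :: "binnum \<Rightarrow> real" where
  "bin_val b = real (fst b) / 2 ^ snd b"

definition bin_size :: "binnum \<Rightarrow> nat" where
  "bin_size b = 1 + floorlog 2 (fst b) + snd b"

text \<open>Jobs are pairs of load and minimal cache demand.\<close>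

record cache_instance =
  jobs :: "(binnum \<times> binnum) list"
  cores :: nat
  cache :: binnum

definition job_load :: "cache_instance \<Rightarrow> nat \<Rightarrow> real" where
  "job_load I j = bin_val (fst (jobs I ! j))"

definition job_demand :: "cache_instance \<Rightarrow> nat \<Rightarrow> real" where
  "job_demand I j = bin_val (snd (jobs I ! j))"

definition valid_instance :: "cache_instance \<Rightarrow> bool" where
  "valid_instance I \<longleftrightarrow> 1 \<le> cores I \<and> (\<forall>j < length (jobs I). 0 < job_load I j)"

definition instance_size :: "cache_instance \<Rightarrow> nat" where
  "instance_size I = floorlog 2 (cores I) + bin_size (cache I)
     + (\<Sum>(a, x) \<leftarrow> jobs I. bin_size a + bin_size x)"


section \<open>Random access machine programs with logarithmic cost\<close>

text \<open>
  The machine model is the random access machine with unbounded natural number cells and the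
  logarithmic cost criterion (Aho, Hopcroft, Ullman), which is polynomially equivalent to Turing
  machines, presented as a structured language. The memory consists of named arrays, of which a
  program can mention only finitely many; a scalar variable is cell 0 of an array. Every operation
  is charged the number of binary digits of its operands, memory accesses also those of the
  address. Subtraction is truncated at 0, division rounds down, and division by 0 yields 0.
\<close>

type_synonym state = "string \<Rightarrow> nat \<Rightarrow> nat"

datatype aexp =
    Num nat
  | Get string aexp
  | Plus aexp aexp
  | Minus aexp aexp
  | Times aexp aexp
  | Div aexp aexp

datatype bexp = Less aexp aexp | Neg bexp | Conj bexp bexp

datatype com =
    Skip
  | Assign string aexp aexp
  | Seq com com
  | Cond bexp com com
  | While bexp com

fun aval :: "aexp \<Rightarrow> state \<Rightarrow> nat" where
  "aval (Num k) s = k"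
| "aval (Get v e) s = s v (aval e s)"
| "aval (Plus e f) s = aval e s + aval f s"
| "aval (Minus e f) s = aval e s - aval f s"
| "aval (Times e f) s = aval e s * aval f s"
| "aval (Div e f) s = aval e s div aval f s"

fun bval :: "bexp \<Rightarrow> state \<Rightarrow> bool" where
  "bval (Less e f) s \<longleftrightarrow> aval e s < aval f s"
| "bval (Neg b) s \<longleftrightarrow> \<not> bval b s"
| "bval (Conj b d) s \<longleftrightarrow> bval b s \<and> bval d s"

definition op_cost :: "nat \<Rightarrow> nat \<Rightarrow> nat" where
  "op_cost k l = 1 + floorlog 2 k + floorlog 2 l"

fun acost :: "aexp \<Rightarrow> state \<Rightarrow> nat" where
  "acost (Num k) s = op_cost k 0"
| "acost (Get v e) s = acost e s + op_cost (aval e s) (s v (aval e s))"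
| "acost (Plus e f) s = acost e s + acost f s + op_cost (aval e s) (aval f s)"
| "acost (Minus e f) s = acost e s + acost f s + op_cost (aval e s) (aval f s)"
| "acost (Times e f) s = acost e s + acost f s + op_cost (aval e s) (aval f s)"
| "acost (Div e f) s = acost e s + acost f s + op_cost (aval e s) (aval f s)"

fun bcost :: "bexp \<Rightarrow> state \<Rightarrow> nat" where
  "bcost (Less e f) s = acost e s + acost f s + op_cost (aval e s) (aval f s)"
| "bcost (Neg b) s = bcost b s + 1"
| "bcost (Conj b d) s = bcost b s + bcost d s + 1"

text \<open>\<open>exec P s t s'\<close>: program \<open>P\<close> started in \<open>s\<close> halts in \<open>s'\<close> with total cost \<open>t\<close>.\<close>

inductive exec :: "com \<Rightarrow> state \<Rightarrow> nat \<Rightarrow> state \<Rightarrow> bool" where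
  Skip: "exec Skip s 1 s"
| Assign: "exec (Assign v e f) s
     (acost e s + acost f s + op_cost (aval e s) (aval f s))
     (s(v := (s v)(aval e s := aval f s)))"
| Seq: "exec P s t s' \<Longrightarrow> exec Q s' u s'' \<Longrightarrow> exec (Seq P Q) s (t + u) s''"
| CondTrue: "bval b s \<Longrightarrow> exec P s t s' \<Longrightarrow> exec (Cond b P Q) s (bcost b s + 1 + t) s'"
| CondFalse: "\<not> bval b s \<Longrightarrow> exec Q s t s' \<Longrightarrow> exec (Cond b P Q) s (bcost b s + 1 + t) s'"
| WhileFalse: "\<not> bval b s \<Longrightarrow> exec (While b P) s (bcost b s + 1) s"
| WhileTrue: "bval b s \<Longrightarrow> exec P s t s' \<Longrightarrow> exec (While b P) s' u s'' \<Longrightarrow>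
     exec (While b P) s (bcost b s + 1 + t + u) s''"

text \<open>Programs are deterministic, so the halting run in a statement about \<open>exec\<close> is the only one.\<close>

inductive_cases exec_SkipE: "exec Skip s t s'"
inductive_cases exec_AssignE: "exec (Assign v e f) s t s'"
inductive_cases exec_SeqE: "exec (Seq P Q) s t s'"
inductive_cases exec_CondE: "exec (Cond b P Q) s t s'"
inductive_cases exec_WhileE: "exec (While b P) s t s'"

lemma exec_deterministic:
  "exec P s t s' \<Longrightarrow> exec P s u s'' \<Longrightarrow> u = t \<and> s'' = s'"
proof (induction arbitrary: u s'' rule: exec.induct)
  case Skip
  from Skip.prems show ?case by (rule exec_SkipE) simp
next
  case Assign
  from Assign.prems show ?case by (rule exec_AssignE) simp
next
  case Seq
  from Seq.prems show ?case by (rule exec_SeqE) (auto dest: Seq.IH)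
next
  case CondTrue
  from CondTrue.prems show ?case by (rule exec_CondE) (use CondTrue.hyps(1) in \<open>auto dest: CondTrue.IH\<close>)
next
  case CondFalse
  from CondFalse.prems show ?case by (rule exec_CondE) (use CondFalse.hyps(1) in \<open>auto dest: CondFalse.IH\<close>)
next
  case WhileFalse
  from WhileFalse.prems show ?case by (rule exec_WhileE) (use WhileFalse.hyps in auto)
next
  case WhileTrue
  from WhileTrue.prems show ?case by (rule exec_WhileE) (use WhileTrue.hyps(1) in \<open>auto dest: WhileTrue.IH\<close>)
qed


section \<open>Input and output\<close>

definition array :: "nat list \<Rightarrow> nat \<Rightarrow> nat" where
  "array xs = (\<lambda>i. if i < length xs then xs ! i else 0)"

definition input_state :: "cache_instance \<Rightarrow> state" where
  "input_state I = (\<lambda>_. array [])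
     (''n'' := array [length (jobs I)],
      ''c'' := array [cores I],
      ''K'' := array [fst (cache I), snd (cache I)],
      ''load_digits'' := array (map (\<lambda>(a, x). fst a) (jobs I)),
      ''load_frac'' := array (map (\<lambda>(a, x). snd a) (jobs I)),
      ''demand_digits'' := array (map (\<lambda>(a, x). fst x) (jobs I)),
      ''demand_frac'' := array (map (\<lambda>(a, x). snd x) (jobs I)))"

text \<open>
  The output is read off the arrays of the final state. Cells never written to are 0, so a program
  need not visit the cores that get no cache: the number of cores is part of the input in binary
  and may be exponential in the input length.
\<close>

definition output_partition :: "state \<Rightarrow> nat \<Rightarrow> binnum" where
  "output_partition s i = (s ''p_digits'' i, s ''p_frac'' i)"

definition output_assignment :: "state \<Rightarrow> nat \<Rightarrow> nat" where
  "output_assignment s j = s ''S'' j"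

end

(*
  Scale all numbers to integers and test a makespan m. Call a job big if its load exceeds m/b, where
  b = \<beta>; a core of a solution holds at most b - 1 big jobs, so giving every big job its demand
  costs at most (b - 1) K. For b = 3 the jobs with load in (m/3, 2m/3] can be paired arbitrarily within
  4m/3; pairing them in the order of decreasing loads makes the big loads majorize those of any
  solution. The other jobs are put, in the order of decreasing demands, on the cores in the order of
  increasing big loads, moving on as soon as a core has load m. Majorization shows that the first job
  put on the i-th core does not fit on i - 1 cores of a solution together with its predecessors, so
  the demands of these first jobs are bounded by the sorted cache sizes of a solution and add up to
  at most K. Binary search for m leads to the approximation guarantee.

  For the running time, the program multiplies only by constants. Numbers then grow by a constant
  number of digits per step, so a polynomial bound on the number of steps suffices.
*)

theory Submission
  imports Defs
begin

section \<open>Unit cost runs\<close>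

text \<open>The ratios satisfy \<alpha> = 1 + 1/\<beta>: a job that is not big adds at most m/b to a
  core whose load is still below m. For b \<le> 2 no core of a solution holds two big jobs, so each
  of them can have a core of its own. For b = 3 two of them may share a core, and separating them
  could use up too many cores; a job above 2m/3 has no big partner in any solution, so exactly the
  big jobs up to 2m/3 are candidates for pairing. Two obstacles shape the program. The number of
  cores can be exponential in the input length, so no loop may run over the cores: the core of a big
  job is computed from the rank of its group among 2n labels, and loads are inspected only on cores
  that hold a job. And every loop needs a correctness proof, so sorting is replaced by counting:
  ranks, pairs, core numbers and loads are all conditional sums, computed by one kind of double loop
  with a single correctness lemma.\<close>

inductive steps :: "com \<Rightarrow> state \<Rightarrow> nat \<Rightarrow> state \<Rightarrow> bool" where
  Skip: "steps Skip s 1 s"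
| Assign: "steps (Assign v e f) s 1 (s(v := (s v)(aval e s := aval f s)))"
| Seq: "steps P s k s' \<Longrightarrow> steps Q s' l s'' \<Longrightarrow> steps (Seq P Q) s (k + l) s''"
| CondTrue: "bval b s \<Longrightarrow> steps P s k s' \<Longrightarrow> steps (Cond b P Q) s (1 + k) s'"
| CondFalse: "\<not> bval b s \<Longrightarrow> steps Q s k s' \<Longrightarrow> steps (Cond b P Q) s (1 + k) s'"
| WhileFalse: "\<not> bval b s \<Longrightarrow> steps (While b P) s 1 s"
| WhileTrue: "bval b s \<Longrightarrow> steps P s k s' \<Longrightarrow> steps (While b P) s' l s'' \<Longrightarrow>
     steps (While b P) s (1 + k + l) s''"

text \<open>Repeated squaring would make numbers exponentially long in the number of steps, whereas
  a literal factor adds a constant number of digits. Quotients are harmless, as they do not exceed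
  the dividend.\<close>

fun linear_aexp :: "aexp \<Rightarrow> bool" where
  "linear_aexp (Num k) \<longleftrightarrow> True"
| "linear_aexp (Get v e) \<longleftrightarrow> linear_aexp e"
| "linear_aexp (Plus e f) \<longleftrightarrow> linear_aexp e \<and> linear_aexp f"
| "linear_aexp (Minus e f) \<longleftrightarrow> linear_aexp e \<and> linear_aexp f"
| "linear_aexp (Times e f) \<longleftrightarrow> (\<exists>k. e = Num k) \<and> linear_aexp f"
| "linear_aexp (Div e f) \<longleftrightarrow> linear_aexp e \<and> linear_aexp f"

fun linear_bexp :: "bexp \<Rightarrow> bool" where
  "linear_bexp (Less e f) \<longleftrightarrow> linear_aexp e \<and> linear_aexp f"
| "linear_bexp (Neg b) \<longleftrightarrow> linear_bexp b"
| "linear_bexp (Conj b d) \<longleftrightarrow> linear_bexp b \<and> linear_bexp d"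

fun linear_com :: "com \<Rightarrow> bool" where
  "linear_com Skip \<longleftrightarrow> True"
| "linear_com (Assign v e f) \<longleftrightarrow> linear_aexp e \<and> linear_aexp f"
| "linear_com (Seq P Q) \<longleftrightarrow> linear_com P \<and> linear_com Q"
| "linear_com (Cond b P Q) \<longleftrightarrow> linear_bexp b \<and> linear_com P \<and> linear_com Q"
| "linear_com (While b P) \<longleftrightarrow> linear_bexp b \<and> linear_com P"

text \<open>Number of digits by which a value can exceed the longest cell. \<open>Get\<close>
  contributes none, since its value is itself the content of a cell, whatever the address.\<close>

fun growth :: "aexp \<Rightarrow> nat" where
  "growth (Num k) = floorlog 2 k"
| "growth (Get v e) = 0"
| "growth (Plus e f) = growth e + growth f + 1"
| "growth (Minus e f) = growth e"
| "growth (Times e f) = growth e + growth f"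
| "growth (Div e f) = growth e"

text \<open>Coefficient of \<open>W + 1\<close> in the cost bound when all cells have at most
  \<open>W\<close> digits; in each operation, the constant 2 and the growths account for
  \<open>op_cost\<close>.\<close>

fun aweight :: "aexp \<Rightarrow> nat" where
  "aweight (Num k) = 1 + floorlog 2 k"
| "aweight (Get v e) = aweight e + 2 + growth e"
| "aweight (Plus e f) = aweight e + aweight f + 2 + growth e + growth f"
| "aweight (Minus e f) = aweight e + aweight f + 2 + growth e + growth f"
| "aweight (Times e f) = aweight e + aweight f + 2 + growth e + growth f"
| "aweight (Div e f) = aweight e + aweight f + 2 + growth e + growth f"

fun bweight :: "bexp \<Rightarrow> nat" where
  "bweight (Less e f) = aweight e + aweight f + 2 + growth e + growth f"
| "bweight (Neg b) = bweight b + 1"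
| "bweight (Conj b d) = bweight b + bweight d + 1"

fun weight :: "com \<Rightarrow> nat" where
  "weight Skip = 1"
| "weight (Assign v e f) = aweight e + aweight f + 2 + growth e + growth f"
| "weight (Seq P Q) = weight P + weight Q"
| "weight (Cond b P Q) = bweight b + 1 + weight P + weight Q"
| "weight (While b P) = bweight b + 1 + weight P"

definition bits_le :: "nat \<Rightarrow> state \<Rightarrow> bool" where
  "bits_le W s \<longleftrightarrow> (\<forall>v i. floorlog 2 (s v i) \<le> W)"

lemma bits_le_mono: "bits_le W s \<Longrightarrow> W \<le> W' \<Longrightarrow> bits_le W' s"
  by (auto simp: bits_le_def intro: le_trans)

lemma floorlog_2_le_iff: "floorlog 2 x \<le> k \<longleftrightarrow> x < 2 ^ k"
  by (cases "k = 0") (auto simp: floorlog_le_iff floorlog_eq_zero_iff)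

lemma less_power_floorlog_2: "x < 2 ^ floorlog 2 x"
  using floorlog_2_le_iff by blast

lemma floorlog_2_add: "floorlog 2 (x + y) \<le> max (floorlog 2 x) (floorlog 2 y) + 1"
proof -
  let ?k = "max (floorlog 2 x) (floorlog 2 y)"
  have "x < 2 ^ ?k" "y < 2 ^ ?k"
    by (simp_all flip: floorlog_2_le_iff)
  then show ?thesis by (simp add: floorlog_2_le_iff)
qed

lemma floorlog_2_mult: "floorlog 2 (x * y) \<le> floorlog 2 x + floorlog 2 y"
proof -
  have "x * y < 2 ^ floorlog 2 x * 2 ^ floorlog 2 y"
    by (intro mult_strict_mono less_power_floorlog_2) auto
  then show ?thesis by (simp add: floorlog_2_le_iff power_add)
qed

lemma floorlog_2_aval:
  assumes "bits_le W s" "linear_aexp e"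
  shows "floorlog 2 (aval e s) \<le> W + growth e"
  using assms(2)
proof (induction e)
  case (Get v e)
  then show ?case using assms(1) by (simp add: bits_le_def)
next
  case (Plus e f)
  then show ?case using floorlog_2_add[of "aval e s" "aval f s"] by simp
next
  case (Minus e f)
  then show ?case using floorlog_mono[of "aval e s - aval f s" "aval e s" 2] by simp
next
  case (Times e f)
  then show ?case using floorlog_2_mult[of "aval e s" "aval f s"] by auto
next
  case (Div e f)
  then show ?case using floorlog_mono[of "aval e s div aval f s" "aval e s" 2] by simp
qed simp

lemma op_cost_aval:
  assumes "bits_le W s" "linear_aexp e" "linear_aexp f"
  shows "op_cost (aval e s) (aval f s) \<le> (2 + growth e + growth f) * (W + 1)"
  using floorlog_2_aval[OF assms(1,2)] floorlog_2_aval[OF assms(1,3)]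
  by (simp add: op_cost_def algebra_simps)

lemma acost_le:
  assumes "bits_le W s" "linear_aexp e"
  shows "acost e s \<le> aweight e * (W + 1)"
  using assms(2)
proof (induction e)
  case (Num k)
  then show ?case by (simp add: op_cost_def floorlog_def)
next
  case (Get v e)
  have "floorlog 2 (s v (aval e s)) \<le> W" using assms(1) by (simp add: bits_le_def)
  then show ?case
    using Get floorlog_2_aval[OF assms(1), of e] by (simp add: op_cost_def algebra_simps)
next
  case (Times e f)
  then have "linear_aexp e" by auto
  with Times show ?case using op_cost_aval[OF assms(1), of e f] by (simp add: algebra_simps)
qed (use op_cost_aval[OF assms(1)] in \<open>fastforce simp: algebra_simps\<close>)+

lemma bcost_le:
  assumes "bits_le W s" "linear_bexp b"
  shows "bcost b s \<le> bweight b * (W + 1)"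
  using assms(2)
proof (induction b)
  case (Less e f)
  then show ?case
    using acost_le[OF assms(1), of e] acost_le[OF assms(1), of f] op_cost_aval[OF assms(1), of e f]
    by (simp add: algebra_simps)
qed (auto simp: algebra_simps)

text \<open>Each step lengthens the numbers by at most \<open>C\<close> digits, so during
  \<open>k\<close> steps all lengths stay below \<open>W + k * C\<close> and each step costs at most
  \<open>C\<close> times that plus one. \<open>C\<close> is an arbitrary upper bound of the weight,
  so that one constant serves all subprograms in the induction, while \<open>W\<close> varies with
  the state reached.\<close>

lemma steps_imp_exec:
  assumes "steps P s k s'" "linear_com P" "weight P \<le> C" "bits_le W s"
  shows "\<exists>t. exec P s t s' \<and> t \<le> k * C * (W + k * C + 1) \<and> bits_le (W + k * C) s'"
  using assms
proof (induction arbitrary: W rule: steps.induct)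
  case (Skip s)
  then show ?case
    by (intro exI[of _ 1] conjI exec.Skip) (auto intro: bits_le_mono)
next
  case (Assign v e f s)
  let ?t = "acost e s + acost f s + op_cost (aval e s) (aval f s)"
  have lin: "linear_aexp e" "linear_aexp f" using Assign.prems by auto
  have "?t \<le> weight (Assign v e f) * (W + 1)"
    using acost_le[OF Assign.prems(3) lin(1)] acost_le[OF Assign.prems(3) lin(2)]
      op_cost_aval[OF Assign.prems(3) lin] by (simp add: algebra_simps)
  also have "\<dots> \<le> C * (W + C + 1)" using Assign.prems by (intro mult_mono) auto
  finally have 1: "?t \<le> C * (W + C + 1)" .
  have "floorlog 2 (aval f s) \<le> W + C"
    using floorlog_2_aval[OF Assign.prems(3) lin(2)] Assign.prems(2) by simp
  then have "bits_le (W + C) (s(v := (s v)(aval e s := aval f s)))"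
    using Assign.prems(3) by (auto simp: bits_le_def intro: trans_le_add1)
  with 1 show ?case by (intro exI[of _ ?t] conjI exec.Assign) (simp_all del: fun_upd_apply)
next
  case (Seq P s k s' Q l s'')
  then obtain t where t: "exec P s t s'" "t \<le> k * C * (W + k * C + 1)" "bits_le (W + k * C) s'"
    by fastforce
  with Seq obtain u where u: "exec Q s' u s''" "u \<le> l * C * (W + k * C + l * C + 1)"
    "bits_le (W + k * C + l * C) s''"
    by fastforce
  have "t \<le> k * C * (W + k * C + l * C + 1)"
    by (rule order.trans[OF t(2)]) (intro mult_left_mono, auto)
  then have "t + u \<le> k * C * (W + k * C + l * C + 1) + l * C * (W + k * C + l * C + 1)"
    using u(2) by (rule add_mono)
  then show ?case
    using exec.Seq[OF t(1) u(1)] u(3)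
    by (intro exI[of _ "t + u"]) (auto simp: algebra_simps)
next
  case (CondTrue b s P k s' Q)
  then obtain t where t: "exec P s t s'" "t \<le> k * C * (W + k * C + 1)" "bits_le (W + k * C) s'"
    by fastforce
  have "bcost b s + 1 \<le> weight (Cond b P Q) * (W + 1)"
    using bcost_le[of W s b] CondTrue.prems by (auto simp: algebra_simps)
  also have "\<dots> \<le> C * (W + 1)" using CondTrue.prems by (intro mult_mono) auto
  finally have b: "bcost b s + 1 \<le> C * (W + 1)" .
  have "bcost b s + 1 + t \<le> (1 + k) * C * (W + (1 + k) * C + 1)"
    by (rule order.trans[OF add_mono[OF b t(2)]]) (simp add: algebra_simps)
  then show ?case using exec.CondTrue[OF CondTrue.hyps(1) t(1)] t(3)
      bits_le_mono[OF t(3), of "W + (1 + k) * C"]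
    by (intro exI[of _ "bcost b s + 1 + t"]) auto
next
  case (CondFalse b s Q k s' P)
  then obtain t where t: "exec Q s t s'" "t \<le> k * C * (W + k * C + 1)" "bits_le (W + k * C) s'"
    by fastforce
  have "bcost b s + 1 \<le> weight (Cond b P Q) * (W + 1)"
    using bcost_le[of W s b] CondFalse.prems by (auto simp: algebra_simps)
  also have "\<dots> \<le> C * (W + 1)" using CondFalse.prems by (intro mult_mono) auto
  finally have b: "bcost b s + 1 \<le> C * (W + 1)" .
  have "bcost b s + 1 + t \<le> (1 + k) * C * (W + (1 + k) * C + 1)"
    by (rule order.trans[OF add_mono[OF b t(2)]]) (simp add: algebra_simps)
  then show ?case using exec.CondFalse[OF CondFalse.hyps(1) t(1)] t(3)
      bits_le_mono[OF t(3), of "W + (1 + k) * C"]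
    by (intro exI[of _ "bcost b s + 1 + t"]) auto
next
  case (WhileFalse b s P)
  have "bcost b s + 1 \<le> weight (While b P) * (W + 1)"
    using bcost_le[of W s b] WhileFalse.prems by (auto simp: algebra_simps)
  also have "\<dots> \<le> C * (W + C + 1)" using WhileFalse.prems by (intro mult_mono) auto
  finally show ?case using exec.WhileFalse[OF WhileFalse.hyps] WhileFalse.prems(3)
      bits_le_mono[of W s "W + C"]
    by (intro exI[of _ "bcost b s + 1"]) auto
next
  case (WhileTrue b s P k s' l s'')
  then obtain t where t: "exec P s t s'" "t \<le> k * C * (W + k * C + 1)" "bits_le (W + k * C) s'"
    by fastforce
  with WhileTrue obtain u where u: "exec (While b P) s' u s''"
    "u \<le> l * C * (W + k * C + l * C + 1)" "bits_le (W + k * C + l * C) s''"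
    by fastforce
  have "bcost b s + 1 \<le> weight (While b P) * (W + 1)"
    using bcost_le[of W s b] WhileTrue.prems by (auto simp: algebra_simps)
  also have "\<dots> \<le> C * (W + 1)" using WhileTrue.prems by (intro mult_mono) auto
  finally have b: "bcost b s + 1 \<le> C * (W + 1)" .
  have "bcost b s + 1 + t + u \<le> (1 + k + l) * C * (W + (1 + k + l) * C + 1)"
    by (rule order.trans[OF add_mono[OF add_mono[OF b t(2)] u(2)]]) (simp add: algebra_simps)
  moreover have "bits_le (W + (1 + k + l) * C) s''"
    by (rule bits_le_mono[OF u(3)]) (simp add: algebra_simps)
  ultimately show ?case using exec.WhileTrue[OF WhileTrue.hyps(1) t(1) u(1)] by blast
qed

section \<open>Programs with bounded loops\<close>

fun step_poly :: "com \<Rightarrow> nat poly" where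
  "step_poly Skip = 1"
| "step_poly (Assign v e f) = 1"
| "step_poly (Seq P Q) = step_poly P + step_poly Q"
| "step_poly (Cond b P Q) = 1 + step_poly P + step_poly Q"
| "step_poly (While b P) = 1 + [:0, 1:] * (1 + step_poly P)"

text \<open>\<open>N\<close> stands for the number of iterations a loop makes each time it is entered.\<close>

definition runs :: "nat \<Rightarrow> com \<Rightarrow> state \<Rightarrow> (state \<Rightarrow> bool) \<Rightarrow> bool" where
  "runs N P s Q \<longleftrightarrow> (\<exists>k s'. steps P s k s' \<and> k \<le> poly (step_poly P) N \<and> Q s')"

lemma runs_mono: "runs N P s Q \<Longrightarrow> (\<And>s'. Q s' \<Longrightarrow> R s') \<Longrightarrow> runs N P s R"
  unfolding runs_def by blast

lemma runs_Skip: "Q s \<Longrightarrow> runs N Skip s Q"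
  unfolding runs_def using steps.Skip by fastforce

lemma runs_Assign: "Q (s(v := (s v)(aval e s := aval f s))) \<Longrightarrow> runs N (Assign v e f) s Q"
  unfolding runs_def using steps.Assign by fastforce

lemma runs_Seq:
  assumes "runs N P s R" "\<And>s'. R s' \<Longrightarrow> runs N P' s' Q"
  shows "runs N (Seq P P') s Q"
  using assms unfolding runs_def by (metis add_mono poly_add step_poly.simps(3) steps.Seq)

lemma runs_Seq_Assign:
  assumes "\<And>s'. s' = s(v := (s v)(aval e s := aval f s)) \<Longrightarrow> runs N P s' Q"
  shows "runs N (Seq (Assign v e f) P) s Q"
  using assms by (intro runs_Seq[of N _ s "\<lambda>s'. s' = s(v := (s v)(aval e s := aval f s))"] runs_Assign refl)

lemma runs_Cond:
  assumes "bval b s \<Longrightarrow> runs N P s Q" "\<not> bval b s \<Longrightarrow> runs N P' s Q"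
  shows "runs N (Cond b P P') s Q"
proof (cases "bval b s")
  case True
  with assms(1) obtain k s' where k: "steps P s k s'" "k \<le> poly (step_poly P) N" "Q s'"
    unfolding runs_def by blast
  from k show ?thesis unfolding runs_def
    by (intro exI[of _ "1 + k"] exI[of _ s'] conjI steps.CondTrue True) auto
next
  case False
  with assms(2) obtain k s' where k: "steps P' s k s'" "k \<le> poly (step_poly P') N" "Q s'"
    unfolding runs_def by blast
  from k show ?thesis unfolding runs_def
    by (intro exI[of _ "1 + k"] exI[of _ s'] conjI steps.CondFalse False) auto
qed

text \<open>The measure serves twice: its decrease yields termination, and its initial value bounds
  the number of iterations.\<close>

lemma steps_While:
  assumes "I s"
    and "\<And>s. I s \<Longrightarrow> bval b s \<Longrightarrow> runs N P s (\<lambda>s'. I s' \<and> f s' < f s)"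
  shows "\<exists>k s'. steps (While b P) s k s' \<and> k \<le> 1 + f s * (1 + poly (step_poly P) N) \<and>
    I s' \<and> \<not> bval b s'"
  using assms(1)
proof (induction "f s" arbitrary: s rule: less_induct)
  case less
  show ?case
  proof (cases "bval b s")
    case True
    from assms(2)[OF less.prems True] obtain k s' where
      k: "steps P s k s'" "k \<le> poly (step_poly P) N" "I s'" "f s' < f s"
      unfolding runs_def by blast
    from less.hyps[OF k(4,3)] obtain l s'' where
      l: "steps (While b P) s' l s''" "l \<le> 1 + f s' * (1 + poly (step_poly P) N)" "I s''"
        "\<not> bval b s''"
      by blast
    have "1 + k + l \<le> 1 + Suc (f s') * (1 + poly (step_poly P) N)" using k(2) l(2) by simp
    also have "\<dots> \<le> 1 + f s * (1 + poly (step_poly P) N)"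
      using k(4) by (intro add_left_mono mult_right_mono) auto
    finally show ?thesis using steps.WhileTrue[OF True k(1) l(1)] l(3,4) by blast
  next
    case False
    then show ?thesis using steps.WhileFalse[OF False] less.prems by fastforce
  qed
qed

lemma runs_While:
  assumes "I s" "f s \<le> N"
    and "\<And>s. I s \<Longrightarrow> bval b s \<Longrightarrow> runs N P s (\<lambda>s'. I s' \<and> f s' < f s)"
    and "\<And>s. I s \<Longrightarrow> \<not> bval b s \<Longrightarrow> Q s"
  shows "runs N (While b P) s Q"
proof -
  obtain k s' where k: "steps (While b P) s k s'" "k \<le> 1 + f s * (1 + poly (step_poly P) N)"
    "I s'" "\<not> bval b s'"
    using steps_While[of I s b N P f] assms(1,3) by blast
  have "k \<le> 1 + N * (1 + poly (step_poly P) N)"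
    using k(2) assms(2) by (meson add_left_mono le_trans mult_right_mono zero_le)
  then show ?thesis using k assms(4) unfolding runs_def by auto
qed

section \<open>Counting loops, conditional sums and tables\<close>

abbreviation Var :: "string \<Rightarrow> aexp" where
  "Var v \<equiv> Get v (Num 0)"

abbreviation Set :: "string \<Rightarrow> aexp \<Rightarrow> com" where
  "Set v e \<equiv> Assign v (Num 0) e"

definition For :: "string \<Rightarrow> aexp \<Rightarrow> com \<Rightarrow> com" where
  "For v M P = Seq (Set v (Num 0))
     (While (Less (Var v) M) (Seq P (Set v (Plus (Var v) (Num 1)))))"

text \<open>The loop bound \<open>M\<close> is evaluated afresh in each round, so the invariant has
  to determine its value. The invariant refers to the state after the counter has been increased;
  the body itself must leave the counter unchanged.\<close>

lemma runs_For:
  assumes "I 0 (s(v := (s v)(0 := 0)))"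
    and M: "\<And>k s'. k \<le> m \<Longrightarrow> I k s' \<Longrightarrow> aval M s' = m"
    and P: "\<And>k s'. k < m \<Longrightarrow> I k s' \<Longrightarrow> s' v 0 = k \<Longrightarrow>
      runs N P s' (\<lambda>s''. s'' v 0 = k \<and> I (Suc k) (s''(v := (s'' v)(0 := Suc k))))"
    and Q: "\<And>s'. I m s' \<Longrightarrow> Q s'"
    and "m \<le> N"
  shows "runs N (For v M P) s Q"
  unfolding For_def
proof (rule runs_Seq, rule runs_Assign)
  fix s' assume s': "s' = s(v := (s v)(aval (Num 0) s := aval (Num 0) s))"
  show "runs N (While (Less (Var v) M) (Seq P (Set v (Plus (Var v) (Num 1))))) s' Q"
  proof (rule runs_While[where I = "\<lambda>s. s v 0 \<le> m \<and> I (s v 0) s" and f = "\<lambda>s. m - s v 0"])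
    show "s' v 0 \<le> m \<and> I (s' v 0) s'" using assms(1) s' by simp
    show "m - s' v 0 \<le> N" using assms(5) by simp
  next
    fix s assume s: "s v 0 \<le> m \<and> I (s v 0) s" "bval (Less (Var v) M) s"
    then have "s v 0 < m" using M[of "s v 0" s] by simp
    moreover have "I (s v 0) s" using s by simp
    ultimately have 1: "runs N P s (\<lambda>s''. s'' v 0 = s v 0 \<and>
        I (Suc (s v 0)) (s''(v := (s'' v)(0 := Suc (s v 0)))))"
      by (rule P) simp
    show "runs N (Seq P (Set v (Plus (Var v) (Num 1)))) s
        (\<lambda>s'. (s' v 0 \<le> m \<and> I (s' v 0) s') \<and> m - s' v 0 < m - s v 0)"
      by (rule runs_Seq[OF 1], rule runs_Assign) (use \<open>s v 0 < m\<close> in auto)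
  next
    fix s assume s: "s v 0 \<le> m \<and> I (s v 0) s" "\<not> bval (Less (Var v) M) s"
    then have "s v 0 = m" using M[of "s v 0" s] by simp
    with s show "Q s" using Q by simp
  qed
qed (rule refl)

text \<open>Frame condition at the level of whole arrays: it lets facts about the untouched arrays
  pass through a subprogram.\<close>

definition eq_off :: "string set \<Rightarrow> state \<Rightarrow> state \<Rightarrow> bool" where
  "eq_off X s s' \<longleftrightarrow> (\<forall>v. v \<notin> X \<longrightarrow> s' v = s v)"

definition Sum :: "string \<Rightarrow> aexp \<Rightarrow> bexp \<Rightarrow> aexp \<Rightarrow> com" where
  "Sum r M b e = Seq (Set r (Num 0)) (For ''i'' M (Cond b (Set r (Plus (Var r) e)) Skip))"

lemma runs_Sum:
  assumes r: "r \<noteq> ''i''"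
    and M: "\<And>s'. eq_off {r, ''i''} s s' \<Longrightarrow> aval M s' = m"
    and b: "\<And>k s'. k < m \<Longrightarrow> eq_off {r, ''i''} s s' \<Longrightarrow> s' ''i'' 0 = k \<Longrightarrow> bval b s' = B k"
    and e: "\<And>k s'. k < m \<Longrightarrow> eq_off {r, ''i''} s s' \<Longrightarrow> s' ''i'' 0 = k \<Longrightarrow> B k \<Longrightarrow> aval e s' = f k"
    and "m \<le> N"
    and Q: "\<And>s'. eq_off {r, ''i''} s s' \<Longrightarrow> s' r 0 = (\<Sum>k | k < m \<and> B k. f k) \<Longrightarrow> Q s'"
  shows "runs N (Sum r M b e) s Q"
  unfolding Sum_def
proof (rule runs_Seq, rule runs_Assign)
  fix s' assume s': "s' = s(r := (s r)(aval (Num 0) s := aval (Num 0) s))"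
  let ?I = "\<lambda>k s'. eq_off {r, ''i''} s s' \<and> s' r 0 = (\<Sum>l | l < k \<and> B l. f l)"
  have *: "(\<Sum>l | l < Suc k \<and> B l. f l) = (\<Sum>l | l < k \<and> B l. f l) + (if B k then f k else 0)" for k
  proof -
    have "{l. l < Suc k \<and> B l} = (if B k then insert k {l. l < k \<and> B l} else {l. l < k \<and> B l})"
      by (auto simp: less_Suc_eq)
    then show ?thesis by simp
  qed
  show "runs N (For ''i'' M (Cond b (Set r (Plus (Var r) e)) Skip)) s' Q"
  proof (rule runs_For[where I = ?I and m = m])
    fix k t assume kt: "k < m" "?I k t" "t ''i'' 0 = k"
    have b': "bval b t = B k" using b kt by blast
    show "runs N (Cond b (Set r (Plus (Var r) e)) Skip) t (\<lambda>s''. s'' ''i'' 0 = k \<and>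
       ?I (Suc k) (s''(''i'' := (s'' ''i'')(0 := Suc k))))"
    proof (rule runs_Cond; (rule runs_Assign runs_Skip)?)
      assume "bval b t"
      then have "B k" "aval e t = f k" using b' e kt by blast+
      then show "(t(r := (t r)(aval (Num 0) t := aval (Plus (Var r) e) t))) ''i'' 0 = k \<and>
       ?I (Suc k) ((t(r := (t r)(aval (Num 0) t := aval (Plus (Var r) e) t)))
          (''i'' := ((t(r := (t r)(aval (Num 0) t := aval (Plus (Var r) e) t))) ''i'')(0 := Suc k)))"
        using kt r by (auto simp: eq_off_def *)
    next
      assume "\<not> bval b t"
      then show "t ''i'' 0 = k \<and> ?I (Suc k) (t(''i'' := (t ''i'')(0 := Suc k)))"
        using b' kt r by (auto simp: eq_off_def *)
    qed
  qed (use assms s' in \<open>auto simp: eq_off_def\<close>)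
qed (rule refl)

text \<open>General enough for every phase except the greedy pass: each entry depends on one
  conditional sum and a final case distinction. The group table needs only the case distinction and
  sums over an empty range.\<close>

definition Table :: "string \<Rightarrow> aexp \<Rightarrow> aexp \<Rightarrow> bexp \<Rightarrow> aexp \<Rightarrow> bexp \<Rightarrow> aexp \<Rightarrow> aexp \<Rightarrow> com" where
  "Table a M M' b e b' f g = For ''j'' M (Seq (Sum ''r'' M' b e)
     (Cond b' (Assign a (Var ''j'') f) (Assign a (Var ''j'') g)))"

text \<open>\<open>B\<close>, \<open>w\<close> and \<open>F\<close> are the mathematical
  counterparts of the test, the summand and the entry. The array \<open>a\<close> belongs to
  \<open>X\<close>, so the expressions must have their values independently of the entries already
  written.\<close>

lemma runs_Table:
  fixes a :: string
  defines "X \<equiv> {a, ''j'', ''r'', ''i''}"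
  assumes a: "a \<noteq> ''j''" "a \<noteq> ''r''" "a \<noteq> ''i''"
    and M: "\<And>s'. eq_off X s s' \<Longrightarrow> aval M s' = m"
    and M': "\<And>s'. eq_off X s s' \<Longrightarrow> aval M' s' = m'"
    and b: "\<And>k l s'. k < m \<Longrightarrow> l < m' \<Longrightarrow> eq_off X s s' \<Longrightarrow> s' ''j'' 0 = k \<Longrightarrow> s' ''i'' 0 = l \<Longrightarrow>
      bval b s' = B k l"
    and e: "\<And>k l s'. k < m \<Longrightarrow> l < m' \<Longrightarrow> eq_off X s s' \<Longrightarrow> s' ''j'' 0 = k \<Longrightarrow> s' ''i'' 0 = l \<Longrightarrow>
      B k l \<Longrightarrow> aval e s' = w k l"
    and F: "\<And>k s'. k < m \<Longrightarrow> eq_off X s s' \<Longrightarrow> s' ''j'' 0 = k \<Longrightarrow>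
      s' ''r'' 0 = (\<Sum>l | l < m' \<and> B k l. w k l) \<Longrightarrow>
      (if bval b' s' then aval f s' else aval g s') = F k"
    and N: "m \<le> N" "m' \<le> N"
    and Q: "\<And>s'. eq_off X s s' \<Longrightarrow> (\<And>k. k < m \<Longrightarrow> s' a k = F k) \<Longrightarrow> Q s'"
  shows "runs N (Table a M M' b e b' f g) s Q"
  unfolding Table_def
proof (rule runs_For[where I = "\<lambda>k s'. eq_off X s s' \<and> (\<forall>l<k. s' a l = F l)" and m = m])
  fix k t assume k: "k < m" "t ''j'' 0 = k"
    and t: "eq_off X s t \<and> (\<forall>l<k. t a l = F l)"
  let ?Q = "\<lambda>s''. s'' ''j'' 0 = k \<and>
        (let u = s''(''j'' := (s'' ''j'')(0 := Suc k)) in eq_off X s u \<and> (\<forall>l<Suc k. u a l = F l))"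
  have "runs N (Seq (Sum ''r'' M' b e) (Cond b' (Assign a (Var ''j'') f) (Assign a (Var ''j'') g))) t ?Q"
  proof (rule runs_Seq)
    let ?R = "\<lambda>s'. eq_off {''r'', ''i''} t s' \<and> s' ''r'' 0 = (\<Sum>l | l < m' \<and> B k l. w k l)"
    have trans: "eq_off X s s'" "s' ''j'' 0 = k" "s' a = t a" if "eq_off {''r'', ''i''} t s'" for s'
      using that t a k by (auto simp: eq_off_def X_def)
    show "runs N (Sum ''r'' M' b e) t ?R"
      by (rule runs_Sum[where m = m' and B = "B k" and f = "w k"])
        (use trans k M' b e N in auto)
    fix u assume u: "?R u"
    have F': "(if bval b' u then aval f u else aval g u) = F k"
      using u trans k by (intro F) auto
    have ux: "eq_off X s u" "u ''j'' 0 = k" "u a = t a" using trans u by auto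
    show "runs N (Cond b' (Assign a (Var ''j'') f) (Assign a (Var ''j'') g)) u ?Q"
      by (rule runs_Cond; rule runs_Assign)
        (use F' ux t a in \<open>auto simp: eq_off_def X_def Let_def less_Suc_eq\<close>)
  qed
  then show "runs N (Seq (Sum ''r'' M' b e)
        (Cond b' (Assign a (Var ''j'') f) (Assign a (Var ''j'') g))) t
        (\<lambda>s''. s'' ''j'' 0 = k \<and> eq_off X s (s''(''j'' := (s'' ''j'')(0 := Suc k))) \<and>
           (\<forall>l<Suc k. (s''(''j'' := (s'' ''j'')(0 := Suc k))) a l = F l))"
    by (simp add: Let_def)
qed (use M N Q in \<open>auto simp: eq_off_def X_def\<close>)

section \<open>Ranks\<close>

text \<open>Breaking ties by index makes this a strict total order, so that different elements have
  different ranks.\<close>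

definition before :: "(nat \<Rightarrow> nat) \<Rightarrow> nat \<Rightarrow> nat \<Rightarrow> bool" where
  "before w i j \<longleftrightarrow> w j < w i \<or> w i = w j \<and> i < j"

definition rank :: "(nat \<Rightarrow> nat) \<Rightarrow> nat set \<Rightarrow> nat \<Rightarrow> nat" where
  "rank w D j = card {i \<in> D. before w i j}"

lemma before_linear: "i \<noteq> j \<Longrightarrow> before w i j \<or> before w j i"
  by (auto simp: before_def)

lemma before_trans: "before w i j \<Longrightarrow> before w j k \<Longrightarrow> before w i k"
  by (auto simp: before_def)

lemma before_irrefl: "\<not> before w i i"
  by (auto simp: before_def)

lemma before_imp_ge: "before w i j \<Longrightarrow> w j \<le> w i"
  by (auto simp: before_def)

lemma rank_less_iff:
  assumes "finite D" "i \<in> D" "j \<in> D"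
  shows "rank w D i < rank w D j \<longleftrightarrow> before w i j"
proof -
  have *: "rank w D i < rank w D j" if "i \<in> D" "before w i j" for i j
  proof -
    have "{k \<in> D. before w k i} \<subset> {k \<in> D. before w k j}"
      using that before_irrefl before_trans by blast
    then show ?thesis unfolding rank_def using assms(1) by (intro psubset_card_mono) auto
  qed
  show ?thesis using *[of i j] *[of j i] assms before_linear[of i j w]
    by (cases "i = j") (auto simp: before_irrefl)
qed

text \<open>Ranks are distinct by totality, and below \<open>card D\<close> because no element
  precedes itself. This replaces a sorted list.\<close>

lemma rank_bij_betw:
  assumes "finite D"
  shows "bij_betw (rank w D) D {..<card D}"
proof -
  have inj: "inj_on (rank w D) D"
    using rank_less_iff[OF assms] before_linear by (intro inj_onI) (metis less_irrefl)
  have "{i \<in> D. before w i j} \<subset> D" if "j \<in> D" for j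
    using that before_irrefl by blast
  then have "rank w D j < card D" if "j \<in> D" for j
    unfolding rank_def using that assms by (intro psubset_card_mono) blast+
  then have "rank w D ` D \<subseteq> {..<card D}" by auto
  then show ?thesis
    using inj assms by (simp add: bij_betw_def card_image card_subset_eq)
qed

lemma rank_less_card: "finite D \<Longrightarrow> j \<in> D \<Longrightarrow> rank w D j < card D"
  using rank_bij_betw[of D w] by (auto simp: bij_betw_def)

lemma card_rank_less:
  assumes "finite D"
  shows "card {j \<in> D. rank w D j < k} = min k (card D)"
proof -
  have "rank w D ` {j \<in> D. rank w D j < k} = rank w D ` D \<inter> {..<k}" by auto
  also have "\<dots> = {..<min k (card D)}"
    using rank_bij_betw[OF assms, of w] by (auto simp: bij_betw_def)
  finally have "bij_betw (rank w D) {j \<in> D. rank w D j < k} {..<min k (card D)}"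
    using rank_bij_betw[OF assms, of w] by (auto simp: bij_betw_def inj_on_def)
  then show ?thesis by (simp add: bij_betw_same_card)
qed

text \<open>Only the parts of \<open>Z\<close> and \<open>T\<close> outside each other matter. The
  minimum of \<open>w\<close> on \<open>T - Z\<close> separates them, and \<open>T - Z\<close> has
  at least as many elements.\<close>

lemma sum_le_sum_top:
  fixes w :: "nat \<Rightarrow> nat"
  assumes "finite D" "Z \<subseteq> D" "T \<subseteq> D" "card Z \<le> card T"
    and top: "\<And>t z. t \<in> T \<Longrightarrow> z \<in> D - T \<Longrightarrow> w z \<le> w t"
  shows "sum w Z \<le> sum w T"
proof -
  have fin: "finite Z" "finite T" using assms finite_subset by blast+
  have "card (Z - T) + card (Z \<inter> T) = card Z" "card (T - Z) + card (Z \<inter> T) = card T"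
    using fin by (metis Int_commute add.commute card_Int_Diff)+
  then have le: "card (Z - T) \<le> card (T - Z)" using assms(4) by linarith
  have "sum w (Z - T) \<le> sum w (T - Z)"
  proof (cases "T - Z = {}")
    case True
    then have "card (Z - T) = 0" using le by (simp only: True) simp
    then have "Z - T = {}" using fin by simp
    then show ?thesis by (simp only: sum.empty zero_le)
  next
    case False
    let ?m = "Min (w ` (T - Z))"
    have "sum w (Z - T) \<le> card (Z - T) * ?m"
      using sum_bounded_above[of "Z - T" w ?m] fin False assms(2) top by auto
    also have "\<dots> \<le> card (T - Z) * ?m" using le by simp
    also have "\<dots> \<le> sum w (T - Z)"
      using sum_bounded_below[of "T - Z" ?m w] fin by auto
    finally show ?thesis .
  qed
  then have "sum w (Z - T) + sum w (Z \<inter> T) \<le> sum w (T - Z) + sum w (Z \<inter> T)" by simp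
  then show ?thesis
    using sum.Int_Diff[OF fin(1), of w T] sum.Int_Diff[OF fin(2), of w Z]
    by (simp add: Int_commute add.commute)
qed

lemma sum_le_sum_rank_less:
  assumes "finite D" "Z \<subseteq> D" "card Z \<le> k"
  shows "sum w Z \<le> sum w {j \<in> D. rank w D j < k}"
proof (rule sum_le_sum_top[OF assms(1,2)])
  show "card Z \<le> card {j \<in> D. rank w D j < k}"
    using assms card_mono[of D Z] by (simp add: card_rank_less)
next
  fix t z assume "t \<in> {j \<in> D. rank w D j < k}" "z \<in> D - {j \<in> D. rank w D j < k}"
  then have "rank w D t < rank w D z" "t \<in> D" "z \<in> D" by auto
  then show "w z \<le> w t" using rank_less_iff[OF assms(1)] before_imp_ge by blast
qed auto

text \<open>Hall's condition, in the case where it is met greedily in the order of the values of \<open>S\<close>.\<close>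

lemma sum_le_sum_of_card:
  fixes p :: "'b \<Rightarrow> real" and S :: "'a \<Rightarrow> nat"
  assumes "finite F" "inj_on S F" "finite Q" "\<And>q. q \<in> Q \<Longrightarrow> 0 \<le> p q"
    and card: "\<And>j. j \<in> F \<Longrightarrow> S j < card {q \<in> Q. y j \<le> p q}"
  shows "sum y F \<le> sum p Q"
proof -
  have "\<exists>g. inj_on g {j \<in> F. S j < k} \<and> (\<forall>j\<in>{j \<in> F. S j < k}. g j \<in> Q \<and> y j \<le> p (g j))" for k
  proof (induction k)
    case (Suc k)
    then obtain g where g: "inj_on g {j \<in> F. S j < k}"
      "\<And>j. j \<in> F \<Longrightarrow> S j < k \<Longrightarrow> g j \<in> Q \<and> y j \<le> p (g j)" by blast
    show ?case
    proof (cases "\<exists>j\<in>F. S j = k")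
      case True
      then obtain j where j: "j \<in> F" "S j = k" by blast
      have eq: "{i \<in> F. S i < Suc k} = insert j {i \<in> F. S i < k}"
        using j assms(2) by (auto simp: less_Suc_eq inj_on_def)
      have "card (g ` {i \<in> F. S i < k}) \<le> card {i \<in> F. S i < k}"
        using assms(1) by (intro card_image_le) auto
      also have "\<dots> \<le> card {..<k}"
        using assms(1,2) by (intro card_inj_on_le[of S]) (auto simp: inj_on_def)
      finally have "card (g ` {i \<in> F. S i < k}) < card {q \<in> Q. y j \<le> p q}"
        using card[OF j(1)] j(2) by simp
      moreover have "finite (g ` {i \<in> F. S i < k})" using assms(1) by simp
      \<comment> \<open>Since \<open>S\<close> is injective, at most \<open>k\<close> elements of
        \<open>Q\<close> are taken when the value \<open>k\<close> is reached, but more than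
        \<open>k\<close> are admissible.\<close>
      ultimately obtain q where q: "q \<in> Q" "y j \<le> p q" "q \<notin> g ` {i \<in> F. S i < k}"
        by (metis (no_types, lifting) card_mono leD mem_Collect_eq subsetI)
      show ?thesis unfolding eq
        using g q j by (intro exI[of _ "g(j := q)"]) (auto simp: inj_on_def)
    next
      case False
      then have "{i \<in> F. S i < Suc k} = {i \<in> F. S i < k}" by (auto simp: less_Suc_eq)
      then show ?thesis using Suc by simp
    qed
  qed simp
  moreover have "{j \<in> F. S j < Suc (Max (S ` F))} = F"
    using assms(1) by (auto simp: less_Suc_eq_le)
  ultimately obtain g where g: "inj_on g F" "\<And>j. j \<in> F \<Longrightarrow> g j \<in> Q \<and> y j \<le> p (g j)"
    by metis
  have "sum y F \<le> (\<Sum>j\<in>F. p (g j))" using g by (intro sum_mono) auto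
  also have "\<dots> = sum p (g ` F)" using g by (simp add: sum.reindex)
  also have "\<dots> \<le> sum p Q" using g assms by (intro sum_mono2) auto
  finally show ?thesis .
qed

lemma sum_nat_fibres:
  fixes f :: "'a \<Rightarrow> 'b::comm_monoid_add"
  assumes "finite D" "finite U"
  shows "(\<Sum>q\<in>U. \<Sum>j | j \<in> D \<and> S j = q. f j) = (\<Sum>j | j \<in> D \<and> S j \<in> U. f j)"
proof -
  have "(\<Sum>q\<in>U. sum f {j \<in> {j \<in> D. S j \<in> U}. S j = q}) = sum f {j \<in> D. S j \<in> U}"
    using assms by (intro sum.group) auto
  moreover have "sum f {j \<in> {j \<in> D. S j \<in> U}. S j = q} = sum f {j \<in> D. S j = q}" if "q \<in> U" for q
    using that by (intro sum.cong) auto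
  ultimately show ?thesis by simp
qed

section \<open>The scheduling algorithm\<close>

locale scheduling =
  fixes n c b d :: nat and ld dm :: "nat \<Rightarrow> nat"
begin

definition big :: "nat \<Rightarrow> nat \<Rightarrow> bool" where
  "big m j \<longleftrightarrow> m < b * ld j"

text \<open>For \<open>d = 2\<close> the threshold is 2m/3. For \<open>d = 0\<close> no job of
  positive load qualifies, which switches pairing off for the other two ratios.\<close>

definition medium :: "nat \<Rightarrow> nat \<Rightarrow> bool" where
  "medium m j \<longleftrightarrow> big m j \<and> 3 * ld j \<le> d * m"

definition bigs :: "nat \<Rightarrow> nat set" where
  "bigs m = {j. j < n \<and> big m j}"

definition mediums :: "nat \<Rightarrow> nat set" where
  "mediums m = {j. j < n \<and> medium m j}"

text \<open>
  Medium jobs share a core with their neighbour in the order of decreasing loads; the other big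
  jobs are alone in their group.
\<close>

definition group :: "nat \<Rightarrow> nat \<Rightarrow> nat" where
  "group m j = (if medium m j then rank ld (mediums m) j div 2 else n + j)"

definition group_load :: "nat \<Rightarrow> nat \<Rightarrow> nat" where
  "group_load m h = (\<Sum>j | j \<in> bigs m \<and> group m j = h. ld j)"

text \<open>The value \<open>c\<close> marks jobs that are not assigned yet.\<close>

definition big_core :: "nat \<Rightarrow> nat \<Rightarrow> nat" where
  "big_core m j =
     (if big m j then c - 1 - rank (group_load m) {..<2 * n} (group m j) else c)"

text \<open>The inverse of the rank, as a sum over a singleton: in this form \<open>Table\<close>
  can compute it.\<close>

definition ordered :: "nat \<Rightarrow> nat" where
  "ordered t = (\<Sum>i | i < n \<and> rank dm {..<n} i = t. i)"

definition core_load :: "(nat \<Rightarrow> nat) \<Rightarrow> nat \<Rightarrow> nat" where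
  "core_load S i = (\<Sum>j | j < n \<and> S j = i. ld j)"

text \<open>A single move per job is enough: core numbers increase with the big loads, so if any
  core is still below \<open>m\<close>, then so is the next one, which holds only big jobs
  yet.\<close>

fun greedy :: "nat \<Rightarrow> nat \<Rightarrow> nat \<times> (nat \<Rightarrow> nat)" where
  "greedy m 0 = (0, big_core m)"
| "greedy m (Suc t) =
    (let (i, S) = greedy m t; i' = (if m \<le> core_load S i then Suc i else i)
     in if big m (ordered t) then (i, S) else (i', S(ordered t := i')))"

definition schedule :: "nat \<Rightarrow> nat \<Rightarrow> nat" where
  "schedule m = snd (greedy m n)"

text \<open>Selects one job of largest demand on each core in use; its demand is the cache that the
  core receives.\<close>

definition first_on_core :: "(nat \<Rightarrow> nat) \<Rightarrow> nat \<Rightarrow> bool" where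
  "first_on_core S j \<longleftrightarrow> (\<forall>i<n. S i = S j \<longrightarrow> \<not> before dm i j)"

text \<open>The test is carried out by the program, hence loads are checked only on cores
  \<open>S j\<close> that hold a job. The load bound is \<alpha>m without fractions.\<close>

definition acceptable :: "nat \<Rightarrow> nat \<Rightarrow> (nat \<Rightarrow> nat) \<Rightarrow> bool" where
  "acceptable K m S \<longleftrightarrow>
     (\<forall>j<n. S j < c \<and> b * core_load S (S j) \<le> (b + 1) * m) \<and>
     (\<Sum>j | j < n \<and> first_on_core S j. dm j) \<le> b * K"

lemma finite_bigs [simp]: "finite (bigs m)" and finite_mediums [simp]: "finite (mediums m)"
  by (simp_all add: bigs_def mediums_def)

lemma mediums_subset: "mediums m \<subseteq> bigs m"
  by (auto simp: bigs_def mediums_def medium_def)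

lemma card_mediums_le: "card (mediums m) \<le> n"
  using card_mono[of "{..<n}" "mediums m"] by (force simp: mediums_def)

lemma group_medium_less: "j \<in> mediums m \<Longrightarrow> group m j < (card (mediums m) + 1) div 2"
  using rank_less_card[of "mediums m" j ld] by (simp add: group_def mediums_def)

text \<open>Keeps the labels of pairs apart from the labels \<open>n + j\<close> of single
  jobs.\<close>

lemma group_medium_less': "j \<in> mediums m \<Longrightarrow> group m j < n"
  using group_medium_less[of j m] card_mediums_le[of m] by linarith

lemma group_less: "j < n \<Longrightarrow> group m j < 2 * n"
  using group_medium_less'[of j m] by (fastforce simp: group_def mediums_def)

lemma ordered:
  assumes "t < n"
  shows "ordered t < n" "rank dm {..<n} (ordered t) = t"
proof -
  have "t \<in> rank dm {..<n} ` {..<n}"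
    using rank_bij_betw[of "{..<n}" dm] assms by (simp add: bij_betw_def)
  then obtain i where i: "i < n" "rank dm {..<n} i = t" by auto
  have "{i. i < n \<and> rank dm {..<n} i = t} = {i}"
    using i rank_bij_betw[of "{..<n}" dm] by (auto simp: bij_betw_def inj_on_def)
  then show "ordered t < n" "rank dm {..<n} (ordered t) = t"
    using i by (simp_all add: ordered_def)
qed

lemma sum_group_load:
  "finite H \<Longrightarrow> (\<Sum>h\<in>H. group_load m h) = (\<Sum>j | j \<in> bigs m \<and> group m j \<in> H. ld j)"
  unfolding group_load_def by (rule sum_nat_fibres) simp

lemma inj_on_first_on_core: "inj_on S {j. j < n \<and> first_on_core S j}"
proof (rule inj_onI)
  fix i j assume *: "i \<in> {j. j < n \<and> first_on_core S j}" "j \<in> {j. j < n \<and> first_on_core S j}" "S i = S j"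
  then have "\<not> before dm i j" "\<not> before dm j i" by (auto simp: first_on_core_def)
  then show "i = j" using before_linear by blast
qed

text \<open>The job of least rank on the core of \<open>j\<close> qualifies. Hence cache for the
  first jobs serves all jobs.\<close>

lemma first_on_core_exists:
  assumes "j < n"
  shows "\<exists>i<n. S i = S j \<and> first_on_core S i \<and> dm j \<le> dm i"
proof -
  let ?D = "{i. i < n \<and> S i = S j}"
  have "finite ?D" "j \<in> ?D" using assms by auto
  define i where "i = arg_min_on (rank dm ?D) ?D"
  have i: "i \<in> ?D"
    unfolding i_def using \<open>finite ?D\<close> \<open>j \<in> ?D\<close> arg_min_if_finite(1)[of ?D] by blast
  have "\<not> rank dm ?D k < rank dm ?D i" if "k \<in> ?D" for k
    unfolding i_def using \<open>finite ?D\<close> that arg_min_if_finite(2)[of ?D] by blast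
  then have *: "\<not> before dm k i" if "k \<in> ?D" for k
    using rank_less_iff[OF \<open>finite ?D\<close> that i, of dm] that by blast
  then have "dm j \<le> dm i" using \<open>j \<in> ?D\<close> by (force simp: before_def)
  then show ?thesis using i * by (auto simp: first_on_core_def)
qed

end

text \<open>The solution \<open>S'\<close> need not be optimal for \<open>m\<close>: any
  \<open>m\<close> above its makespan is allowed, so that one optimal solution shows acceptance of
  all larger values at once.\<close>

locale feasible_makespan = scheduling +
  fixes K m :: nat and p :: "nat \<Rightarrow> real" and S' :: "nat \<Rightarrow> nat"
  assumes parameters: "(b, d) \<in> {(1, 0), (2, 0), (3, 2)}"
    and cores_pos: "1 \<le> c"
    and load_pos: "j < n \<Longrightarrow> 0 < ld j"
    and p_nonneg: "i < c \<Longrightarrow> 0 \<le> p i"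
    and p_sum: "(\<Sum>i<c. p i) \<le> real K"
    and S'_less: "j < n \<Longrightarrow> S' j < c"
    and demand: "j < n \<Longrightarrow> real (dm j) \<le> p (S' j)"
    and load: "i < c \<Longrightarrow> core_load S' i \<le> m"
begin

section \<open>Big jobs on the cores of a solution\<close>

lemma no_mediums:
  assumes "d = 0"
  shows "mediums m = {}"
proof -
  have "\<not> medium m j" if "j < n" for j
    unfolding medium_def using load_pos[OF that] assms by simp
  then show ?thesis by (auto simp: mediums_def)
qed

lemma sum_load_on_core_le:
  assumes "q < c" "A \<subseteq> {j. j < n \<and> S' j = q}"
  shows "sum ld A \<le> m"
proof -
  have "sum ld A \<le> core_load S' q"
    unfolding core_load_def using assms by (intro sum_mono2) auto
  then show ?thesis using load[OF assms(1)] by simp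
qed

lemma load_le: "j < n \<Longrightarrow> ld j \<le> m"
  using sum_load_on_core_le[of "S' j" "{j}"] S'_less by simp

text \<open>\<open>b\<close> loads above m/b would exceed \<open>m\<close>. Over the integers a big
  job has \<open>b * ld j \<ge> m + 1\<close>, which yields a strict inequality even for
  \<open>m = 0\<close>.\<close>

lemma card_bigs_on_core:
  assumes "q < c"
  shows "card {j \<in> bigs m. S' j = q} < b"
proof -
  let ?A = "{j \<in> bigs m. S' j = q}"
  have "card ?A * (m + 1) \<le> (\<Sum>j\<in>?A. b * ld j)"
    using sum_bounded_below[of ?A "m + 1" "\<lambda>j. b * ld j"] by (auto simp: bigs_def big_def)
  also have "\<dots> = b * sum ld ?A" by (simp add: sum_distrib_left)
  also have "\<dots> \<le> b * m"
    using assms by (intro mult_left_mono sum_load_on_core_le) (auto simp: bigs_def)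
  also have "\<dots> < b * (m + 1)" using parameters by auto
  finally show ?thesis by (simp only: mult_less_cancel2)
qed

text \<open>Core space in units of half a core: two medium jobs can share a core, any other big job
  occupies one alone.\<close>

definition halves :: "nat \<Rightarrow> nat" where
  "halves j = (if medium m j then 1 else 2)"

text \<open>For \<open>b = 3\<close> a big job satisfies \<open>m * halves j < 3 * ld j\<close>, and
  the loads add up to at most \<open>m\<close>; the summand \<open>card ?A\<close> keeps track of
  the strictness. Otherwise a core holds at most one big job.\<close>

lemma halves_on_core:
  assumes "q < c"
  shows "(\<Sum>j | j \<in> bigs m \<and> S' j = q. halves j) \<le> 2"
proof -
  let ?A = "{j \<in> bigs m. S' j = q}"
  show ?thesis
  proof (cases "b = 3")
    case True
    then have d: "d = 2" using parameters by auto
    have "m * sum halves ?A + card ?A = (\<Sum>j\<in>?A. m * halves j + 1)"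
      by (simp only: sum.distrib sum_distrib_left card_eq_sum)
    also have "\<dots> \<le> (\<Sum>j\<in>?A. 3 * ld j)"
      unfolding bigs_def big_def medium_def halves_def using True d by (intro sum_mono) auto
    also have "\<dots> = 3 * sum ld ?A" by (simp add: sum_distrib_left)
    also have "\<dots> \<le> 3 * m"
      using assms by (intro mult_left_mono sum_load_on_core_le) (auto simp: bigs_def)
    finally have *: "m * sum halves ?A + card ?A \<le> 3 * m" .
    show ?thesis
    proof (rule ccontr)
      assume "\<not> ?thesis"
      then have 3: "3 \<le> sum halves ?A" by simp
      then have "m * 3 \<le> m * sum halves ?A" by (rule mult_left_mono) simp
      with * have "card ?A = 0" by linarith
      then have "?A = {}" by simp
      then have "sum halves ?A = 0" by (simp only: sum.empty)
      then show False using 3 by simp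
    qed
  next
    case False
    then have "sum halves ?A \<le> card ?A * 2"
      using sum_bounded_above[of ?A halves 2] by (simp add: halves_def)
    also have "card ?A \<le> 1" using card_bigs_on_core[OF assms] False parameters by auto
    finally show ?thesis by simp
  qed
qed

text \<open>Limits the number of groups that the big jobs on \<open>U\<close> require: the singles
  plus half of the medium jobs, rounded up, are at most \<open>card U\<close>.\<close>

lemma halves_on_cores:
  assumes "U \<subseteq> {..<c}"
  shows "2 * card {j \<in> bigs m - mediums m. S' j \<in> U} + card {j \<in> mediums m. S' j \<in> U}
    \<le> 2 * card U"
proof -
  let ?A = "{j \<in> bigs m. S' j \<in> U}"
  let ?L = "{j \<in> bigs m - mediums m. S' j \<in> U}" and ?M = "{j \<in> mediums m. S' j \<in> U}"
  have fin: "finite U" using assms finite_subset by blast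
  have "?A = ?L \<union> ?M" using mediums_subset by auto
  then have "sum halves ?A = sum halves ?L + sum halves ?M"
    by (simp only:) (rule sum.union_disjoint, auto)
  moreover have "sum halves ?L = (\<Sum>j\<in>?L. 2)"
    by (rule sum.cong) (auto simp: halves_def mediums_def bigs_def)
  moreover have "sum halves ?M = (\<Sum>j\<in>?M. 1)"
    by (rule sum.cong) (auto simp: halves_def mediums_def bigs_def)
  moreover have "sum halves ?A = (\<Sum>q\<in>U. \<Sum>j | j \<in> bigs m \<and> S' j = q. halves j)"
    using fin by (simp add: sum_nat_fibres)
  moreover have "\<dots> \<le> (\<Sum>q\<in>U. 2)"
    using assms by (intro sum_mono halves_on_core) auto
  ultimately show ?thesis by simp
qed

abbreviation group_rank :: "nat \<Rightarrow> nat" where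
  "group_rank \<equiv> rank (group_load m) {..<2 * n}"

text \<open>Only groups of positive load can precede the group of a big job, and counting halves on
  all cores shows that there are at most \<open>c\<close> nonempty groups. Hence the truncated
  subtraction in \<open>big_core\<close> is exact and distinct groups get distinct cores.\<close>

lemma group_rank_less:
  assumes "j \<in> bigs m"
  shows "group_rank (group m j) < c"
proof -
  let ?L = "bigs m - mediums m" and ?k = "(card (mediums m) + 1) div 2"
  have pos: "0 < ld j" "j < n" using assms load_pos by (auto simp: bigs_def)
  then have "0 < group_load m (group m j)"
    unfolding group_load_def using assms by (subst sum_pos2[of _ j]) auto
  moreover have "h \<in> group m ` bigs m" if "0 < group_load m h" for h
  proof (rule ccontr)
    assume "h \<notin> group m ` bigs m"
    then have "{j. j \<in> bigs m \<and> group m j = h} = {}" by auto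
    then show False using that by (simp only: group_load_def sum.empty)
  qed
  ultimately have "{h \<in> {..<2 * n}. before (group_load m) h (group m j)} \<subseteq> group m ` bigs m"
    using before_imp_ge by fastforce
  then have "{h \<in> {..<2 * n}. before (group_load m) h (group m j)} \<subset> group m ` bigs m"
    using assms before_irrefl by blast
  then have "group_rank (group m j) < card (group m ` bigs m)"
    unfolding rank_def by (intro psubset_card_mono) auto
  also have "\<dots> \<le> card ((\<lambda>j. n + j) ` ?L \<union> {..<?k})"
  proof (intro card_mono subsetI)
    fix h assume "h \<in> group m ` bigs m"
    then obtain i where i: "i \<in> bigs m" "h = group m i" by blast
    then show "h \<in> (\<lambda>j. n + j) ` ?L \<union> {..<?k}"
      using group_medium_less[of i m] by (cases "i \<in> mediums m") (auto simp: group_def mediums_def bigs_def)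
  qed auto
  also have "\<dots> \<le> card ?L + ?k"
    by (rule order.trans[OF card_Un_le]) (simp add: card_image_le)
  also have "\<dots> \<le> c"
  proof -
    have "{j \<in> bigs m - mediums m. S' j \<in> {..<c}} = ?L" "{j \<in> mediums m. S' j \<in> {..<c}} = mediums m"
      using S'_less by (auto simp: bigs_def mediums_def)
    then show ?thesis using halves_on_cores[of "{..<c}"] by simp
  qed
  finally show ?thesis .
qed

section \<open>Big loads of the schedule and their majorization\<close>

definition B :: "nat \<Rightarrow> nat" where
  "B = core_load (big_core m)"

lemma big_core_less: "j \<in> bigs m \<Longrightarrow> big_core m j < c"
  using cores_pos by (simp add: big_core_def bigs_def)

lemma sum_B:
  assumes "I \<subseteq> {..<c}"
  shows "sum B I = (\<Sum>j | j \<in> bigs m \<and> big_core m j \<in> I. ld j)"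
proof -
  have "finite I" using assms finite_subset by blast
  then have "sum B I = (\<Sum>j | j \<in> {..<n} \<and> big_core m j \<in> I. ld j)"
    unfolding B_def core_load_def using sum_nat_fibres[of "{..<n}" I ld "big_core m"] by simp
  also have "\<dots> = (\<Sum>j | j \<in> bigs m \<and> big_core m j \<in> I. ld j)"
    using assms by (intro sum.cong) (auto simp: bigs_def big_core_def split: if_splits)
  finally show ?thesis .
qed

lemma B_eq:
  assumes "i < c"
  shows "B i = (\<Sum>h | h < 2 * n \<and> group_rank h = c - 1 - i. group_load m h)"
proof -
  have "B i = (\<Sum>j | j \<in> bigs m \<and> big_core m j \<in> {i}. ld j)"
    using sum_B[of "{i}"] assms by simp
  also have "\<dots> = (\<Sum>j | j \<in> bigs m \<and> group m j \<in> {h. h < 2 * n \<and> group_rank h = c - 1 - i}. ld j)"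
  proof (rule sum.cong)
    have "big_core m j = i \<longleftrightarrow> group_rank (group m j) = c - 1 - i" "group m j < 2 * n"
      if "j \<in> bigs m" for j
      using group_rank_less[OF that] that assms group_less by (auto simp: big_core_def bigs_def)
    then show "{j \<in> bigs m. big_core m j \<in> {i}} =
      {j \<in> bigs m. group m j \<in> {h. h < 2 * n \<and> group_rank h = c - 1 - i}}" by auto
  qed simp
  also have "\<dots> = (\<Sum>h | h < 2 * n \<and> group_rank h = c - 1 - i. group_load m h)"
    by (subst sum_group_load) auto
  finally show ?thesis .
qed

lemma B_cases:
  assumes "i < c"
  obtains "B i = 0" "2 * n \<le> c - 1 - i" | h where "h < 2 * n" "group_rank h = c - 1 - i" "B i = group_load m h"
proof (cases "\<exists>h<2 * n. group_rank h = c - 1 - i")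
  case True
  then obtain h where h: "h < 2 * n" "group_rank h = c - 1 - i" by blast
  then have "{h. h < 2 * n \<and> group_rank h = c - 1 - i} = {h}"
    using rank_bij_betw[of "{..<2 * n}" "group_load m"] by (auto simp: bij_betw_def inj_on_def)
  then show ?thesis using h that(2) B_eq[OF assms] by simp
next
  case False
  then have "{h. h < 2 * n \<and> group_rank h = c - 1 - i} = {}" by auto
  then have "B i = 0" using B_eq[OF assms] by (simp only: sum.empty)
  moreover have "c - 1 - i \<notin> group_rank ` {..<2 * n}" using False by auto
  then have "2 * n \<le> c - 1 - i"
    using rank_bij_betw[of "{..<2 * n}" "group_load m"] by (auto simp: bij_betw_def)
  ultimately show ?thesis by (rule that(1))
qed

text \<open>Groups are placed from the last core downwards in the order of decreasing loads, so a
  core without a group cannot lie behind a core with one.\<close>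

lemma B_mono:
  assumes "i \<le> i'" "i' < c"
  shows "B i \<le> B i'"
proof -
  from assms have "i < c" by simp
  then show ?thesis
  proof (cases rule: B_cases)
    case (2 h)
    show ?thesis
    proof (cases rule: B_cases[OF assms(2)])
      case 1
      then show ?thesis using rank_less_card[of "{..<2 * n}" h "group_load m"] 2 assms by simp
    next
      case h': (2 h')
      have "\<not> group_rank h < group_rank h'" using 2 h' assms by (simp add: not_less diff_le_mono2)
      then have "\<not> before (group_load m) h h'"
        using rank_less_iff[of "{..<2 * n}" h h' "group_load m"] 2 h' by simp
      then show ?thesis using 2 h' by (auto simp: before_def)
    qed
  qed simp
qed

text \<open>Labels below \<open>n\<close> belong to at most two medium jobs, of load at most 2m/3
  each, which together give exactly the permitted 4m/3. Any other label belongs to at most one job,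
  whose load is at most \<open>m\<close> because the solution carries it.\<close>

lemma group_load_le: "b * group_load m h \<le> (b + 1) * m"
proof (cases "h < n")
  case True
  let ?A = "{j \<in> mediums m. rank ld (mediums m) j div 2 = h}"
  have eq: "{j. j \<in> bigs m \<and> group m j = h} = ?A"
    using True mediums_subset by (auto simp: group_def bigs_def mediums_def split: if_splits)
  show ?thesis
  proof (cases "d = 0")
    case True
    then have "group_load m h = 0" unfolding group_load_def eq using no_mediums by simp
    then show ?thesis by simp
  next
    case False
    then have bd: "b = 3" "d = 2" using parameters by auto
    have "card ?A \<le> card {2 * h, 2 * h + 1}"
      using rank_bij_betw[of "mediums m" ld]
      by (intro card_inj_on_le[of "rank ld (mediums m)"]) (auto simp: bij_betw_def inj_on_def)
    then have card: "card ?A \<le> 2" by simp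
    have "3 * ld j \<le> 2 * m" if "j \<in> ?A" for j
      using that bd(2) unfolding mediums_def medium_def by auto
    then have bound: "(\<Sum>j\<in>?A. 3 * ld j) \<le> card ?A * (2 * m)"
      using sum_bounded_above[of ?A "\<lambda>j. 3 * ld j" "2 * m"] by simp
    have "3 * group_load m h = (\<Sum>j\<in>?A. 3 * ld j)"
      unfolding group_load_def eq by (simp add: sum_distrib_left)
    also have "\<dots> \<le> card ?A * (2 * m)"
      by (rule bound)
    also have "\<dots> \<le> 2 * (2 * m)" using card by (intro mult_right_mono) auto
    finally show ?thesis using bd by simp
  qed
next
  case False
  then have "{j. j \<in> bigs m \<and> group m j = h} \<subseteq> {h - n} \<inter> {..<n}"
    using group_medium_less'[of _ m] by (fastforce simp: group_def bigs_def mediums_def)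
  then have "group_load m h \<le> sum ld ({h - n} \<inter> {..<n})"
    unfolding group_load_def by (intro sum_mono2) auto
  also have "\<dots> \<le> m" using load_le by (cases "h - n < n") auto
  finally have "b * group_load m h \<le> b * m" by (rule mult_le_mono2)
  also have "\<dots> \<le> (b + 1) * m" by simp
  finally show ?thesis .
qed

lemma B_le:
  assumes "i < c"
  shows "b * B i \<le> (b + 1) * m"
proof (cases rule: B_cases[OF assms])
  case (2 h)
  then show ?thesis using group_load_le[of h] by (simp only:)
qed simp

text \<open>
  The big loads of our schedule majorize those of any solution: pairing the largest medium jobs
  concentrates the load, hence also the free space on the other cores.
\<close>

lemma sum_big_loads_le:
  assumes U: "U \<subseteq> {..<c}"
  shows "(\<Sum>j | j \<in> bigs m \<and> S' j \<in> U. ld j) \<le> sum B {c - card U..<c}"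
proof -
  let ?L = "{j \<in> bigs m - mediums m. S' j \<in> U}" and ?M = "{j \<in> mediums m. S' j \<in> U}"
  \<comment> \<open>The medium jobs on \<open>U\<close> are replaced by the largest ones; rounding
    their number up to the even number \<open>2 * ?k\<close> makes them the members of the first
    \<open>?k\<close> pairs.\<close>
  let ?k = "(card ?M + 1) div 2"
  let ?T = "{j \<in> mediums m. rank ld (mediums m) j < 2 * ?k}"
  let ?Z = "(\<lambda>j. n + j) ` ?L \<union> {..<?k}"
  have le: "card ?L + ?k \<le> card U" using halves_on_cores[OF U] by linarith
  have cU: "card U \<le> c" using card_mono[OF _ U] by simp
  have "{j. j \<in> bigs m \<and> S' j \<in> U} = ?L \<union> ?M" using mediums_subset by auto
  then have "(\<Sum>j | j \<in> bigs m \<and> S' j \<in> U. ld j) = sum ld ?L + sum ld ?M"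
    by (simp only:) (rule sum.union_disjoint, auto)
  also have "\<dots> \<le> sum ld ?L + sum ld ?T"
  proof (rule add_left_mono, rule sum_le_sum_rank_less)
    show "card ?M \<le> 2 * ?k" by linarith
  qed auto
  also have "\<dots> = sum ld (?L \<union> ?T)"
    by (rule sum.union_disjoint[symmetric]) auto
  also have "\<dots> \<le> (\<Sum>j | j \<in> bigs m \<and> group m j \<in> ?Z. ld j)"
  proof (intro sum_mono2 subsetI)
    fix j assume "j \<in> ?L \<union> ?T"
    then consider "j \<in> ?L" | "j \<in> ?T" by blast
    then show "j \<in> {j. j \<in> bigs m \<and> group m j \<in> ?Z}"
    proof cases
      case 1
      then have "group m j = n + j" by (auto simp: group_def mediums_def bigs_def)
      then show ?thesis using 1 by blast
    next
      case 2
      then have "group m j = rank ld (mediums m) j div 2" by (auto simp: group_def mediums_def)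
      moreover have "\<dots> < ?k" using 2 by (intro less_mult_imp_div_less) (simp add: mult.commute)
      ultimately show ?thesis using 2 mediums_subset by auto
    qed
  qed auto
  also have "\<dots> = sum (group_load m) ?Z" by (rule sum_group_load[symmetric]) simp
  \<comment> \<open>A second exchange, now of groups: at most \<open>card U\<close> of them are
    replaced by the heaviest ones, which sit on the last \<open>card U\<close> cores.\<close>
  also have "\<dots> \<le> sum (group_load m) {h \<in> {..<2 * n}. group_rank h < card U}"
  proof (rule sum_le_sum_rank_less)
    have "card ?M \<le> card (mediums m)" by (rule card_mono) auto
    then have "?k \<le> n" using card_mediums_le[of m] by linarith
    moreover have "n + j < 2 * n" if "j \<in> ?L" for j using that by (simp add: bigs_def)
    ultimately show "?Z \<subseteq> {..<2 * n}" by fastforce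
    have "card ?Z \<le> card ?L + ?k"
      by (rule order.trans[OF card_Un_le]) (simp add: card_image_le)
    then show "card ?Z \<le> card U" using le by simp
  qed simp
  also have "\<dots> = (\<Sum>j | j \<in> bigs m \<and> group m j \<in> {h \<in> {..<2 * n}. group_rank h < card U}. ld j)"
    by (rule sum_group_load) simp
  also have "\<dots> = (\<Sum>j | j \<in> bigs m \<and> big_core m j \<in> {c - card U..<c}. ld j)"
  proof (rule sum.cong)
    have "big_core m j \<in> {c - card U..<c} \<longleftrightarrow> group_rank (group m j) < card U" "group m j < 2 * n"
      if "j \<in> bigs m" for j
      using group_rank_less[OF that] that cU group_less by (auto simp: big_core_def bigs_def)
    then show "{j \<in> bigs m. group m j \<in> {h \<in> {..<2 * n}. group_rank h < card U}} =
       {j \<in> bigs m. big_core m j \<in> {c - card U..<c}}" by auto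
  qed simp
  also have "\<dots> = sum B {c - card U..<c}" by (rule sum_B[symmetric]) auto
  finally show ?thesis by simp
qed

section \<open>The greedy pass over the small jobs\<close>

lemma total_load: "sum ld {..<n} \<le> c * m"
proof -
  have "sum ld {..<n} = (\<Sum>q<c. core_load S' q)"
    unfolding core_load_def using sum_nat_fibres[of "{..<n}" "{..<c}" ld S'] S'_less
    by (auto intro: sum.cong)
  also have "\<dots> \<le> (\<Sum>q<c. m)" using load by (intro sum_mono) auto
  finally show ?thesis by simp
qed

definition smalls_done :: "nat \<Rightarrow> nat set" where
  "smalls_done t = {j. j < n \<and> \<not> big m j \<and> rank dm {..<n} j < t}"

text \<open>The last conjunct is the hypothesis of \<open>sum_le_sum_of_card\<close>: with cores
  numbered from 0, a small job on core \<open>i\<close> has more than \<open>i\<close> cores of the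
  solution with enough cache for it.\<close>

definition progress :: "nat \<Rightarrow> nat \<Rightarrow> (nat \<Rightarrow> nat) \<Rightarrow> bool" where
  "progress t i S \<longleftrightarrow>
     i < c \<and>
     (\<forall>j\<in>bigs m. S j = big_core m j) \<and>
     (\<forall>j\<in>smalls_done t. S j \<le> i) \<and>
     (\<forall>j<n. j \<notin> bigs m \<longrightarrow> j \<notin> smalls_done t \<longrightarrow> S j = c) \<and>
     (\<forall>k<i. m \<le> core_load S k) \<and>
     (\<forall>k<c. b * core_load S k \<le> (b + 1) * m) \<and>
     (\<forall>j\<in>smalls_done t. S j < card {q \<in> {..<c}. real (dm j) \<le> p q})"

lemma finite_smalls_done [simp]: "finite (smalls_done t)"
  by (simp add: smalls_done_def)

lemma smalls_done_Suc:
  assumes "t < n"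
  shows "smalls_done (Suc t) =
    (if big m (ordered t) then smalls_done t else insert (ordered t) (smalls_done t))"
proof -
  have "rank dm {..<n} j = t \<longleftrightarrow> j = ordered t" if "j < n" for j
    using that ordered[OF assms] rank_bij_betw[of "{..<n}" dm] by (auto simp: bij_betw_def inj_on_def)
  then have "{j. j < n \<and> \<not> big m j \<and> rank dm {..<n} j = t} = {j. j < n \<and> \<not> big m j \<and> j = ordered t}"
    by blast
  moreover have "smalls_done (Suc t) = smalls_done t \<union> {j. j < n \<and> \<not> big m j \<and> rank dm {..<n} j = t}"
    by (auto simp: smalls_done_def less_Suc_eq)
  ultimately show ?thesis using ordered(1)[OF assms] by auto
qed

text \<open>The marker \<open>c\<close> of unassigned jobs lies outside \<open>I\<close>, so only
  big jobs and small jobs already placed contribute.\<close>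

lemma sum_core_load:
  assumes "progress t i S" "I \<subseteq> {..<c}"
  shows "sum (core_load S) I = sum B I + (\<Sum>j | j \<in> smalls_done t \<and> S j \<in> I. ld j)"
proof -
  have "finite I" using assms finite_subset by blast
  then have "sum (core_load S) I = (\<Sum>j | j \<in> {..<n} \<and> S j \<in> I. ld j)"
    unfolding core_load_def using sum_nat_fibres[of "{..<n}" I ld S] by simp
  also have "{j. j \<in> {..<n} \<and> S j \<in> I} =
      {j. j \<in> bigs m \<and> big_core m j \<in> I} \<union> {j. j \<in> smalls_done t \<and> S j \<in> I}"
  proof -
    have "S j = c" if "j < n" "j \<notin> bigs m" "j \<notin> smalls_done t" for j
      using assms(1) that by (simp add: progress_def)
    moreover have "S j = big_core m j" if "j \<in> bigs m" for j
      using assms(1) that by (simp add: progress_def)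
    moreover have "j < n" if "j \<in> bigs m \<or> j \<in> smalls_done t" for j
      using that by (auto simp: bigs_def smalls_done_def)
    moreover have "c \<notin> I" using assms(2) by auto
    ultimately show ?thesis by auto metis
  qed
  also have "sum ld \<dots> = sum B I + (\<Sum>j | j \<in> smalls_done t \<and> S j \<in> I. ld j)"
    unfolding sum_B[OF assms(2)]
    by (rule sum.union_disjoint) (auto simp: bigs_def smalls_done_def)
  finally show ?thesis .
qed

text \<open>A job still unassigned has positive load, so the cores carry strictly less than the
  total load, which is at most \<open>c * m\<close>.\<close>

lemma underloaded_core:
  assumes "progress t i S" "j < n" "S j = c"
  shows "\<exists>k<c. core_load S k < m"
proof (rule ccontr)
  assume "\<not> ?thesis"
  then have "(\<Sum>k<c. m) \<le> (\<Sum>k<c. core_load S k)" by (intro sum_mono) auto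
  also have "\<dots> = (\<Sum>j | j \<in> {..<n} \<and> S j \<in> {..<c}. ld j)"
    unfolding core_load_def using sum_nat_fibres[of "{..<n}" "{..<c}" ld S] by simp
  also have "\<dots> \<le> sum ld ({..<n} - {j})" using assms(3) by (intro sum_mono2) auto
  also have "\<dots> < sum ld {..<n}"
    using assms(2) load_pos[OF assms(2)] by (intro sum_strict_mono2[of _ _ j]) auto
  finally show False using total_load by simp
qed

text \<open>
  A small job that reaches core \<open>i\<close> finds the cores before \<open>i\<close> full, so by majorization the
  small jobs seen so far do not fit on any \<open>i\<close> cores of a solution.
\<close>

lemma card_cores_for_small:
  assumes P: "progress t i S" and j: "j < n" "\<not> big m j" "rank dm {..<n} j = t"
    and k: "k < c" "\<And>l. l < k \<Longrightarrow> m \<le> core_load S l"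
  shows "k < card {q \<in> {..<c}. real (dm j) \<le> p q}"
proof (rule ccontr)
  let ?T = "{q \<in> {..<c}. real (dm j) \<le> p q}"
  assume "\<not> ?thesis"
  then have "card ?T \<le> k" by simp
  moreover have "k \<le> card {..<c}" using k by simp
  \<comment> \<open>Enlarging to exactly \<open>k\<close> cores leaves a complement of
    \<open>c - k\<close> cores, to be compared with the cores \<open>{k..<c}\<close> of the schedule
    by majorization.\<close>
  ultimately obtain T where T: "?T \<subseteq> T" "T \<subseteq> {..<c}" "card T = k"
    using exists_subset_between[of ?T k "{..<c}"] by auto
  let ?big = "\<lambda>U. \<Sum>j | j \<in> bigs m \<and> S' j \<in> U. ld j"
  let ?D = "smalls_done t"
  have finT: "finite T" using T finite_subset by blast
  have "card ({..<c} - T) = c - k" using T finT by (simp add: card_Diff_subset)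
  then have 1: "?big ({..<c} - T) \<le> sum B {k..<c}"
    using sum_big_loads_le[of "{..<c} - T"] k by simp
  have "sum ld (bigs m) = ?big T + ?big ({..<c} - T)"
  proof -
    have "bigs m = {j \<in> bigs m. S' j \<in> T} \<union> {j \<in> bigs m. S' j \<in> {..<c} - T}"
      using S'_less by (auto simp: bigs_def)
    then have "sum ld (bigs m) = sum ld ({j \<in> bigs m. S' j \<in> T} \<union> {j \<in> bigs m. S' j \<in> {..<c} - T})"
      by (rule arg_cong)
    also have "\<dots> = ?big T + ?big ({..<c} - T)" by (rule sum.union_disjoint) auto
    finally show ?thesis .
  qed
  moreover have "sum ld (bigs m) = sum B {..<c}"
  proof -
    have "{j \<in> bigs m. big_core m j \<in> {..<c}} = bigs m" using big_core_less by auto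
    then show ?thesis using sum_B[of "{..<c}"] by simp
  qed
  moreover have "sum B {..<c} = sum B {..<k} + sum B {k..<c}"
    using k(1) sum.atLeastLessThan_concat[of 0 k c B] by (simp add: atLeast0LessThan)
  ultimately have 2: "sum B {..<k} \<le> ?big T" using 1 by simp
  have "k * m \<le> sum (core_load S) {..<k}"
    using sum_bounded_below[of "{..<k}" m "core_load S"] k(2) by simp
  also have "\<dots> = sum B {..<k} + (\<Sum>j | j \<in> ?D \<and> S j \<in> {..<k}. ld j)"
    using k(1) by (intro sum_core_load[OF P]) auto
  also have "\<dots> \<le> ?big T + sum ld ?D"
    by (intro add_mono 2 sum_mono2) auto
  finally have 3: "k * m \<le> ?big T + sum ld ?D" .
  \<comment> \<open>The small jobs up to \<open>j\<close> have at least the demand of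
    \<open>j\<close>, so the solution must put all of them on \<open>T\<close>, next to its big jobs
    there. As the first \<open>k\<close> cores are already full, this overloads \<open>T\<close> by
    at least \<open>ld j\<close>.\<close>
  have small: "S' l \<in> T" if "l \<in> insert j ?D" for l
  proof -
    have "l < n" using that j by (auto simp: smalls_done_def)
    have "dm j \<le> dm l"
    proof (cases "l = j")
      case False
      then have "rank dm {..<n} l < rank dm {..<n} j" using that j by (auto simp: smalls_done_def)
      then show ?thesis
        using rank_less_iff[of "{..<n}" l j dm] \<open>l < n\<close> j before_imp_ge by simp
    qed simp
    then have "real (dm j) \<le> p (S' l)" using demand[OF \<open>l < n\<close>] by linarith
    then show ?thesis using T(1) S'_less[OF \<open>l < n\<close>] by auto
  qed
  have "?big T + (ld j + sum ld ?D) = ?big T + sum ld (insert j ?D)"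
    using j by (simp add: smalls_done_def)
  also have "\<dots> = sum ld ({l. l \<in> bigs m \<and> S' l \<in> T} \<union> insert j ?D)"
    using j by (intro sum.union_disjoint[symmetric]) (auto simp: bigs_def smalls_done_def)
  also have "\<dots> \<le> (\<Sum>l | l \<in> {..<n} \<and> S' l \<in> T. ld l)"
    using small j by (intro sum_mono2) (auto simp: bigs_def smalls_done_def)
  also have "\<dots> = sum (core_load S') T"
    unfolding core_load_def using sum_nat_fibres[of "{..<n}" T ld S'] finT by simp
  also have "\<dots> \<le> (\<Sum>q\<in>T. m)" using load T by (intro sum_mono) auto
  also have "\<dots> = k * m" using T by simp
  finally show False using 3 load_pos[OF j(1)] by simp
qed

text \<open>The chosen core has load below \<open>m\<close>, and the small job adds at most m/b.
  That the core exists and is below \<open>m\<close> follows by comparison with an underloaded core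
  \<open>k\<close>, which cannot lie before \<open>i'\<close>.\<close>

lemma progress_Suc:
  assumes P: "progress t i S" and t: "t < n" and small: "\<not> big m (ordered t)"
  defines "i' \<equiv> if m \<le> core_load S i then Suc i else i"
  shows "progress (Suc t) i' (S(ordered t := i'))"
proof -
  let ?j = "ordered t"
  let ?S = "S(?j := i')"
  have j: "?j < n" "rank dm {..<n} ?j = t" using ordered[OF t] by auto
  then have nd: "?j \<notin> smalls_done t" "?j \<notin> bigs m" using small by (auto simp: smalls_done_def bigs_def)
  then have Sj: "S ?j = c" using P j by (simp add: progress_def)
  have P': "i < c" "\<And>j. j \<in> bigs m \<Longrightarrow> S j = big_core m j" "\<And>j. j \<in> smalls_done t \<Longrightarrow> S j \<le> i"
    "\<And>j. j < n \<Longrightarrow> j \<notin> bigs m \<Longrightarrow> j \<notin> smalls_done t \<Longrightarrow> S j = c"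
    "\<And>k. k < i \<Longrightarrow> m \<le> core_load S k" "\<And>k. k < c \<Longrightarrow> b * core_load S k \<le> (b + 1) * m"
    "\<And>j. j \<in> smalls_done t \<Longrightarrow> S j < card {q \<in> {..<c}. real (dm j) \<le> p q}"
    using P by (auto simp: progress_def)
  have full: "m \<le> core_load S k" if "k < i'" for k
    using that P'(5)[of k] by (auto simp: i'_def less_Suc_eq split: if_splits)
  obtain k where k: "k < c" "core_load S k < m"
    using underloaded_core[OF P j(1) Sj] by blast
  have i': "i' < c" "core_load S i' < m"
  proof -
    have "i' \<le> k" using k(2) full[of k] by linarith
    then show "i' < c" using k by simp
    show "core_load S i' < m"
    proof (cases "m \<le> core_load S i")
      case True
      then have eq: "i' = Suc i" by (simp add: i'_def)
      \<comment> \<open>No small job lies beyond core \<open>i\<close> so far, so the load of the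
        next core is its big load, which by monotonicity is at most that of the underloaded core
        \<open>k\<close>.\<close>
      have empty: "{j. j \<in> smalls_done t \<and> S j \<in> {Suc i}} = {}" using P'(3) by fastforce
      have "core_load S i' = B i'"
        using sum_core_load[OF P, of "{Suc i}"] \<open>i' < c\<close> unfolding empty eq by simp
      also have "\<dots> \<le> B k" using B_mono[OF \<open>i' \<le> k\<close> k(1)] .
      also have "\<dots> \<le> core_load S k" using sum_core_load[OF P, of "{k}"] k by simp
      finally show ?thesis using k by simp
    qed (simp add: i'_def)
  qed
  have load_Suc: "core_load ?S l = core_load S l + (if l = i' then ld ?j else 0)" if "l < c" for l
  proof (cases "l = i'")
    case True
    have "{j. j < n \<and> ?S j = l} = insert ?j {j. j < n \<and> S j = l}" "?j \<notin> {j. j < n \<and> S j = l}"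
      using True j Sj that by auto
    then show ?thesis using True by (simp add: core_load_def)
  next
    case False
    then have "{j. j < n \<and> ?S j = l} = {j. j < n \<and> S j = l}" using j Sj that by auto
    then show ?thesis using False by (simp add: core_load_def)
  qed
  have Suc_t: "smalls_done (Suc t) = insert ?j (smalls_done t)"
    using smalls_done_Suc[OF t] small by simp
  show ?thesis unfolding progress_def
  proof (intro conjI ballI allI impI)
    show "i' < c" by fact
    show "?S j = big_core m j" if "j \<in> bigs m" for j using that nd P'(2) by auto
    show "?S j \<le> i'" if "j \<in> smalls_done (Suc t)" for j
      using that P'(3)[of j] Suc_t by (auto simp: i'_def)
    show "?S j = c" if "j < n" "j \<notin> bigs m" "j \<notin> smalls_done (Suc t)" for j
      using that P'(4) Suc_t by auto
    show "m \<le> core_load ?S l" if "l < i'" for l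
      using full[OF that] load_Suc[of l] that i' by simp
    show "b * core_load ?S l \<le> (b + 1) * m" if "l < c" for l
    proof (cases "l = i'")
      case True
      have "b * core_load ?S l = b * core_load S i' + b * ld ?j"
        using True load_Suc[OF that] by (simp add: algebra_simps)
      also have "\<dots> \<le> b * m + m"
        using i'(2) small by (intro add_mono mult_left_mono) (auto simp: big_def)
      finally show ?thesis by simp
    qed (use load_Suc[OF that] P'(6)[OF that] in simp)
    show "?S j < card {q \<in> {..<c}. real (dm j) \<le> p q}" if "j \<in> smalls_done (Suc t)" for j
      using that Suc_t P'(7)[of j] nd card_cores_for_small[OF P j(1) small j(2) i'(1) full] by auto
  qed
qed

lemma progress_greedy: "t \<le> n \<Longrightarrow> progress t (fst (greedy m t)) (snd (greedy m t))"
proof (induction t)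
  case 0
  have "b * core_load (big_core m) k \<le> (b + 1) * m" if "k < c" for k
    using B_le[OF that] by (simp add: B_def)
  moreover have "smalls_done 0 = {}" by (simp add: smalls_done_def)
  moreover have "big_core m j = c" if "j < n" "j \<notin> bigs m" for j
    using that by (simp add: bigs_def big_core_def)
  ultimately show ?case using cores_pos by (simp add: progress_def)
next
  case (Suc t)
  obtain i S where iS: "greedy m t = (i, S)" by (cases "greedy m t")
  then have P: "progress t i S" using Suc by simp
  show ?case
  proof (cases "big m (ordered t)")
    case True
    then have "smalls_done (Suc t) = smalls_done t" using smalls_done_Suc Suc.prems by simp
    then show ?thesis using P True by (simp add: iS progress_def Let_def)
  next
    case False
    then show ?thesis using progress_Suc[OF P _ False] Suc.prems by (simp add: iS Let_def del: fun_upd_apply)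
  qed
qed

section \<open>Cache used by the schedule\<close>

lemma sum_big_demands: "(\<Sum>j\<in>bigs m. real (dm j)) \<le> (real b - 1) * real K"
proof -
  have b: "1 \<le> b" using parameters by auto
  have "(\<Sum>j\<in>bigs m. real (dm j)) \<le> (\<Sum>j\<in>bigs m. p (S' j))"
    using demand by (intro sum_mono) (auto simp: bigs_def)
  also have "\<dots> = (\<Sum>j | j \<in> bigs m \<and> S' j \<in> {..<c}. p (S' j))"
    using S'_less by (intro sum.cong) (auto simp: bigs_def)
  also have "\<dots> = (\<Sum>q<c. \<Sum>j | j \<in> bigs m \<and> S' j = q. p (S' j))"
    by (rule sum_nat_fibres[symmetric]) auto
  also have "\<dots> \<le> (\<Sum>q<c. (real b - 1) * p q)"
  proof (rule sum_mono)
    fix q assume q: "q \<in> {..<c}"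
    have "(\<Sum>j | j \<in> bigs m \<and> S' j = q. p (S' j)) = (\<Sum>j | j \<in> bigs m \<and> S' j = q. p q)"
      by (rule sum.cong) auto
    also have "\<dots> = real (card {j \<in> bigs m. S' j = q}) * p q" by simp
    also have "\<dots> \<le> (real b - 1) * p q"
      using card_bigs_on_core[of q] p_nonneg[of q] q by (intro mult_right_mono) auto
    finally show "(\<Sum>j | j \<in> bigs m \<and> S' j = q. p (S' j)) \<le> (real b - 1) * p q" .
  qed
  also have "\<dots> = (real b - 1) * (\<Sum>q<c. p q)" by (simp add: sum_distrib_left)
  also have "\<dots> \<le> (real b - 1) * real K" using p_sum b by (intro mult_left_mono) auto
  finally show ?thesis .
qed

theorem acceptable_schedule: "acceptable K m (schedule m)"
proof -
  let ?S = "schedule m"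
  obtain i where P: "progress n i ?S"
    using progress_greedy[of n] by (auto simp: schedule_def)
  have all: "{..<n} = bigs m \<union> smalls_done n"
    using rank_less_card[of "{..<n}" _ dm] by (auto simp: bigs_def smalls_done_def)
  have less: "?S j < c" if "j < n" for j
  proof (cases "j \<in> bigs m")
    case True
    then show ?thesis using P big_core_less by (simp add: progress_def)
  next
    case False
    then have "j \<in> smalls_done n" using that all by blast
    then have "?S j \<le> i" "i < c" using P by (auto simp: progress_def)
    then show ?thesis by simp
  qed
  let ?F = "{j. j < n \<and> first_on_core ?S j}"
  \<comment> \<open>All big jobs are charged, even those that are not first on their core; only the
    small first jobs are left for the Hall-type bound by \<open>K\<close>.\<close>
  have "(\<Sum>j\<in>?F. real (dm j)) \<le> (\<Sum>j\<in>bigs m \<union> (?F \<inter> smalls_done n). real (dm j))"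
    using all by (intro sum_mono2) (auto simp: bigs_def)
  also have "\<dots> = (\<Sum>j\<in>bigs m. real (dm j)) + (\<Sum>j\<in>?F \<inter> smalls_done n. real (dm j))"
    by (rule sum.union_disjoint) (auto simp: bigs_def smalls_done_def)
  also have "(\<Sum>j\<in>?F \<inter> smalls_done n. real (dm j)) \<le> (\<Sum>q\<in>{..<c}. p q)"
  proof (rule sum_le_sum_of_card[where S = ?S])
    show "inj_on ?S (?F \<inter> smalls_done n)"
      using inj_on_first_on_core by (rule inj_on_subset) blast
    show "?S j < card {q \<in> {..<c}. real (dm j) \<le> p q}" if "j \<in> ?F \<inter> smalls_done n" for j
      using that P by (simp add: progress_def)
  qed (use p_nonneg in auto)
  finally have "(\<Sum>j\<in>?F. real (dm j)) \<le> real b * real K"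
    using sum_big_demands p_sum by (simp add: algebra_simps)
  then have "real (\<Sum>j\<in>?F. dm j) \<le> real (b * K)" by simp
  then have "(\<Sum>j\<in>?F. dm j) \<le> b * K" by (simp only: of_nat_le_iff)
  then show ?thesis
    using P less by (auto simp: acceptable_def progress_def)
qed

end

section \<open>The program\<close>

abbreviation (input) iv :: aexp where "iv \<equiv> Var ''i''"
abbreviation (input) jv :: aexp where "jv \<equiv> Var ''j''"

definition True_bexp :: bexp where
  "True_bexp = Less (Num 0) (Num 1)"

definition Eq :: "aexp \<Rightarrow> aexp \<Rightarrow> bexp" where
  "Eq e f = Conj (Neg (Less e f)) (Neg (Less f e))"

text \<open>Boolean expressions offer only negation and conjunction, hence De Morgan's law for the
  disjunction.\<close>

definition Before :: "aexp \<Rightarrow> aexp \<Rightarrow> aexp \<Rightarrow> aexp \<Rightarrow> bexp" where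
  "Before e f i j = Neg (Conj (Neg (Less f e)) (Neg (Conj (Eq e f) (Less i j))))"

definition Big :: "nat \<Rightarrow> aexp \<Rightarrow> bexp" where
  "Big b e = Less (Var ''m'') (Times (Num b) (Get ''ld'' e))"

definition Medium :: "nat \<Rightarrow> nat \<Rightarrow> aexp \<Rightarrow> bexp" where
  "Medium b d e = Conj (Big b e)
     (Neg (Less (Times (Num d) (Var ''m'')) (Times (Num 3) (Get ''ld'' e))))"

lemma bval_simps [simp]:
  "bval True_bexp s"
  "bval (Eq e f) s \<longleftrightarrow> aval e s = aval f s"
  "bval (Before e f i j) s \<longleftrightarrow>
     aval f s < aval e s \<or> aval e s = aval f s \<and> aval i s < aval j s"
  by (auto simp: True_bexp_def Eq_def Before_def)

text \<open>Sorting by counting: the ranks are tabulated, then inverted by searching for each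
  position the job of that rank. The quadratic time is affordable.\<close>

definition order_prog :: com where
  "order_prog = Seq
     (Table ''rk'' (Var ''n'') (Var ''n'') (Before (Get ''dm'' iv) (Get ''dm'' jv) iv jv) (Num 1)
        True_bexp (Var ''r'') (Var ''r''))
     (Table ''ord'' (Var ''n'') (Var ''n'') (Eq (Get ''rk'' iv) jv) iv True_bexp (Var ''r'') (Var ''r''))"

definition medium_rank_prog :: "nat \<Rightarrow> nat \<Rightarrow> com" where
  "medium_rank_prog b d = Table ''rk'' (Var ''n'') (Var ''n'')
     (Conj (Medium b d iv) (Before (Get ''ld'' iv) (Get ''ld'' jv) iv jv)) (Num 1)
     True_bexp (Var ''r'') (Var ''r'')"

definition group_prog :: "nat \<Rightarrow> nat \<Rightarrow> com" where
  "group_prog b d = Table ''group'' (Var ''n'') (Num 0) True_bexp (Num 0)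
     (Medium b d jv) (Div (Get ''rk'' jv) (Num 2)) (Plus (Var ''n'') jv)"

definition group_load_prog :: "nat \<Rightarrow> com" where
  "group_load_prog b = Table ''G'' (Plus (Var ''n'') (Var ''n'')) (Var ''n'')
     (Conj (Big b iv) (Eq (Get ''group'' iv) jv)) (Get ''ld'' iv) True_bexp (Var ''r'') (Var ''r'')"

text \<open>The inner sum counts the group labels preceding the group of the job, over all
  \<open>2n\<close> possible labels; empty groups have load 0 and come last.\<close>

definition big_core_prog :: "nat \<Rightarrow> com" where
  "big_core_prog b = Table ''S'' (Var ''n'') (Plus (Var ''n'') (Var ''n''))
     (Before (Get ''G'' iv) (Get ''G'' (Get ''group'' jv)) iv (Get ''group'' jv)) (Num 1)
     (Big b jv) (Minus (Minus (Var ''c'') (Num 1)) (Var ''r'')) (Var ''c'')"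

definition big_prog :: "nat \<Rightarrow> nat \<Rightarrow> com" where
  "big_prog b d = Seq (medium_rank_prog b d) (Seq (group_prog b d)
     (Seq (group_load_prog b) (big_core_prog b)))"

definition greedy_prog :: "nat \<Rightarrow> com" where
  "greedy_prog b = Seq (Set ''cur'' (Num 0)) (For ''t'' (Var ''n'')
     (Cond (Big b (Get ''ord'' (Var ''t''))) Skip
       (Seq (Sum ''r'' (Var ''n'') (Eq (Get ''S'' iv) (Var ''cur'')) (Get ''ld'' iv))
       (Seq (Cond (Less (Var ''r'') (Var ''m'')) Skip (Set ''cur'' (Plus (Var ''cur'') (Num 1))))
       (Assign ''S'' (Get ''ord'' (Var ''t'')) (Var ''cur''))))))"

definition schedule_prog :: "nat \<Rightarrow> nat \<Rightarrow> com" where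
  "schedule_prog b d = Seq (big_prog b d) (greedy_prog b)"

definition first_prog :: com where
  "first_prog = Table ''first'' (Var ''n'') (Var ''n'')
     (Conj (Eq (Get ''S'' iv) (Get ''S'' jv)) (Before (Get ''dm'' iv) (Get ''dm'' jv) iv jv)) (Num 1)
     True_bexp (Var ''r'') (Var ''r'')"

text \<open>\<open>first\<close> counts the preceding jobs on the same core, so 0 marks the first
  job. \<open>bad\<close> counts the jobs violating the core or load condition; comparing the cache
  in \<open>tot\<close> with the bound is left to the search.\<close>

definition check_prog :: "nat \<Rightarrow> com" where
  "check_prog b = Seq first_prog (Seq
     (Table ''L'' (Var ''n'') (Var ''n'') (Eq (Get ''S'' iv) (Get ''S'' jv)) (Get ''ld'' iv)
        True_bexp (Var ''r'') (Var ''r'')) (Seq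
     (Sum ''tot'' (Var ''n'') (Less (Get ''first'' iv) (Num 1)) (Get ''dm'' iv))
     (Sum ''bad'' (Var ''n'')
        (Neg (Conj (Less (Get ''S'' iv) (Var ''c''))
          (Neg (Less (Times (Num (b + 1)) (Var ''m'')) (Times (Num b) (Get ''L'' iv)))))) (Num 1))))"

lemma card_eq_0_less: "card {j::nat. j < n \<and> P j} = 0 \<longleftrightarrow> (\<forall>j<n. \<not> P j)"
  by auto

section \<open>Correctness of the scheduling and checking programs\<close>

context scheduling
begin

definition env :: "state \<Rightarrow> bool" where
  "env s \<longleftrightarrow> s ''n'' 0 = n \<and> s ''c'' 0 = c \<and> (\<forall>j<n. s ''ld'' j = ld j) \<and> (\<forall>j<n. s ''dm'' j = dm j)"

lemma env_eq_off:
  assumes "eq_off X s s'" "env s" "{''n'', ''c'', ''ld'', ''dm''} \<inter> X = {}"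
  shows "env s'"
proof -
  have "s' v = s v" if "v \<in> {''n'', ''c'', ''ld'', ''dm''}" for v
    using assms that by (auto simp: eq_off_def)
  then show ?thesis using assms(2) by (simp add: env_def)
qed

lemma runs_order:
  assumes s: "env s" and N: "2 * n \<le> N"
  shows "runs N order_prog s (\<lambda>s'. eq_off {''rk'', ''ord'', ''j'', ''r'', ''i''} s s' \<and>
    (\<forall>t<n. s' ''ord'' t = ordered t))"
  unfolding order_prog_def
proof (rule runs_Seq)
  show "runs N (Table ''rk'' (Var ''n'') (Var ''n'') (Before (Get ''dm'' iv) (Get ''dm'' jv) iv jv) (Num 1)
        True_bexp (Var ''r'') (Var ''r'')) s (\<lambda>s'. eq_off {''rk'', ''j'', ''r'', ''i''} s s' \<and>
    (\<forall>j<n. s' ''rk'' j = rank dm {..<n} j))"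
    by (rule runs_Table[where m = n and m' = n and B = "\<lambda>j i. before dm i j" and w = "\<lambda>_ _. 1" and
          F = "rank dm {..<n}"])
      (use s N in \<open>auto simp: eq_off_def env_def before_def rank_def\<close>)
next
  fix s1 assume s1: "eq_off {''rk'', ''j'', ''r'', ''i''} s s1 \<and> (\<forall>j<n. s1 ''rk'' j = rank dm {..<n} j)"
  then have "env s1" using env_eq_off[OF _ s] by auto
  then show "runs N (Table ''ord'' (Var ''n'') (Var ''n'') (Eq (Get ''rk'' iv) jv) iv
      True_bexp (Var ''r'') (Var ''r'')) s1 (\<lambda>s'. eq_off {''rk'', ''ord'', ''j'', ''r'', ''i''} s s' \<and>
    (\<forall>t<n. s' ''ord'' t = ordered t))"
    by (intro runs_Table[where m = n and m' = n and B = "\<lambda>t i. rank dm {..<n} i = t" and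
          w = "\<lambda>_ i. i" and F = ordered])
      (use s1 N in \<open>auto simp: eq_off_def env_def ordered_def\<close>)
qed

lemma bval_Big: "env s \<Longrightarrow> s ''m'' 0 = m \<Longrightarrow> aval e s < n \<Longrightarrow> bval (Big b e) s \<longleftrightarrow> big m (aval e s)"
  by (simp add: Big_def big_def env_def)

lemma bval_Medium:
  "env s \<Longrightarrow> s ''m'' 0 = m \<Longrightarrow> aval e s < n \<Longrightarrow> bval (Medium b d e) s \<longleftrightarrow> medium m (aval e s)"
  by (auto simp: Medium_def bval_Big medium_def) (auto simp: env_def)

lemma runs_medium_rank:
  assumes s: "env s" "s ''m'' 0 = m" and N: "2 * n \<le> N"
  shows "runs N (medium_rank_prog b d) s (\<lambda>s'. eq_off {''rk'', ''j'', ''r'', ''i''} s s' \<and>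
    (\<forall>j<n. s' ''rk'' j = rank ld (mediums m) j))"
  unfolding medium_rank_prog_def
proof (rule runs_Table[where m = n and m' = n and B = "\<lambda>j i. medium m i \<and> before ld i j" and
        w = "\<lambda>_ _. 1" and F = "rank ld (mediums m)"])
  fix k l s' assume *: "k < n" "l < n" "eq_off {''rk'', ''j'', ''r'', ''i''} s s'"
    "s' ''j'' 0 = k" "s' ''i'' 0 = l"
  then have "env s'" "s' ''m'' 0 = m"
    using s env_eq_off[OF *(3) s(1)] by (simp_all add: eq_off_def)
  then show "bval (Conj (Medium b d iv) (Before (Get ''ld'' iv) (Get ''ld'' jv) iv jv)) s' =
      (medium m l \<and> before ld l k)"
    using * by (simp add: bval_Medium) (auto simp: env_def before_def)
qed (use s N in \<open>auto simp: eq_off_def env_def rank_def mediums_def conj_assoc\<close>)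

lemma runs_group:
  assumes s: "env s" "s ''m'' 0 = m" "\<forall>j<n. s ''rk'' j = rank ld (mediums m) j" and N: "2 * n \<le> N"
  shows "runs N (group_prog b d) s (\<lambda>s'. eq_off {''group'', ''j'', ''r'', ''i''} s s' \<and>
    (\<forall>j<n. s' ''group'' j = group m j))"
  unfolding group_prog_def
proof (rule runs_Table[where m = n and m' = 0 and B = "\<lambda>_ _. True" and w = "\<lambda>_ _. 0" and F = "group m"])
  fix k s' assume *: "k < n" "eq_off {''group'', ''j'', ''r'', ''i''} s s'" "s' ''j'' 0 = k"
  then have "env s'" "s' ''m'' 0 = m" "s' ''rk'' k = rank ld (mediums m) k"
    using s env_eq_off[OF *(2) s(1)] by (simp_all add: eq_off_def)
  then show "(if bval (Medium b d jv) s' then aval (Div (Get ''rk'' jv) (Num 2)) s'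
      else aval (Plus (Var ''n'') jv) s') = group m k"
    using * by (simp add: bval_Medium group_def) (simp add: env_def)
qed (use s N in \<open>auto simp: eq_off_def env_def\<close>)

lemma runs_group_load:
  assumes s: "env s" "s ''m'' 0 = m" "\<forall>j<n. s ''group'' j = group m j" and N: "2 * n \<le> N"
  shows "runs N (group_load_prog b) s (\<lambda>s'. eq_off {''G'', ''j'', ''r'', ''i''} s s' \<and>
    (\<forall>h<2 * n. s' ''G'' h = group_load m h))"
  unfolding group_load_prog_def
proof (rule runs_Table[where m = "2 * n" and m' = n and B = "\<lambda>h i. big m i \<and> group m i = h" and
        w = "\<lambda>_. ld" and F = "group_load m"])
  fix k l s' assume *: "l < n" "eq_off {''G'', ''j'', ''r'', ''i''} s s'"
    "s' ''j'' 0 = k" "s' ''i'' 0 = l"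
  then have "env s'" "s' ''m'' 0 = m" "s' ''group'' l = group m l"
    using s env_eq_off[OF *(2) s(1)] by (simp_all add: eq_off_def)
  then show "bval (Conj (Big b iv) (Eq (Get ''group'' iv) jv)) s' = (big m l \<and> group m l = k)"
    using * by (simp add: bval_Big)
qed (use s N in \<open>auto simp: eq_off_def env_def group_load_def bigs_def conj_assoc\<close>)

lemma runs_big_core:
  assumes s: "env s" "s ''m'' 0 = m" "\<forall>j<n. s ''group'' j = group m j"
    "\<forall>h<2 * n. s ''G'' h = group_load m h" and N: "2 * n \<le> N"
  shows "runs N (big_core_prog b) s (\<lambda>s'. eq_off {''S'', ''j'', ''r'', ''i''} s s' \<and>
    (\<forall>j<n. s' ''S'' j = big_core m j))"
  unfolding big_core_prog_def
proof (rule runs_Table[where m = n and m' = "2 * n" and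
        B = "\<lambda>j h. before (group_load m) h (group m j)" and w = "\<lambda>_ _. 1" and F = "big_core m"])
  fix k l s' assume *: "k < n" "l < 2 * n" "eq_off {''S'', ''j'', ''r'', ''i''} s s'"
    "s' ''j'' 0 = k" "s' ''i'' 0 = l"
  then have "s' ''group'' k = group m k" "s' ''G'' l = group_load m l"
    "s' ''G'' (group m k) = group_load m (group m k)"
    using s group_less by (auto simp: eq_off_def)
  then show "bval (Before (Get ''G'' iv) (Get ''G'' (Get ''group'' jv)) iv (Get ''group'' jv)) s' =
      before (group_load m) l (group m k)"
    using * by (simp add: before_def)
next
  fix k s' assume *: "k < n" "eq_off {''S'', ''j'', ''r'', ''i''} s s'" "s' ''j'' 0 = k"
    "s' ''r'' 0 = (\<Sum>l | l < 2 * n \<and> before (group_load m) l (group m k). 1)"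
  then have "env s'" "s' ''m'' 0 = m"
    using s env_eq_off[OF *(2) s(1)] by (simp_all add: eq_off_def)
  then show "(if bval (Big b jv) s' then aval (Minus (Minus (Var ''c'') (Num 1)) (Var ''r'')) s'
      else aval (Var ''c'') s') = big_core m k"
    using * by (simp add: bval_Big big_core_def rank_def) (simp add: env_def)
qed (use s N in \<open>auto simp: eq_off_def env_def\<close>)

lemma runs_big:
  assumes s: "env s" "s ''m'' 0 = m" and N: "2 * n \<le> N"
  shows "runs N (big_prog b d) s (\<lambda>s'.
    eq_off {''rk'', ''group'', ''G'', ''S'', ''j'', ''r'', ''i''} s s' \<and> (\<forall>j<n. s' ''S'' j = big_core m j))"
  unfolding big_prog_def
proof (rule runs_Seq[OF runs_medium_rank[OF s N]], elim conjE)
  fix s1 assume s1: "eq_off {''rk'', ''j'', ''r'', ''i''} s s1"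
    "\<forall>j<n. s1 ''rk'' j = rank ld (mediums m) j"
  then have e1: "env s1" "s1 ''m'' 0 = m"
    using s env_eq_off[OF s1(1) s(1)] by (simp_all add: eq_off_def)
  show "runs N (Seq (group_prog b d) (Seq (group_load_prog b) (big_core_prog b))) s1 (\<lambda>s'.
    eq_off {''rk'', ''group'', ''G'', ''S'', ''j'', ''r'', ''i''} s s' \<and> (\<forall>j<n. s' ''S'' j = big_core m j))"
  proof (rule runs_Seq[OF runs_group[OF e1 s1(2) N]], elim conjE)
    fix s2 assume s2: "eq_off {''group'', ''j'', ''r'', ''i''} s1 s2"
      "\<forall>j<n. s2 ''group'' j = group m j"
    then have e2: "env s2" "s2 ''m'' 0 = m"
      using e1 env_eq_off[OF s2(1) e1(1)] by (simp_all add: eq_off_def)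
    show "runs N (Seq (group_load_prog b) (big_core_prog b)) s2 (\<lambda>s'.
    eq_off {''rk'', ''group'', ''G'', ''S'', ''j'', ''r'', ''i''} s s' \<and> (\<forall>j<n. s' ''S'' j = big_core m j))"
    proof (rule runs_Seq[OF runs_group_load[OF e2 s2(2) N]], elim conjE)
      fix s3 assume s3: "eq_off {''G'', ''j'', ''r'', ''i''} s2 s3"
        "\<forall>h<2 * n. s3 ''G'' h = group_load m h"
      then have e3: "env s3" "s3 ''m'' 0 = m" "\<forall>j<n. s3 ''group'' j = group m j"
        using e2 s2(2) env_eq_off[OF s3(1) e2(1)] by (simp_all add: eq_off_def)
      show "runs N (big_core_prog b) s3 (\<lambda>s'.
        eq_off {''rk'', ''group'', ''G'', ''S'', ''j'', ''r'', ''i''} s s' \<and> (\<forall>j<n. s' ''S'' j = big_core m j))"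
        by (rule runs_mono[OF runs_big_core[OF e3 s3(2) N]])
          (use s1(1) s2(1) s3(1) in \<open>auto simp: eq_off_def\<close>)
    qed
  qed
qed

lemma runs_greedy:
  assumes s: "env s" "s ''m'' 0 = m" "\<forall>t<n. s ''ord'' t = ordered t" "\<forall>j<n. s ''S'' j = big_core m j"
    and N: "2 * n \<le> N"
  shows "runs N (greedy_prog b) s (\<lambda>s'.
    eq_off {''S'', ''cur'', ''t'', ''r'', ''i''} s s' \<and> (\<forall>j<n. s' ''S'' j = schedule m j))"
  unfolding greedy_prog_def
proof (rule runs_Seq_Assign)
  fix s0
  let ?X = "{''S'', ''cur'', ''t'', ''r'', ''i''}"
  let ?Inv = "\<lambda>t s'. eq_off ?X s s' \<and> s' ''cur'' 0 = fst (greedy m t) \<and>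
    (\<forall>j<n. s' ''S'' j = snd (greedy m t) j)"
  assume s0: "s0 = s(''cur'' := (s ''cur'')(aval (Num 0) s := aval (Num 0) s))"
  show "runs N (For ''t'' (Var ''n'')
     (Cond (Big b (Get ''ord'' (Var ''t''))) Skip
       (Seq (Sum ''r'' (Var ''n'') (Eq (Get ''S'' iv) (Var ''cur'')) (Get ''ld'' iv))
       (Seq (Cond (Less (Var ''r'') (Var ''m'')) Skip (Set ''cur'' (Plus (Var ''cur'') (Num 1))))
       (Assign ''S'' (Get ''ord'' (Var ''t'')) (Var ''cur'')))))) s0 (\<lambda>s'.
    eq_off ?X s s' \<and> (\<forall>j<n. s' ''S'' j = schedule m j))"
  proof (rule runs_For[where m = n and I = ?Inv])
    show "?Inv 0 (s0(''t'' := (s0 ''t'')(0 := 0)))"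
      using s by (auto simp: s0 eq_off_def)
  next
    fix t s1 assume t: "t < n" "s1 ''t'' 0 = t" and Inv: "?Inv t s1"
    obtain i S where iS: "greedy m t = (i, S)" by (cases "greedy m t")
    then have s1: "eq_off ?X s s1" "s1 ''cur'' 0 = i" "\<forall>j<n. s1 ''S'' j = S j"
      using Inv by auto
    then have e1: "env s1" "s1 ''m'' 0 = m" "s1 ''ord'' t = ordered t"
      using s t env_eq_off[OF s1(1) s(1)] by (simp_all add: eq_off_def)
    have o: "ordered t < n" using ordered(1)[OF t(1)] .
    show "runs N (Cond (Big b (Get ''ord'' (Var ''t''))) Skip
       (Seq (Sum ''r'' (Var ''n'') (Eq (Get ''S'' iv) (Var ''cur'')) (Get ''ld'' iv))
       (Seq (Cond (Less (Var ''r'') (Var ''m'')) Skip (Set ''cur'' (Plus (Var ''cur'') (Num 1))))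
       (Assign ''S'' (Get ''ord'' (Var ''t'')) (Var ''cur''))))) s1
       (\<lambda>s'. s' ''t'' 0 = t \<and> ?Inv (Suc t) (s'(''t'' := (s' ''t'')(0 := Suc t))))"
    proof (rule runs_Cond)
      assume "bval (Big b (Get ''ord'' (Var ''t''))) s1"
      then have "big m (ordered t)" using e1 t o by (simp add: Big_def big_def env_def)
      then show "runs N Skip s1 (\<lambda>s'. s' ''t'' 0 = t \<and> ?Inv (Suc t) (s'(''t'' := (s' ''t'')(0 := Suc t))))"
        using s1 t by (intro runs_Skip) (auto simp: iS eq_off_def)
    next
      assume "\<not> bval (Big b (Get ''ord'' (Var ''t''))) s1"
      then have small: "\<not> big m (ordered t)" using e1 t o by (simp add: Big_def big_def env_def)
      show "runs N (Seq (Sum ''r'' (Var ''n'') (Eq (Get ''S'' iv) (Var ''cur'')) (Get ''ld'' iv))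
       (Seq (Cond (Less (Var ''r'') (Var ''m'')) Skip (Set ''cur'' (Plus (Var ''cur'') (Num 1))))
       (Assign ''S'' (Get ''ord'' (Var ''t'')) (Var ''cur'')))) s1
         (\<lambda>s'. s' ''t'' 0 = t \<and> ?Inv (Suc t) (s'(''t'' := (s' ''t'')(0 := Suc t))))"
      proof (rule runs_Seq)
        show "runs N (Sum ''r'' (Var ''n'') (Eq (Get ''S'' iv) (Var ''cur'')) (Get ''ld'' iv)) s1
          (\<lambda>s2. eq_off {''r'', ''i''} s1 s2 \<and> s2 ''r'' 0 = core_load S i)"
          by (rule runs_Sum[where m = n and B = "\<lambda>j. S j = i" and f = ld])
            (use s1 e1 N in \<open>auto simp: eq_off_def env_def core_load_def\<close>)
      next
        fix s2 assume s2: "eq_off {''r'', ''i''} s1 s2 \<and> s2 ''r'' 0 = core_load S i"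
        have *: "eq_off ?X s s2" "s2 ''cur'' 0 = i" "\<forall>j<n. s2 ''S'' j = S j" "s2 ''m'' 0 = m"
          "s2 ''ord'' t = ordered t" "s2 ''t'' 0 = t"
          using s1 s2 e1 t by (auto simp: eq_off_def)
        show "runs N (Seq (Cond (Less (Var ''r'') (Var ''m'')) Skip (Set ''cur'' (Plus (Var ''cur'') (Num 1))))
          (Assign ''S'' (Get ''ord'' (Var ''t'')) (Var ''cur''))) s2
            (\<lambda>s'. s' ''t'' 0 = t \<and> ?Inv (Suc t) (s'(''t'' := (s' ''t'')(0 := Suc t))))"
        proof (rule runs_Seq)
          show "runs N (Cond (Less (Var ''r'') (Var ''m'')) Skip (Set ''cur'' (Plus (Var ''cur'') (Num 1)))) s2
            (\<lambda>s3. eq_off {''cur''} s2 s3 \<and> s3 ''cur'' 0 = (if m \<le> core_load S i then Suc i else i))"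
            by (rule runs_Cond; (rule runs_Skip runs_Assign)) (use * s2 in \<open>auto simp: eq_off_def\<close>)
        next
          fix s3 assume s3: "eq_off {''cur''} s2 s3 \<and>
            s3 ''cur'' 0 = (if m \<le> core_load S i then Suc i else i)"
          then have **: "eq_off ?X s s3" "\<forall>j<n. s3 ''S'' j = S j"
            "s3 ''ord'' t = ordered t" "s3 ''t'' 0 = t"
            using * by (auto simp: eq_off_def)
          show "runs N (Assign ''S'' (Get ''ord'' (Var ''t'')) (Var ''cur'')) s3
            (\<lambda>s'. s' ''t'' 0 = t \<and> ?Inv (Suc t) (s'(''t'' := (s' ''t'')(0 := Suc t))))"
            by (rule runs_Assign) (use ** s3 small in \<open>auto simp: iS Let_def eq_off_def\<close>)
        qed
      qed
    qed
  qed (use s N in \<open>auto simp: eq_off_def env_def schedule_def\<close>)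
qed

lemma runs_schedule:
  assumes s: "env s" "s ''m'' 0 = m" "\<forall>t<n. s ''ord'' t = ordered t" and N: "2 * n \<le> N"
  shows "runs N (schedule_prog b d) s (\<lambda>s'.
    eq_off {''rk'', ''group'', ''G'', ''S'', ''cur'', ''t'', ''j'', ''r'', ''i''} s s' \<and>
    (\<forall>j<n. s' ''S'' j = schedule m j))"
  unfolding schedule_prog_def
proof (rule runs_Seq[OF runs_big[OF s(1,2) N]])
  fix s1 assume s1: "eq_off {''rk'', ''group'', ''G'', ''S'', ''j'', ''r'', ''i''} s s1 \<and>
    (\<forall>j<n. s1 ''S'' j = big_core m j)"
  then have "env s1" "s1 ''m'' 0 = m" "\<forall>t<n. s1 ''ord'' t = ordered t"
    using s env_eq_off[OF conjunct1[OF s1] s(1)] by (simp_all add: eq_off_def)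
  then show "runs N (greedy_prog b) s1 (\<lambda>s'.
    eq_off {''rk'', ''group'', ''G'', ''S'', ''cur'', ''t'', ''j'', ''r'', ''i''} s s' \<and>
    (\<forall>j<n. s' ''S'' j = schedule m j))"
    by (rule runs_mono[OF runs_greedy]) (use s1 N in \<open>auto simp: eq_off_def\<close>)
qed

lemma runs_first:
  assumes s: "env s" "\<forall>j<n. s ''S'' j = S j" and N: "2 * n \<le> N"
  shows "runs N first_prog s (\<lambda>s'. eq_off {''first'', ''j'', ''r'', ''i''} s s' \<and>
    (\<forall>j<n. s' ''first'' j = 0 \<longleftrightarrow> first_on_core S j))"
  unfolding first_prog_def
proof (rule runs_Table[where m = n and m' = n and B = "\<lambda>j i. S i = S j \<and> before dm i j" and
        w = "\<lambda>_ _. 1" and F = "\<lambda>j. card {i. i < n \<and> S i = S j \<and> before dm i j}"])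
  fix k l s' assume *: "k < n" "l < n" "eq_off {''first'', ''j'', ''r'', ''i''} s s'"
    "s' ''j'' 0 = k" "s' ''i'' 0 = l"
  then have "env s'" "s' ''S'' k = S k" "s' ''S'' l = S l"
    using s env_eq_off[OF *(3) s(1)] by (simp_all add: eq_off_def)
  then show "bval (Conj (Eq (Get ''S'' iv) (Get ''S'' jv)) (Before (Get ''dm'' iv) (Get ''dm'' jv) iv jv)) s' =
      (S l = S k \<and> before dm l k)"
    using * by (simp add: before_def env_def)
next
  fix s' assume *: "eq_off {''first'', ''j'', ''r'', ''i''} s s'"
    "\<And>k. k < n \<Longrightarrow> s' ''first'' k = card {i. i < n \<and> S i = S k \<and> before dm i k}"
  have "card {i. i < n \<and> S i = S j \<and> before dm i j} = 0 \<longleftrightarrow> first_on_core S j" for j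
    by (auto simp: first_on_core_def)
  then show "eq_off {''first'', ''j'', ''r'', ''i''} s s' \<and> (\<forall>j<n. s' ''first'' j = 0 \<longleftrightarrow> first_on_core S j)"
    using * by simp
qed (use s N in \<open>auto simp: eq_off_def env_def\<close>)

lemma runs_check:
  assumes s: "env s" "s ''m'' 0 = m" "\<forall>j<n. s ''S'' j = S j" and N: "2 * n \<le> N"
  shows "runs N (check_prog b) s (\<lambda>s'.
    eq_off {''first'', ''L'', ''tot'', ''bad'', ''j'', ''r'', ''i''} s s' \<and>
    (s' ''bad'' 0 = 0 \<and> s' ''tot'' 0 \<le> b * K \<longleftrightarrow> acceptable K m S))"
  unfolding check_prog_def
proof (rule runs_Seq[OF runs_first[OF s(1,3) N]])
  fix s1 assume s1: "eq_off {''first'', ''j'', ''r'', ''i''} s s1 \<and>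
    (\<forall>j<n. s1 ''first'' j = 0 \<longleftrightarrow> first_on_core S j)"
  then have e1: "env s1" using env_eq_off[OF _ s(1)] by auto
  show "runs N (Seq
     (Table ''L'' (Var ''n'') (Var ''n'') (Eq (Get ''S'' iv) (Get ''S'' jv)) (Get ''ld'' iv)
        True_bexp (Var ''r'') (Var ''r'')) (Seq
     (Sum ''tot'' (Var ''n'') (Less (Get ''first'' iv) (Num 1)) (Get ''dm'' iv))
     (Sum ''bad'' (Var ''n'')
        (Neg (Conj (Less (Get ''S'' iv) (Var ''c''))
          (Neg (Less (Times (Num (b + 1)) (Var ''m'')) (Times (Num b) (Get ''L'' iv)))))) (Num 1)))) s1
    (\<lambda>s'. eq_off {''first'', ''L'', ''tot'', ''bad'', ''j'', ''r'', ''i''} s s' \<and>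
    (s' ''bad'' 0 = 0 \<and> s' ''tot'' 0 \<le> b * K \<longleftrightarrow> acceptable K m S))"
  proof (rule runs_Seq)
    show "runs N (Table ''L'' (Var ''n'') (Var ''n'') (Eq (Get ''S'' iv) (Get ''S'' jv)) (Get ''ld'' iv)
        True_bexp (Var ''r'') (Var ''r'')) s1 (\<lambda>s'.
        eq_off {''first'', ''L'', ''j'', ''r'', ''i''} s s' \<and>
        (\<forall>j<n. s' ''first'' j = 0 \<longleftrightarrow> first_on_core S j) \<and> (\<forall>j<n. s' ''L'' j = core_load S (S j)))"
      by (rule runs_Table[where m = n and m' = n and B = "\<lambda>j i. S i = S j" and
            w = "\<lambda>_. ld" and F = "\<lambda>j. core_load S (S j)"])
        (use s s1 e1 N in \<open>auto simp: eq_off_def env_def core_load_def\<close>)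
  next
    fix s2 assume s2: "eq_off {''first'', ''L'', ''j'', ''r'', ''i''} s s2 \<and>
      (\<forall>j<n. s2 ''first'' j = 0 \<longleftrightarrow> first_on_core S j) \<and> (\<forall>j<n. s2 ''L'' j = core_load S (S j))"
    then have e2: "env s2" using env_eq_off[OF _ s(1)] by auto
    show "runs N (Seq (Sum ''tot'' (Var ''n'') (Less (Get ''first'' iv) (Num 1)) (Get ''dm'' iv))
     (Sum ''bad'' (Var ''n'')
        (Neg (Conj (Less (Get ''S'' iv) (Var ''c''))
          (Neg (Less (Times (Num (b + 1)) (Var ''m'')) (Times (Num b) (Get ''L'' iv)))))) (Num 1))) s2
       (\<lambda>s'. eq_off {''first'', ''L'', ''tot'', ''bad'', ''j'', ''r'', ''i''} s s' \<and>
       (s' ''bad'' 0 = 0 \<and> s' ''tot'' 0 \<le> b * K \<longleftrightarrow> acceptable K m S))"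
    proof (rule runs_Seq)
      show "runs N (Sum ''tot'' (Var ''n'') (Less (Get ''first'' iv) (Num 1)) (Get ''dm'' iv)) s2 (\<lambda>s'.
        eq_off {''tot'', ''i''} s2 s' \<and> s' ''tot'' 0 = (\<Sum>j | j < n \<and> first_on_core S j. dm j))"
        by (rule runs_Sum[where m = n and B = "first_on_core S" and f = dm])
          (use s2 e2 N in \<open>auto simp: eq_off_def env_def\<close>)
    next
      fix s3 assume s3: "eq_off {''tot'', ''i''} s2 s3 \<and>
        s3 ''tot'' 0 = (\<Sum>j | j < n \<and> first_on_core S j. dm j)"
      then have e3: "env s3" using env_eq_off[OF _ e2] by auto
      show "runs N (Sum ''bad'' (Var ''n'')
        (Neg (Conj (Less (Get ''S'' iv) (Var ''c''))
          (Neg (Less (Times (Num (b + 1)) (Var ''m'')) (Times (Num b) (Get ''L'' iv)))))) (Num 1)) s3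
        (\<lambda>s'. eq_off {''first'', ''L'', ''tot'', ''bad'', ''j'', ''r'', ''i''} s s' \<and>
         (s' ''bad'' 0 = 0 \<and> s' ''tot'' 0 \<le> b * K \<longleftrightarrow> acceptable K m S))"
      proof (rule runs_Sum[where m = n and f = "\<lambda>_. 1" and
              B = "\<lambda>j. \<not> (S j < c \<and> b * core_load S (S j) \<le> (b + 1) * m)"])
        fix k s' assume *: "k < n" "eq_off {''bad'', ''i''} s3 s'" "s' ''i'' 0 = k"
        then have "env s'" "s' ''m'' 0 = m" "s' ''S'' k = S k" "s' ''L'' k = core_load S (S k)"
          using s s2 s3 env_eq_off[OF *(2) e3] by (simp_all add: eq_off_def)
        then show "bval (Neg (Conj (Less (Get ''S'' iv) (Var ''c''))
          (Neg (Less (Times (Num (b + 1)) (Var ''m'')) (Times (Num b) (Get ''L'' iv)))))) s' =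
          (\<not> (S k < c \<and> b * core_load S (S k) \<le> (b + 1) * m))"
          using * by (simp add: env_def not_less)
      next
        fix s' assume *: "eq_off {''bad'', ''i''} s3 s'"
          "s' ''bad'' 0 = (\<Sum>j | j < n \<and> \<not> (S j < c \<and> b * core_load S (S j) \<le> (b + 1) * m). 1)"
        have "s' ''bad'' 0 = card {j. j < n \<and> \<not> (S j < c \<and> b * core_load S (S j) \<le> (b + 1) * m)}"
          using *(2) by (simp only: card_eq_sum)
        then have "s' ''bad'' 0 = 0 \<longleftrightarrow> (\<forall>j<n. S j < c \<and> b * core_load S (S j) \<le> (b + 1) * m)"
          by (simp only: card_eq_0_less not_not)
        moreover have "s' ''tot'' 0 = (\<Sum>j | j < n \<and> first_on_core S j. dm j)"
          using *(1) s3 by (simp add: eq_off_def)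
        moreover have "eq_off {''first'', ''L'', ''tot'', ''bad'', ''j'', ''r'', ''i''} s s'"
          using *(1) s2 s3 by (simp add: eq_off_def)
        ultimately show "eq_off {''first'', ''L'', ''tot'', ''bad'', ''j'', ''r'', ''i''} s s' \<and>
          (s' ''bad'' 0 = 0 \<and> s' ''tot'' 0 \<le> b * K \<longleftrightarrow> acceptable K m S)"
          unfolding acceptable_def by simp
      qed (use e3 N in \<open>auto simp: eq_off_def env_def\<close>)
    qed
  qed
qed

end

text \<open>\<open>h\<close> starts as a power of two above the total load, so that every halving is
  exact and the number of rounds is bounded by a number of digits. Acceptance of
  \<open>m = lo + h\<close> keeps \<open>lo\<close>; rejection moves \<open>lo\<close> up to
  \<open>m\<close>.\<close>

definition search_prog :: "nat \<Rightarrow> nat \<Rightarrow> com" where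
  "search_prog b d =
     Seq (Set ''lo'' (Num 0))
     (Seq (Sum ''T'' (Var ''n'') True_bexp (Get ''ld'' iv))
     (Seq (Set ''h'' (Num 1))
     (Seq (While (Neg (Less (Var ''T'') (Var ''h''))) (Set ''h'' (Plus (Var ''h'') (Var ''h''))))
     (While (Less (Num 1) (Var ''h''))
       (Seq (Set ''h'' (Div (Var ''h'') (Num 2)))
       (Seq (Set ''m'' (Plus (Var ''lo'') (Var ''h'')))
       (Seq (schedule_prog b d)
       (Seq (check_prog b)
       (Cond (Conj (Less (Var ''bad'') (Num 1)) (Neg (Less (Times (Num b) (Var ''Kb'')) (Var ''tot''))))
         Skip (Set ''lo'' (Plus (Var ''lo'') (Var ''h''))))))))))))"

text \<open>The schedule is computed again for \<open>lo + 1\<close>, because the arrays hold the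
  last candidate tested, which may have been rejected. All scaled demands have the same number
  \<open>E\<close> of fractional digits.\<close>

definition output_prog :: "nat \<Rightarrow> nat \<Rightarrow> com" where
  "output_prog b d =
     Seq (Set ''m'' (Plus (Var ''lo'') (Num 1)))
     (Seq (schedule_prog b d)
     (Seq first_prog
     (For ''t'' (Var ''n'') (Cond (Less (Get ''first'' (Var ''t'')) (Num 1))
       (Seq (Assign ''p_digits'' (Get ''S'' (Var ''t'')) (Get ''dm'' (Var ''t'')))
         (Assign ''p_frac'' (Get ''S'' (Var ''t'')) (Var ''E'')))
       Skip))))"

lemma floorlog_2_power: "floorlog 2 (2 ^ k) = Suc k"
  using floorlog_power[of 1 2 k] by (simp add: floorlog_def)

definition work_vars :: "string set" where
  "work_vars = {''rk'', ''group'', ''G'', ''S'', ''cur'', ''t'', ''j'', ''r'', ''i'',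
     ''first'', ''L'', ''tot'', ''bad'', ''m'', ''lo'', ''h'', ''T''}"

context scheduling
begin

lemma runs_schedule_check:
  assumes s: "env s" "s ''m'' 0 = m" "\<forall>t<n. s ''ord'' t = ordered t" and N: "2 * n \<le> N"
  shows "runs N (Seq (schedule_prog b d) (check_prog b)) s (\<lambda>s'.
    eq_off {''rk'', ''group'', ''G'', ''S'', ''cur'', ''t'', ''j'', ''r'', ''i'', ''first'', ''L'', ''tot'', ''bad''} s s' \<and>
    (s' ''bad'' 0 = 0 \<and> s' ''tot'' 0 \<le> b * K \<longleftrightarrow> acceptable K m (schedule m)))"
proof (rule runs_Seq[OF runs_schedule[OF s N]], elim conjE)
  fix s1 assume s1: "eq_off {''rk'', ''group'', ''G'', ''S'', ''cur'', ''t'', ''j'', ''r'', ''i''} s s1"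
    "\<forall>j<n. s1 ''S'' j = schedule m j"
  then have e1: "env s1" "s1 ''m'' 0 = m"
    using s env_eq_off[OF s1(1) s(1)] by (simp_all add: eq_off_def)
  show "runs N (check_prog b) s1 (\<lambda>s'.
    eq_off {''rk'', ''group'', ''G'', ''S'', ''cur'', ''t'', ''j'', ''r'', ''i'', ''first'', ''L'', ''tot'', ''bad''} s s' \<and>
    (s' ''bad'' 0 = 0 \<and> s' ''tot'' 0 \<le> b * K \<longleftrightarrow> acceptable K m (schedule m)))"
    by (rule runs_mono[OF runs_check[where K = K, OF e1 s1(2) N]])
      (use s1(1) in \<open>simp add: eq_off_def\<close>)
qed

text \<open>Makes the result on scheduling followed by checking applicable inside the right-nested
  search body.\<close>

lemma runs_Seq_assoc: "runs N (Seq (Seq P Q) R) s A \<Longrightarrow> runs N (Seq P (Seq Q R)) s A"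
proof -
  assume "runs N (Seq (Seq P Q) R) s A"
  then obtain k s' where k: "steps (Seq (Seq P Q) R) s k s'" "k \<le> poly (step_poly (Seq (Seq P Q) R)) N" "A s'"
    unfolding runs_def by blast
  from k(1) obtain k1 k2 k3 s1 s2 where
    "steps P s k1 s1" "steps Q s1 k2 s2" "steps R s2 k3 s'" "k = k1 + k2 + k3"
    by (auto elim!: steps.cases[of "Seq _ _"])
  then have "steps (Seq P (Seq Q R)) s (k1 + (k2 + k3)) s'" by (intro steps.Seq)
  then show ?thesis unfolding runs_def using k \<open>k = k1 + k2 + k3\<close>
    by (intro exI[of _ "k1 + (k2 + k3)"] exI[of _ s']) (simp add: add.assoc)
qed

abbreviation (input) search_body :: com where
  "search_body \<equiv> Seq (Set ''h'' (Div (Var ''h'') (Num 2)))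
       (Seq (Set ''m'' (Plus (Var ''lo'') (Var ''h'')))
       (Seq (schedule_prog b d)
       (Seq (check_prog b)
       (Cond (Conj (Less (Var ''bad'') (Num 1)) (Neg (Less (Times (Num b) (Var ''Kb'')) (Var ''tot''))))
         Skip (Set ''lo'' (Plus (Var ''lo'') (Var ''h'')))))))"

text \<open>The upper bound puts \<open>M\<close> within reach of the search, whose initial
  \<open>h\<close> exceeds the total load. The summand 1 covers instances without jobs, where the
  total load is 0 but \<open>M\<close> has to be positive.\<close>

definition accepted_from :: "nat \<Rightarrow> nat \<Rightarrow> bool" where
  "accepted_from K M \<longleftrightarrow> 0 < M \<and> M \<le> sum ld {..<n} + 1 \<and> (\<forall>m\<ge>M. acceptable K m (schedule m))"

text \<open>
  Acceptance need not be monotone in \<open>m\<close>. The binary search keeps \<open>lo < M\<close> and \<open>lo + h\<close>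
  accepted for every \<open>M\<close> from which on everything is accepted.
\<close>

definition search_inv :: "nat \<Rightarrow> state \<Rightarrow> state \<Rightarrow> bool" where
  "search_inv K s s' \<longleftrightarrow> eq_off work_vars s s' \<and>
     (\<forall>M. accepted_from K M \<longrightarrow> s' ''lo'' 0 < M \<and>
        acceptable K (s' ''lo'' 0 + s' ''h'' 0) (schedule (s' ''lo'' 0 + s' ''h'' 0)))"

lemma runs_search_body:
  assumes s: "env s" "\<forall>t<n. s ''ord'' t = ordered t" "s ''Kb'' 0 = K"
    and N: "2 * n \<le> N"
    and s4: "search_inv K s s4" and k: "s4 ''h'' 0 = 2 * 2 ^ k"
  shows "runs N search_body s4 (\<lambda>s'. search_inv K s s' \<and> s' ''h'' 0 = 2 ^ k)"
proof (rule runs_Seq_Assign, rule runs_Seq_Assign, rule runs_Seq_assoc)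
  let ?m = "s4 ''lo'' 0 + 2 ^ k"
  let ?cond = "Conj (Less (Var ''bad'') (Num 1)) (Neg (Less (Times (Num b) (Var ''Kb'')) (Var ''tot'')))"
  let ?R = "\<lambda>s'. search_inv K s s' \<and> s' ''h'' 0 = 2 ^ k"
  fix s5 s6 assume s5: "s5 = s4(''h'' := (s4 ''h'')(aval (Num 0) s4 := aval (Div (Var ''h'') (Num 2)) s4))"
    and s6: "s6 = s5(''m'' := (s5 ''m'')(aval (Num 0) s5 := aval (Plus (Var ''lo'') (Var ''h'')) s5))"
  have e6: "eq_off work_vars s s6" "s6 ''h'' 0 = 2 ^ k" "s6 ''lo'' 0 = s4 ''lo'' 0" "s6 ''m'' 0 = ?m"
    using s4(1) k by (simp_all add: s6 s5 search_inv_def eq_off_def work_vars_def)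
  then have "env s6" "\<forall>t<n. s6 ''ord'' t = ordered t"
    using s env_eq_off[OF e6(1) s(1)] by (simp_all add: eq_off_def work_vars_def)
  note runs = runs_schedule_check[where K = K, OF this(1) e6(4) this(2) N]
  show "runs N (Seq (Seq (schedule_prog b d) (check_prog b))
     (Cond ?cond Skip (Set ''lo'' (Plus (Var ''lo'') (Var ''h''))))) s6 ?R"
  proof (rule runs_Seq[OF runs], elim conjE)
    fix s7 assume s7: "eq_off {''rk'', ''group'', ''G'', ''S'', ''cur'', ''t'', ''j'', ''r'', ''i'', ''first'', ''L'', ''tot'', ''bad''} s6 s7"
      and acc: "(s7 ''bad'' 0 = 0 \<and> s7 ''tot'' 0 \<le> b * K) = acceptable K ?m (schedule ?m)"
    have e7: "eq_off work_vars s s7" "s7 ''h'' 0 = 2 ^ k" "s7 ''lo'' 0 = s4 ''lo'' 0" "s7 ''Kb'' 0 = K"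
      using e6 s7 s by (simp_all add: eq_off_def work_vars_def)
    have cond: "bval ?cond s7 \<longleftrightarrow> acceptable K ?m (schedule ?m)"
      using acc e7(4) by (simp add: not_less)
    have low: "s4 ''lo'' 0 < M" "acceptable K (s4 ''lo'' 0 + 2 * 2 ^ k) (schedule (s4 ''lo'' 0 + 2 * 2 ^ k))"
      if "accepted_from K M" for M
      using s4 that k by (auto simp: search_inv_def)
    show "runs N (Cond ?cond Skip (Set ''lo'' (Plus (Var ''lo'') (Var ''h'')))) s7 ?R"
    proof (rule runs_Cond)
      assume "bval ?cond s7"
      then have "acceptable K ?m (schedule ?m)" using cond by blast
      then show "runs N Skip s7 ?R"
        using e7 low(1) by (intro runs_Skip) (simp add: search_inv_def)
    next
      assume "\<not> bval ?cond s7"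
      then have na: "\<not> acceptable K ?m (schedule ?m)" using cond by blast
      \<comment> \<open>Everything from \<open>M\<close> on is accepted, so a rejected candidate
        lies below every such \<open>M\<close>; this needs no monotonicity below
        \<open>M\<close>.\<close>
      have *: "?m < M" if "accepted_from K M" for M
        using that na unfolding accepted_from_def by (meson not_less)
      have lo: "eq_off work_vars s (s7(''lo'' := (s7 ''lo'')(0 := ?m)))"
        using e7(1) by (simp add: eq_off_def work_vars_def)
      have **: "acceptable K (?m + 2 ^ k) (schedule (?m + 2 ^ k))" if "accepted_from K M" for M
        using low(2)[OF that] by (simp only: mult_2 add.assoc)
      show "runs N (Set ''lo'' (Plus (Var ''lo'') (Var ''h''))) s7 ?R"
        using lo e7(2,3) * ** by (intro runs_Assign) (simp add: search_inv_def)
    qed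
  qed
qed

text \<open>While \<open>2 ^ k \<le> T\<close>, the number \<open>T\<close> has at least
  \<open>k + 1\<close> digits, so the digits of \<open>T\<close> bound the exponent and the number
  of rounds.\<close>

lemma runs_doubling:
  assumes s: "eq_off work_vars s0 s" "s ''lo'' 0 = 0" "s ''T'' 0 = T" "s ''h'' 0 = 1"
    and N: "floorlog 2 T + 1 \<le> N"
  shows "runs N (While (Neg (Less (Var ''T'') (Var ''h''))) (Set ''h'' (Plus (Var ''h'') (Var ''h'')))) s
    (\<lambda>s'. eq_off work_vars s0 s' \<and> s' ''lo'' 0 = 0 \<and> T < s' ''h'' 0 \<and> (\<exists>k\<le>floorlog 2 T. s' ''h'' 0 = 2 ^ k))"
proof -
  let ?I = "\<lambda>s'. eq_off work_vars s0 s' \<and> s' ''lo'' 0 = 0 \<and> s' ''T'' 0 = T \<and>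
      (\<exists>k\<le>floorlog 2 T. s' ''h'' 0 = 2 ^ k)"
  show ?thesis
  proof (rule runs_While[where I = ?I and f = "\<lambda>s. Suc (floorlog 2 T) - floorlog 2 (s ''h'' 0)"])
    show "?I s" using s by (auto intro: exI[of _ 0])
    show "Suc (floorlog 2 T) - floorlog 2 (s ''h'' 0) \<le> N" using N by simp
  next
    fix s' assume s': "?I s'" "bval (Neg (Less (Var ''T'') (Var ''h''))) s'"
    then obtain k where k: "s' ''h'' 0 = 2 ^ k" "2 ^ k \<le> T" by auto
    then have "floorlog 2 (2 ^ k) \<le> floorlog 2 T" by (intro floorlog_mono)
    then have "Suc k \<le> floorlog 2 T" by (simp add: floorlog_2_power)
    then have dec: "Suc (floorlog 2 T) - floorlog 2 (2 ^ Suc k) < Suc (floorlog 2 T) - floorlog 2 (2 ^ k)"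
      unfolding floorlog_2_power by linarith
    let ?s = "s'(''h'' := (s' ''h'')(0 := 2 ^ Suc k))"
    have "eq_off work_vars s0 ?s" using s'(1) by (simp add: eq_off_def work_vars_def)
    moreover have "?s ''lo'' 0 = 0" "?s ''T'' 0 = T" "?s ''h'' 0 = 2 ^ Suc k" using s'(1) by auto
    ultimately have inv: "?I ?s \<and> Suc (floorlog 2 T) - floorlog 2 (?s ''h'' 0)
        < Suc (floorlog 2 T) - floorlog 2 (s' ''h'' 0)"
      using dec \<open>Suc k \<le> floorlog 2 T\<close> unfolding k(1) by metis
    have "aval (Plus (Var ''h'') (Var ''h'')) s' = 2 ^ Suc k" using k by simp
    then show "runs N (Set ''h'' (Plus (Var ''h'') (Var ''h''))) s' (\<lambda>s''. ?I s'' \<and>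
       Suc (floorlog 2 T) - floorlog 2 (s'' ''h'' 0) < Suc (floorlog 2 T) - floorlog 2 (s' ''h'' 0))"
      using inv by (intro runs_Assign) (simp only: aval.simps(1))
  qed auto
qed

lemma runs_search:
  assumes s: "env s" "\<forall>t<n. s ''ord'' t = ordered t" "s ''Kb'' 0 = K"
    and N: "2 * n \<le> N" "floorlog 2 (sum ld {..<n}) + 1 \<le> N"
  shows "runs N (search_prog b d) s (\<lambda>s'. eq_off work_vars s s' \<and>
    (\<forall>M. accepted_from K M \<longrightarrow>
      s' ''lo'' 0 + 1 \<le> M \<and> acceptable K (s' ''lo'' 0 + 1) (schedule (s' ''lo'' 0 + 1))))"
  (is "runs N _ s ?Q")
  unfolding search_prog_def
proof (rule runs_Seq_Assign, rule runs_Seq)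
  let ?T = "sum ld {..<n}"
  fix s0 assume s0: "s0 = s(''lo'' := (s ''lo'')(aval (Num 0) s := aval (Num 0) s))"
  have e0: "eq_off work_vars s s0" "s0 ''lo'' 0 = 0"
    by (simp_all add: s0 eq_off_def work_vars_def)
  then have e0': "env s0" using env_eq_off[OF e0(1) s(1)] by (simp add: work_vars_def)
  show "runs N (Sum ''T'' (Var ''n'') True_bexp (Get ''ld'' iv)) s0
    (\<lambda>s1. eq_off {''T'', ''i''} s0 s1 \<and> s1 ''T'' 0 = ?T)"
    by (rule runs_Sum[where m = n and B = "\<lambda>_. True" and f = ld])
      (use e0' N in \<open>auto simp: eq_off_def env_def lessThan_def\<close>)
  fix s1 assume s1: "eq_off {''T'', ''i''} s0 s1 \<and> s1 ''T'' 0 = ?T"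
  show "runs N (Seq (Set ''h'' (Num 1))
     (Seq (While (Neg (Less (Var ''T'') (Var ''h''))) (Set ''h'' (Plus (Var ''h'') (Var ''h''))))
     (While (Less (Num 1) (Var ''h'')) search_body))) s1 ?Q"
  proof (rule runs_Seq_Assign)
    fix s2 assume s2: "s2 = s1(''h'' := (s1 ''h'')(aval (Num 0) s1 := aval (Num 1) s1))"
    have e2: "eq_off work_vars s s2" "s2 ''lo'' 0 = 0" "s2 ''T'' 0 = ?T" "s2 ''h'' 0 = 1"
      using s1 e0 by (simp_all add: s2 eq_off_def work_vars_def)
    show "runs N (Seq (While (Neg (Less (Var ''T'') (Var ''h''))) (Set ''h'' (Plus (Var ''h'') (Var ''h''))))
     (While (Less (Num 1) (Var ''h'')) search_body)) s2 ?Q"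
    proof (rule runs_Seq[OF runs_doubling[OF e2 N(2)]], elim conjE)
      fix s3 assume s3: "eq_off work_vars s s3" "s3 ''lo'' 0 = 0" "?T < s3 ''h'' 0"
        "\<exists>k\<le>floorlog 2 ?T. s3 ''h'' 0 = 2 ^ k"
      show "runs N (While (Less (Num 1) (Var ''h'')) search_body) s3 ?Q"
      proof (rule runs_While[where I = "\<lambda>s'. search_inv K s s' \<and> (\<exists>k. s' ''h'' 0 = 2 ^ k)" and
            f = "\<lambda>s. floorlog 2 (s ''h'' 0)"])
        show "search_inv K s s3 \<and> (\<exists>k. s3 ''h'' 0 = 2 ^ k)"
          using s3 by (auto simp: search_inv_def accepted_from_def)
        show "floorlog 2 (s3 ''h'' 0) \<le> N" using s3 N by (auto simp: floorlog_2_power)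
      next
        fix s' assume s': "search_inv K s s' \<and> (\<exists>k. s' ''h'' 0 = 2 ^ k)"
          "\<not> bval (Less (Num 1) (Var ''h'')) s'"
        then obtain k where "s' ''h'' 0 = 2 ^ k" by auto
        \<comment> \<open>The loop is left when the power of two in \<open>h\<close> is at most 1,
          hence equal to 1; the accepted candidate \<open>lo + h\<close> is then the
          \<open>lo + 1\<close> of the output.\<close>
        then have "s' ''h'' 0 = 1" using s'(2) by (simp add: not_less le_Suc_eq)
        then show "?Q s'" using s'(1) by (auto simp: search_inv_def)
      next
        fix s4 assume s4: "search_inv K s s4 \<and> (\<exists>k. s4 ''h'' 0 = 2 ^ k)"
          "bval (Less (Num 1) (Var ''h'')) s4"
        then obtain k' where k': "s4 ''h'' 0 = 2 ^ k'" by blast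
        with s4(2) obtain k where "k' = Suc k" by (cases k') auto
        then have k: "s4 ''h'' 0 = 2 * 2 ^ k" using k' by simp
        have "floorlog 2 (2 ^ k) < floorlog 2 (s4 ''h'' 0)"
          unfolding k' \<open>k' = Suc k\<close> by (simp only: floorlog_2_power)
        then show "runs N search_body s4
          (\<lambda>s'. (search_inv K s s' \<and> (\<exists>k. s' ''h'' 0 = 2 ^ k)) \<and>
             floorlog 2 (s' ''h'' 0) < floorlog 2 (s4 ''h'' 0))"
          by (intro runs_mono[OF runs_search_body[OF s N(1) conjunct1[OF s4(1)] k]]) auto
      qed
    qed
  qed
qed

end

text \<open>Multiplication by a power of two through repeated doubling, since products of two
  variables are excluded. The number of rounds is polynomial because fraction lengths enter the
  input size by value.\<close>

definition double_prog :: "string \<Rightarrow> aexp \<Rightarrow> com" where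
  "double_prog x f = For ''i'' (Minus (Var ''E'') f) (Set x (Plus (Var x) (Var x)))"

definition scale_job_prog :: com where
  "scale_job_prog =
     Seq (Set ''x'' (Get ''load_digits'' jv))
     (Seq (double_prog ''x'' (Get ''load_frac'' jv))
     (Seq (Assign ''ld'' jv (Var ''x''))
     (Seq (Set ''x'' (Get ''demand_digits'' jv))
     (Seq (double_prog ''x'' (Get ''demand_frac'' jv))
     (Assign ''dm'' jv (Var ''x''))))))"

text \<open>The sum of all fraction lengths serves as common exponent: it is at least each of them,
  is computed by \<open>Sum\<close> and is still at most the input size.\<close>

definition scale_prog :: com where
  "scale_prog =
     Seq (Sum ''E'' (Var ''n'') True_bexp (Plus (Get ''load_frac'' iv) (Get ''demand_frac'' iv)))
     (Seq (Set ''E'' (Plus (Var ''E'') (Get ''K'' (Num 1))))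
     (Seq (For ''j'' (Var ''n'') scale_job_prog)
     (Seq (Set ''Kb'' (Var ''K''))
     (double_prog ''Kb'' (Get ''K'' (Num 1))))))"

definition main_prog :: "nat \<Rightarrow> nat \<Rightarrow> com" where
  "main_prog b d = Seq scale_prog (Seq order_prog (Seq (search_prog b d) (output_prog b d)))"

lemma runs_double:
  assumes x: "x \<noteq> ''i''"
    and M: "\<And>s'. eq_off {x, ''i''} s s' \<Longrightarrow> s' ''E'' 0 - aval f s' = m" and N: "m \<le> N"
  shows "runs N (double_prog x f) s (\<lambda>s'. eq_off {x, ''i''} s s' \<and> s' x 0 = s x 0 * 2 ^ m)"
  unfolding double_prog_def
proof (rule runs_For[where m = m and I = "\<lambda>k s'. eq_off {x, ''i''} s s' \<and> s' x 0 = s x 0 * 2 ^ k"])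
  fix k s' assume s': "k < m" "eq_off {x, ''i''} s s' \<and> s' x 0 = s x 0 * 2 ^ k" "s' ''i'' 0 = k"
  then have "aval (Plus (Var x) (Var x)) s' = s x 0 * 2 ^ Suc k" by simp
  then show "runs N (Set x (Plus (Var x) (Var x))) s' (\<lambda>s''. s'' ''i'' 0 = k \<and>
      eq_off {x, ''i''} s (s''(''i'' := (s'' ''i'')(0 := Suc k))) \<and>
      (s''(''i'' := (s'' ''i'')(0 := Suc k))) x 0 = s x 0 * 2 ^ Suc k)"
    using s' x by (intro runs_Assign) (simp only: aval.simps(1), simp add: eq_off_def)
qed (use assms in \<open>auto simp: eq_off_def\<close>)

lemma runs_scale_job:
  assumes s: "s ''j'' 0 = j" "s ''E'' 0 = E" and N: "E \<le> N"
  shows "runs N scale_job_prog s (\<lambda>s'. eq_off {''i'', ''x'', ''ld'', ''dm''} s s' \<and>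
    s' ''ld'' = (s ''ld'')(j := s ''load_digits'' j * 2 ^ (E - s ''load_frac'' j)) \<and>
    s' ''dm'' = (s ''dm'')(j := s ''demand_digits'' j * 2 ^ (E - s ''demand_frac'' j)))"
  (is "runs N _ s ?Q")
  unfolding scale_job_prog_def
proof (rule runs_Seq_Assign)
  fix s1 assume s1: "s1 = s(''x'' := (s ''x'')(aval (Num 0) s := aval (Get ''load_digits'' jv) s))"
  have r1: "runs N (double_prog ''x'' (Get ''load_frac'' jv)) s1
    (\<lambda>s'. eq_off {''x'', ''i''} s1 s' \<and> s' ''x'' 0 = s1 ''x'' 0 * 2 ^ (E - s ''load_frac'' j))"
    using s N by (intro runs_double) (auto simp: s1 eq_off_def)
  show "runs N (Seq (double_prog ''x'' (Get ''load_frac'' jv))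
     (Seq (Assign ''ld'' jv (Var ''x''))
     (Seq (Set ''x'' (Get ''demand_digits'' jv))
     (Seq (double_prog ''x'' (Get ''demand_frac'' jv))
     (Assign ''dm'' jv (Var ''x'')))))) s1 ?Q"
  proof (rule runs_Seq[OF r1], elim conjE, rule runs_Seq_Assign, rule runs_Seq_Assign)
    fix s2 s3 s4 assume s2: "eq_off {''x'', ''i''} s1 s2" "s2 ''x'' 0 = s1 ''x'' 0 * 2 ^ (E - s ''load_frac'' j)"
      and s3: "s3 = s2(''ld'' := (s2 ''ld'')(aval jv s2 := aval (Var ''x'') s2))"
      and s4: "s4 = s3(''x'' := (s3 ''x'')(aval (Num 0) s3 := aval (Get ''demand_digits'' jv) s3))"
    have e2: "eq_off {''i'', ''x''} s s2" "s2 ''x'' 0 = s ''load_digits'' j * 2 ^ (E - s ''load_frac'' j)"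
      using s2 s by (simp_all add: s1 eq_off_def)
    have j2: "s2 ''j'' 0 = j" using e2(1) s by (simp add: eq_off_def)
    have e4: "eq_off {''i'', ''x'', ''ld''} s s4" "s4 ''x'' 0 = s ''demand_digits'' j"
      "s4 ''ld'' = (s ''ld'')(j := s ''load_digits'' j * 2 ^ (E - s ''load_frac'' j))"
      using e2 j2 by (simp_all add: s3 s4 eq_off_def)
    have r4: "runs N (double_prog ''x'' (Get ''demand_frac'' jv)) s4
      (\<lambda>s'. eq_off {''x'', ''i''} s4 s' \<and> s' ''x'' 0 = s4 ''x'' 0 * 2 ^ (E - s ''demand_frac'' j))"
      using s N e4(1) by (intro runs_double) (auto simp: eq_off_def)
    show "runs N (Seq (double_prog ''x'' (Get ''demand_frac'' jv))
      (Assign ''dm'' jv (Var ''x''))) s4 ?Q"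
    proof (rule runs_Seq[OF r4], elim conjE, rule runs_Assign)
      fix s5 assume s5: "eq_off {''x'', ''i''} s4 s5" "s5 ''x'' 0 = s4 ''x'' 0 * 2 ^ (E - s ''demand_frac'' j)"
      have "s5 ''j'' 0 = j" "s5 ''dm'' = s ''dm''" "s5 ''ld'' = s4 ''ld''" "eq_off {''i'', ''x'', ''ld''} s s5"
        using e4(1) s5(1) s by (simp_all add: eq_off_def)
      then show "?Q (s5(''dm'' := (s5 ''dm'')(aval jv s5 := aval (Var ''x'') s5)))"
        using s5(2) e4(2,3) by (simp add: eq_off_def)
    qed
  qed
qed

lemma runs_scale:
  assumes s: "s ''n'' 0 = n"
    and E: "E = (\<Sum>j<n. s ''load_frac'' j + s ''demand_frac'' j) + s ''K'' 1"
    and N: "n \<le> N" "E \<le> N"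
  shows "runs N scale_prog s (\<lambda>s'. eq_off {''E'', ''i'', ''j'', ''x'', ''ld'', ''dm'', ''Kb''} s s' \<and>
    s' ''E'' 0 = E \<and>
    (\<forall>j<n. s' ''ld'' j = s ''load_digits'' j * 2 ^ (E - s ''load_frac'' j)) \<and>
    (\<forall>j<n. s' ''dm'' j = s ''demand_digits'' j * 2 ^ (E - s ''demand_frac'' j)) \<and>
    s' ''Kb'' 0 = s ''K'' 0 * 2 ^ (E - s ''K'' 1))" (is "runs N _ s ?Q")
  unfolding scale_prog_def
proof (rule runs_Seq)
  let ?E = "\<Sum>j<n. s ''load_frac'' j + s ''demand_frac'' j"
  show "runs N (Sum ''E'' (Var ''n'') True_bexp (Plus (Get ''load_frac'' iv) (Get ''demand_frac'' iv))) s
    (\<lambda>s1. eq_off {''E'', ''i''} s s1 \<and> s1 ''E'' 0 = ?E)"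
    by (rule runs_Sum[where m = n and B = "\<lambda>_. True" and f = "\<lambda>j. s ''load_frac'' j + s ''demand_frac'' j"])
      (use s N in \<open>auto simp: eq_off_def lessThan_def\<close>)
  fix s1 assume s1: "eq_off {''E'', ''i''} s s1 \<and> s1 ''E'' 0 = ?E"
  let ?I = "\<lambda>k s'. eq_off {''E'', ''i'', ''j'', ''x'', ''ld'', ''dm''} s s' \<and> s' ''E'' 0 = E \<and>
    (\<forall>j<k. s' ''ld'' j = s ''load_digits'' j * 2 ^ (E - s ''load_frac'' j)) \<and>
    (\<forall>j<k. s' ''dm'' j = s ''demand_digits'' j * 2 ^ (E - s ''demand_frac'' j))"
  show "runs N (Seq (Set ''E'' (Plus (Var ''E'') (Get ''K'' (Num 1))))
     (Seq (For ''j'' (Var ''n'') scale_job_prog)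
     (Seq (Set ''Kb'' (Var ''K''))
     (double_prog ''Kb'' (Get ''K'' (Num 1)))))) s1 ?Q"
  proof (rule runs_Seq_Assign, rule runs_Seq[where R = "?I n"])
    fix s2 assume s2: "s2 = s1(''E'' := (s1 ''E'')(aval (Num 0) s1 := aval (Plus (Var ''E'') (Get ''K'' (Num 1))) s1))"
    have e2: "eq_off {''E'', ''i''} s s2" "s2 ''E'' 0 = E"
      using s1 by (simp_all add: s2 E eq_off_def)
    show "runs N (For ''j'' (Var ''n'') scale_job_prog) s2 (?I n)"
    proof (rule runs_For[where m = n and I = ?I])
      show "?I 0 (s2(''j'' := (s2 ''j'')(0 := 0)))" using e2 by (simp add: eq_off_def)
    next
      fix k s3 assume s3: "k < n" "?I k s3" "s3 ''j'' 0 = k"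
      then have "s3 ''E'' 0 = E" by simp
      show "runs N scale_job_prog s3 (\<lambda>s'. s' ''j'' 0 = k \<and> ?I (Suc k) (s'(''j'' := (s' ''j'')(0 := Suc k))))"
        by (rule runs_mono[OF runs_scale_job[where s = s3 and j = k and E = E, OF s3(3) \<open>s3 ''E'' 0 = E\<close> N(2)]])
          (use s3 in \<open>simp add: eq_off_def less_Suc_eq\<close>)
    qed (use s N in \<open>auto simp: eq_off_def\<close>)
  next
    fix s4 assume s4: "?I n s4"
    show "runs N (Seq (Set ''Kb'' (Var ''K'')) (double_prog ''Kb'' (Get ''K'' (Num 1)))) s4 ?Q"
    proof (rule runs_Seq_Assign)
      fix s5 assume s5: "s5 = s4(''Kb'' := (s4 ''Kb'')(aval (Num 0) s4 := aval (Var ''K'') s4))"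
      have e5: "s5 ''E'' 0 = E" "s5 ''K'' = s ''K''" "s5 ''Kb'' 0 = s ''K'' 0"
        using s4 by (simp_all add: s5 eq_off_def)
      have r5: "runs N (double_prog ''Kb'' (Get ''K'' (Num 1))) s5
        (\<lambda>s'. eq_off {''Kb'', ''i''} s5 s' \<and> s' ''Kb'' 0 = s5 ''Kb'' 0 * 2 ^ (E - s ''K'' 1))"
        using N e5 by (intro runs_double) (auto simp: eq_off_def)
      show "runs N (double_prog ''Kb'' (Get ''K'' (Num 1))) s5 ?Q"
        by (rule runs_mono[OF r5]) (use s4 e5(3) in \<open>simp add: s5 eq_off_def\<close>)
    qed
  qed
qed

context scheduling
begin

text \<open>The last conjunct is needed because the cache is summed over all \<open>c\<close> cores,
  including those never visited.\<close>

definition is_output :: "nat \<Rightarrow> (nat \<Rightarrow> nat) \<Rightarrow> state \<Rightarrow> bool" where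
  "is_output E S s \<longleftrightarrow> (\<forall>j<n. s ''S'' j = S j) \<and>
    (\<forall>j<n. first_on_core S j \<longrightarrow> s ''p_digits'' (S j) = dm j \<and> s ''p_frac'' (S j) = E) \<and>
    (\<forall>q. q \<notin> S ` {j. j < n \<and> first_on_core S j} \<longrightarrow> s ''p_digits'' q = 0 \<and> s ''p_frac'' q = 0)"

lemma runs_output:
  assumes s: "env s" "\<forall>t<n. s ''ord'' t = ordered t" "s ''E'' 0 = E" "s ''lo'' 0 + 1 = m"
    "s ''p_digits'' = (\<lambda>_. 0)" "s ''p_frac'' = (\<lambda>_. 0)"
    and N: "2 * n \<le> N"
  shows "runs N (output_prog b d) s (is_output E (schedule m))"
  unfolding output_prog_def
proof (rule runs_Seq_Assign)
  let ?S = "schedule m"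
  let ?write = "Cond (Less (Get ''first'' (Var ''t'')) (Num 1))
       (Seq (Assign ''p_digits'' (Get ''S'' (Var ''t'')) (Get ''dm'' (Var ''t'')))
         (Assign ''p_frac'' (Get ''S'' (Var ''t'')) (Var ''E''))) Skip"
  fix s1 assume s1: "s1 = s(''m'' := (s ''m'')(aval (Num 0) s := aval (Plus (Var ''lo'') (Num 1)) s))"
  have e1: "eq_off {''m''} s s1" "s1 ''m'' 0 = m" using s(4) by (simp_all add: s1 eq_off_def)
  then have e1': "env s1" "\<forall>t<n. s1 ''ord'' t = ordered t"
    using s env_eq_off[OF e1(1) s(1)] by (simp_all add: eq_off_def)
  show "runs N (Seq (schedule_prog b d) (Seq first_prog (For ''t'' (Var ''n'') ?write))) s1
    (is_output E ?S)"
  proof (rule runs_Seq[OF runs_schedule[OF e1'(1) e1(2) e1'(2) N]], elim conjE)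
    fix s2 assume s2: "eq_off {''rk'', ''group'', ''G'', ''S'', ''cur'', ''t'', ''j'', ''r'', ''i''} s1 s2"
      "\<forall>j<n. s2 ''S'' j = ?S j"
    have e2: "env s2" using env_eq_off[OF s2(1) e1'(1)] by simp
    show "runs N (Seq first_prog (For ''t'' (Var ''n'') ?write)) s2 (is_output E ?S)"
    proof (rule runs_Seq[OF runs_first[OF e2 s2(2) N]], elim conjE)
      fix s3 assume s3: "eq_off {''first'', ''j'', ''r'', ''i''} s2 s3"
        "\<forall>j<n. (s3 ''first'' j = 0) = first_on_core ?S j"
      have e3: "env s3" using env_eq_off[OF s3(1) e2] by simp
      have e3': "s3 ''E'' 0 = E" "s3 ''p_digits'' = (\<lambda>_. 0)" "s3 ''p_frac'' = (\<lambda>_. 0)"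
        "\<forall>j<n. s3 ''S'' j = ?S j"
        using s3(1) s2 e1 s by (simp_all add: eq_off_def)
      let ?I = "\<lambda>t s'. eq_off {''t'', ''p_digits'', ''p_frac''} s3 s' \<and>
        (\<forall>j<t. first_on_core ?S j \<longrightarrow> s' ''p_digits'' (?S j) = dm j \<and> s' ''p_frac'' (?S j) = E) \<and>
        (\<forall>q. q \<notin> ?S ` {j. j < t \<and> first_on_core ?S j} \<longrightarrow> s' ''p_digits'' q = 0 \<and> s' ''p_frac'' q = 0)"
      show "runs N (For ''t'' (Var ''n'') ?write) s3 (is_output E ?S)"
      proof (rule runs_For[where m = n and I = ?I])
        show "?I 0 (s3(''t'' := (s3 ''t'')(0 := 0)))" using e3' by (simp add: eq_off_def)
      next
        fix k s4 assume s4: "k < n" "?I k s4" "s4 ''t'' 0 = k"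
        have e4: "s4 ''first'' k = s3 ''first'' k" "s4 ''S'' k = ?S k" "s4 ''dm'' k = dm k" "s4 ''E'' 0 = E"
          using s4 e3 e3' by (simp_all add: eq_off_def env_def)
        have first: "bval (Less (Get ''first'' (Var ''t'')) (Num 1)) s4 \<longleftrightarrow> first_on_core ?S k"
          using s3(2) s4(1,3) e4(1) by simp
        show "runs N ?write s4 (\<lambda>s'. s' ''t'' 0 = k \<and> ?I (Suc k) (s'(''t'' := (s' ''t'')(0 := Suc k))))"
        proof (rule runs_Cond)
          assume "bval (Less (Get ''first'' (Var ''t'')) (Num 1)) s4"
          then have k: "first_on_core ?S k" using first by blast
          \<comment> \<open>Different first jobs are on different cores, so no entry of the
            partition is overwritten.\<close>
          then have ne: "?S j \<noteq> ?S k" if "j < k" "first_on_core ?S j" for j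
            using inj_onD[OF inj_on_first_on_core[of ?S], of j k] that s4(1) by auto
          show "runs N (Seq (Assign ''p_digits'' (Get ''S'' (Var ''t'')) (Get ''dm'' (Var ''t'')))
              (Assign ''p_frac'' (Get ''S'' (Var ''t'')) (Var ''E''))) s4
            (\<lambda>s'. s' ''t'' 0 = k \<and> ?I (Suc k) (s'(''t'' := (s' ''t'')(0 := Suc k))))"
          proof (rule runs_Seq_Assign, rule runs_Assign)
            fix s5 assume s5: "s5 = s4(''p_digits'' := (s4 ''p_digits'')
              (aval (Get ''S'' (Var ''t'')) s4 := aval (Get ''dm'' (Var ''t'')) s4))"
            let ?s6 = "s5(''p_frac'' := (s5 ''p_frac'')
              (aval (Get ''S'' (Var ''t'')) s5 := aval (Var ''E'') s5))"
            have "?s6 = s4(''p_digits'' := (s4 ''p_digits'')(?S k := dm k), ''p_frac'' := (s4 ''p_frac'')(?S k := E))"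
              using s4(3) e4 by (simp add: s5)
            moreover have "{j. j < Suc k \<and> first_on_core ?S j} = insert k {j. j < k \<and> first_on_core ?S j}"
              using k by (auto simp: less_Suc_eq)
            ultimately show "?s6 ''t'' 0 = k \<and> ?I (Suc k) (?s6(''t'' := (?s6 ''t'')(0 := Suc k)))"
              using s4(2,3) ne by (simp add: eq_off_def less_Suc_eq)
          qed
        next
          assume "\<not> bval (Less (Get ''first'' (Var ''t'')) (Num 1)) s4"
          then have k: "\<not> first_on_core ?S k" using first by blast
          then have "{j. j < Suc k \<and> first_on_core ?S j} = {j. j < k \<and> first_on_core ?S j}"
            by (auto simp: less_Suc_eq)
          then show "runs N Skip s4 (\<lambda>s'. s' ''t'' 0 = k \<and> ?I (Suc k) (s'(''t'' := (s' ''t'')(0 := Suc k))))"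
            using s4(2,3) k by (intro runs_Skip) (simp add: eq_off_def less_Suc_eq)
        qed
      next
        fix s' assume s': "?I n s'"
        then have "\<forall>j<n. s' ''S'' j = ?S j" using e3' by (simp add: eq_off_def)
        then show "is_output E ?S s'" using s' by (simp add: is_output_def)
      qed (use e3 N in \<open>auto simp: eq_off_def env_def\<close>)
    qed
  qed
qed

lemma runs_order_search_output:
  assumes s: "env s" "s ''Kb'' 0 = K" "s ''E'' 0 = E" "s ''p_digits'' = (\<lambda>_. 0)" "s ''p_frac'' = (\<lambda>_. 0)"
    and N: "2 * n \<le> N" "floorlog 2 (sum ld {..<n}) + 1 \<le> N"
  shows "runs N (Seq order_prog (Seq (search_prog b d) (output_prog b d))) s
    (\<lambda>s'. \<exists>m. is_output E (schedule m) s' \<and>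
      (\<forall>M. accepted_from K M \<longrightarrow> m \<le> M \<and> acceptable K m (schedule m)))" (is "runs N _ s ?Q")
proof (rule runs_Seq[OF runs_order[OF s(1) N(1)]], elim conjE)
  fix s1 assume s1: "eq_off {''rk'', ''ord'', ''j'', ''r'', ''i''} s s1" "\<forall>t<n. s1 ''ord'' t = ordered t"
  have e1: "env s1" "s1 ''Kb'' 0 = K"
    using s env_eq_off[OF s1(1) s(1)] s1(1) by (simp_all add: eq_off_def)
  show "runs N (Seq (search_prog b d) (output_prog b d)) s1 ?Q"
  proof (rule runs_Seq[OF runs_search[OF e1(1) s1(2) e1(2) N]], elim conjE)
    fix s2 assume s2: "eq_off work_vars s1 s2" and
      lo: "\<forall>M. accepted_from K M \<longrightarrow>
        s2 ''lo'' 0 + 1 \<le> M \<and> acceptable K (s2 ''lo'' 0 + 1) (schedule (s2 ''lo'' 0 + 1))"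
    have "env s2" using env_eq_off[OF s2 e1(1)] by (simp add: work_vars_def)
    moreover have "\<forall>t<n. s2 ''ord'' t = ordered t" "s2 ''E'' 0 = E"
      "s2 ''p_digits'' = (\<lambda>_. 0)" "s2 ''p_frac'' = (\<lambda>_. 0)"
      using s s1 s2 by (simp_all add: eq_off_def work_vars_def)
    ultimately have "runs N (output_prog b d) s2 (is_output E (schedule (s2 ''lo'' 0 + 1)))"
      using N by (intro runs_output) auto
    then show "runs N (output_prog b d) s2 ?Q"
      by (rule runs_mono) (use lo in blast)
  qed
qed

end

lemma linear_main_prog: "linear_com (main_prog b d)"
  by (simp add: main_prog_def scale_prog_def scale_job_prog_def double_prog_def order_prog_def
      search_prog_def output_prog_def schedule_prog_def big_prog_def medium_rank_prog_def
      group_prog_def group_load_prog_def big_core_prog_def greedy_prog_def first_prog_def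
      check_prog_def Table_def Sum_def For_def True_bexp_def Eq_def Before_def Big_def Medium_def)

section \<open>Integer instances\<close>

definition total_frac :: "cache_instance \<Rightarrow> nat" where
  "total_frac I = (\<Sum>j<length (jobs I). snd (fst (jobs I ! j)) + snd (snd (jobs I ! j))) + snd (cache I)"

definition scaled :: "cache_instance \<Rightarrow> binnum \<Rightarrow> nat" where
  "scaled I a = fst a * 2 ^ (total_frac I - snd a)"

definition scaled_load :: "cache_instance \<Rightarrow> nat \<Rightarrow> nat" where
  "scaled_load I j = scaled I (fst (jobs I ! j))"

definition scaled_demand :: "cache_instance \<Rightarrow> nat \<Rightarrow> nat" where
  "scaled_demand I j = scaled I (snd (jobs I ! j))"

lemma bin_val_scaled: "snd a \<le> total_frac I \<Longrightarrow> bin_val a = real (scaled I a) / 2 ^ total_frac I"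
  by (simp add: bin_val_def scaled_def field_simps flip: power_add)

lemma snd_le_total_frac:
  assumes "j < length (jobs I)"
  shows "snd (fst (jobs I ! j)) \<le> total_frac I" "snd (snd (jobs I ! j)) \<le> total_frac I"
proof -
  have "snd (fst (jobs I ! j)) + snd (snd (jobs I ! j)) \<le>
    (\<Sum>j<length (jobs I). snd (fst (jobs I ! j)) + snd (snd (jobs I ! j)))"
    using assms by (intro member_le_sum) auto
  then show "snd (fst (jobs I ! j)) \<le> total_frac I" "snd (snd (jobs I ! j)) \<le> total_frac I"
    unfolding total_frac_def by linarith+
qed

lemma job_load_scaled:
  "j < length (jobs I) \<Longrightarrow> job_load I j = real (scaled_load I j) / 2 ^ total_frac I"
  by (simp add: job_load_def scaled_load_def bin_val_scaled snd_le_total_frac)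

lemma job_demand_scaled:
  "j < length (jobs I) \<Longrightarrow> job_demand I j = real (scaled_demand I j) / 2 ^ total_frac I"
  by (simp add: job_demand_def scaled_demand_def bin_val_scaled snd_le_total_frac)

lemma cache_scaled: "bin_val (cache I) = real (scaled I (cache I)) / 2 ^ total_frac I"
  by (rule bin_val_scaled) (simp add: total_frac_def)

section \<open>Bounds in terms of the input size\<close>

lemma instance_size_eq:
  "instance_size I = floorlog 2 (cores I) + bin_size (cache I) +
     (\<Sum>j<length (jobs I). bin_size (fst (jobs I ! j)) + bin_size (snd (jobs I ! j)))"
  by (simp add: instance_size_def sum_list_sum_nth atLeast0LessThan case_prod_beta)

lemma bin_size_job_le:
  assumes "j < length (jobs I)"
  shows "bin_size (fst (jobs I ! j)) + bin_size (snd (jobs I ! j)) \<le> instance_size I"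
proof -
  have "bin_size (fst (jobs I ! j)) + bin_size (snd (jobs I ! j)) \<le>
    (\<Sum>j<length (jobs I). bin_size (fst (jobs I ! j)) + bin_size (snd (jobs I ! j)))"
    using assms by (intro member_le_sum) auto
  then show ?thesis by (simp add: instance_size_eq)
qed

lemma two_length_jobs_le: "2 * length (jobs I) \<le> instance_size I"
proof -
  have "(\<Sum>j<length (jobs I). 2) \<le>
    (\<Sum>j<length (jobs I). bin_size (fst (jobs I ! j)) + bin_size (snd (jobs I ! j)))"
    by (intro sum_mono) (simp add: bin_size_def)
  then show ?thesis by (simp add: instance_size_eq)
qed

lemma total_frac_le: "total_frac I \<le> instance_size I"
proof -
  have "(\<Sum>j<length (jobs I). snd (fst (jobs I ! j)) + snd (snd (jobs I ! j))) \<le>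
    (\<Sum>j<length (jobs I). bin_size (fst (jobs I ! j)) + bin_size (snd (jobs I ! j)))"
    by (intro sum_mono) (simp add: bin_size_def)
  then show ?thesis by (simp add: instance_size_eq total_frac_def bin_size_def)
qed

text \<open>For powers of two x, y \<ge> 1 one has x + y \<le> 2xy, so each summand costs its digits
  and one more for the carry.\<close>

lemma sum_less_power_floorlog:
  fixes n :: nat
  shows "(\<Sum>j<n. f j) < (2::nat) ^ (\<Sum>j<n. 1 + floorlog 2 (f j))"
proof (induction n)
  case (Suc n)
  let ?k = "\<Sum>j<n. 1 + floorlog 2 (f j)"
  have 1: "(1::nat) \<le> 2 ^ ?k" "(1::nat) \<le> 2 ^ floorlog 2 (f n)" by simp_all
  have "(\<Sum>j<Suc n. f j) < 2 ^ ?k + 2 ^ floorlog 2 (f n)"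
    using Suc less_power_floorlog_2[of "f n"] by simp
  also have "\<dots> \<le> 2 ^ ?k * 2 ^ floorlog 2 (f n) + 2 ^ ?k * 2 ^ floorlog 2 (f n)"
    using mult_le_mono[OF le_refl 1(2), of "2 ^ ?k"] mult_le_mono[OF 1(1) le_refl, of "2 ^ floorlog 2 (f n)"]
    by (intro add_mono) simp_all
  also have "\<dots> = 2 ^ (\<Sum>j<Suc n. 1 + floorlog 2 (f j))" by (simp add: power_add)
  finally show ?case .
qed simp

text \<open>One input size pays for the digits and carries of the unscaled loads, the other for the
  shift by \<open>total_frac I\<close>.\<close>

lemma floorlog_total_load: "floorlog 2 (sum (scaled_load I) {..<length (jobs I)}) \<le> 2 * instance_size I"
proof -
  let ?d = "\<lambda>j. fst (fst (jobs I ! j))" and ?n = "length (jobs I)"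
  let ?k = "\<Sum>j<?n. 1 + floorlog 2 (?d j)"
  have "sum (scaled_load I) {..<?n} \<le> (\<Sum>j<?n. ?d j * 2 ^ total_frac I)"
    by (intro sum_mono) (simp add: scaled_load_def scaled_def)
  also have "\<dots> = (\<Sum>j<?n. ?d j) * 2 ^ total_frac I" by (simp add: sum_distrib_right)
  also have "\<dots> < 2 ^ ?k * 2 ^ total_frac I"
    by (intro mult_strict_right_mono sum_less_power_floorlog) simp
  finally have "floorlog 2 (sum (scaled_load I) {..<?n}) \<le> ?k + total_frac I"
    by (simp add: floorlog_2_le_iff power_add)
  also have "?k \<le> (\<Sum>j<?n. bin_size (fst (jobs I ! j)) + bin_size (snd (jobs I ! j)))"
    by (intro sum_mono) (simp add: bin_size_def)
  also have "\<dots> \<le> instance_size I" by (simp add: instance_size_eq)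
  finally show ?thesis using total_frac_le[of I] by simp
qed

lemma floorlog_2_le_self: "floorlog 2 x \<le> x"
  by (simp add: floorlog_2_le_iff)

lemma floorlog_array: "(\<And>x. x \<in> set xs \<Longrightarrow> floorlog 2 x \<le> W) \<Longrightarrow> floorlog 2 (array xs i) \<le> W"
  using floorlog_2_le_self[of 0] by (cases "i < length xs") (simp_all add: array_def)

text \<open>Starting value for the growth of bit lengths. Fraction lengths fit because their values,
  not just their digits, are part of the input size.\<close>

lemma bits_le_input: "bits_le (instance_size I) (input_state I)"
proof -
  let ?Z = "instance_size I"
  have job: "floorlog 2 a \<le> ?Z" "floorlog 2 e \<le> ?Z" "floorlog 2 x \<le> ?Z" "floorlog 2 f \<le> ?Z"
    if x: "((a, e), (x, f)) \<in> set (jobs I)" for a e x f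
  proof -
    obtain j where j: "j < length (jobs I)" "jobs I ! j = ((a, e), (x, f))" using x by (metis in_set_conv_nth)
    then have "bin_size (a, e) + bin_size (x, f) \<le> ?Z" using bin_size_job_le[OF j(1)] by simp
    then show "floorlog 2 a \<le> ?Z" "floorlog 2 e \<le> ?Z" "floorlog 2 x \<le> ?Z" "floorlog 2 f \<le> ?Z"
      using floorlog_2_le_self[of e] floorlog_2_le_self[of f] by (simp_all add: bin_size_def)
  qed
  have other: "floorlog 2 (length (jobs I)) \<le> ?Z" "floorlog 2 (cores I) \<le> ?Z"
    "floorlog 2 (fst (cache I)) \<le> ?Z" "floorlog 2 (snd (cache I)) \<le> ?Z"
    using floorlog_2_le_self[of "length (jobs I)"] floorlog_2_le_self[of "snd (cache I)"]
      two_length_jobs_le[of I]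
    by (simp_all add: instance_size_eq bin_size_def)
  have "floorlog 2 (input_state I v i) \<le> ?Z" for v i
  proof -
    have "floorlog 2 (array [] i) \<le> ?Z" "floorlog 2 (array [length (jobs I)] i) \<le> ?Z"
      "floorlog 2 (array [cores I] i) \<le> ?Z" "floorlog 2 (array [fst (cache I), snd (cache I)] i) \<le> ?Z"
      by (rule floorlog_array, use other in auto)+
    moreover have "floorlog 2 (array (map (\<lambda>(a, x). fst a) (jobs I)) i) \<le> ?Z"
      "floorlog 2 (array (map (\<lambda>(a, x). snd a) (jobs I)) i) \<le> ?Z"
      "floorlog 2 (array (map (\<lambda>(a, x). fst x) (jobs I)) i) \<le> ?Z"
      "floorlog 2 (array (map (\<lambda>(a, x). snd x) (jobs I)) i) \<le> ?Z"
      by (rule floorlog_array, auto intro: job)+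
    ultimately show ?thesis by (simp add: input_state_def)
  qed
  then show ?thesis by (simp add: bits_le_def)
qed

text \<open>A single bound on the iterations of all loops; it is dictated by the search, whose loops
  take up to one round more than the total load has digits. The loops over jobs, labels and fraction
  digits stay below the input size.\<close>

lemma runs_main:
  fixes I :: cache_instance and b d :: nat
  defines "n \<equiv> length (jobs I)" and "c \<equiv> cores I" and "K \<equiv> scaled I (cache I)"
  shows "runs (1 + 2 * instance_size I) (main_prog b d) (input_state I)
    (\<lambda>s'. \<exists>m S. scheduling.is_output n (scaled_demand I) (total_frac I) S s' \<and>
      (\<forall>M. scheduling.accepted_from n c b d (scaled_load I) (scaled_demand I) K M \<longrightarrow>
        m \<le> M \<and> scheduling.acceptable n c b (scaled_load I) (scaled_demand I) K m S))"
proof -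
  interpret scheduling n c b d "scaled_load I" "scaled_demand I" .
  let ?s = "input_state I" and ?N = "1 + 2 * instance_size I"
  have input: "?s ''n'' 0 = n" "?s ''c'' 0 = c" "?s ''K'' 0 = fst (cache I)" "?s ''K'' 1 = snd (cache I)"
    "?s ''p_digits'' = (\<lambda>_. 0)" "?s ''p_frac'' = (\<lambda>_. 0)"
    by (simp_all add: input_state_def array_def n_def c_def fun_eq_iff)
  have input_jobs: "?s ''load_digits'' j = fst (fst (jobs I ! j))" "?s ''load_frac'' j = snd (fst (jobs I ! j))"
    "?s ''demand_digits'' j = fst (snd (jobs I ! j))" "?s ''demand_frac'' j = snd (snd (jobs I ! j))"
    if "j < n" for j
    using that by (simp_all add: input_state_def array_def n_def case_prod_beta)
  have E: "total_frac I = (\<Sum>j<n. ?s ''load_frac'' j + ?s ''demand_frac'' j) + ?s ''K'' 1"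
    using input input_jobs by (simp add: total_frac_def n_def)
  have N: "n \<le> ?N" "total_frac I \<le> ?N" "2 * n \<le> ?N"
    "floorlog 2 (sum (scaled_load I) {..<n}) + 1 \<le> ?N"
    using two_length_jobs_le[of I] total_frac_le[of I] floorlog_total_load[of I] by (simp_all add: n_def)
  show ?thesis
    unfolding main_prog_def
  proof (rule runs_Seq[OF runs_scale[OF input(1) E N(1,2)]], elim conjE)
    fix s1 assume s1: "eq_off {''E'', ''i'', ''j'', ''x'', ''ld'', ''dm'', ''Kb''} ?s s1"
      "s1 ''E'' 0 = total_frac I"
      "\<forall>j<n. s1 ''ld'' j = ?s ''load_digits'' j * 2 ^ (total_frac I - ?s ''load_frac'' j)"
      "\<forall>j<n. s1 ''dm'' j = ?s ''demand_digits'' j * 2 ^ (total_frac I - ?s ''demand_frac'' j)"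
      "s1 ''Kb'' 0 = ?s ''K'' 0 * 2 ^ (total_frac I - ?s ''K'' 1)"
    have "s1 ''n'' 0 = n" "s1 ''c'' 0 = c" "s1 ''p_digits'' = (\<lambda>_. 0)" "s1 ''p_frac'' = (\<lambda>_. 0)"
      using s1(1) input by (simp_all add: eq_off_def)
    moreover from this have "env s1"
      using s1(3,4) input_jobs by (simp add: env_def scaled_load_def scaled_demand_def scaled_def)
    moreover have "s1 ''Kb'' 0 = K" using s1(5) input by (simp add: K_def scaled_def)
    ultimately show "runs ?N (Seq order_prog (Seq (search_prog b d) (output_prog b d))) s1
      (\<lambda>s'. \<exists>m S. is_output (total_frac I) S s' \<and>
        (\<forall>M. accepted_from K M \<longrightarrow> m \<le> M \<and> acceptable K m S))"
      using s1(2) N by (intro runs_mono[OF runs_order_search_output]) auto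
  qed
qed

text \<open>The optimum enters only through \<open>M\<close>, its makespan in scaled units: every
  candidate from there on is accepted, so the search returns some \<open>m\<close> that is at most
  \<open>M\<close> as soon as there is a job. The returned \<open>m\<close> may be smaller than
  \<open>M\<close>, which only helps, since acceptance was checked directly.\<close>

lemma is_output_correct:
  fixes I :: cache_instance and b d :: nat
  defines "n \<equiv> length (jobs I)" and "c \<equiv> cores I" and "K \<equiv> scaled I (cache I)"
  assumes valid: "valid_instance I"
    and feasible: "feasible n (job_demand I) c (bin_val (cache I))"
    and parameters: "(b, d) \<in> {(1, 0), (2, 0), (3, 2)}"
    and out: "scheduling.is_output n (scaled_demand I) (total_frac I) S s"
    and accepted: "\<And>M. scheduling.accepted_from n c b d (scaled_load I) (scaled_demand I) K M \<Longrightarrow>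
        m \<le> M \<and> scheduling.acceptable n c b (scaled_load I) (scaled_demand I) K m S"
  shows "solution n (job_demand I) c (real b * bin_val (cache I))
      (\<lambda>i. bin_val (output_partition s i)) (output_assignment s)" (is ?sol)
    and "makespan n (job_load I) c (output_assignment s) \<le>
      (real b + 1) / real b * m_opt n (job_load I) (job_demand I) c (bin_val (cache I))" (is ?mak)
proof -
  interpret scheduling n c b d "scaled_load I" "scaled_demand I" .
  let ?E = "total_frac I" and ?opt = "m_opt n (job_load I) (job_demand I) c (bin_val (cache I))"
  have w: "(0::real) < 2 ^ ?E" by simp
  have c: "1 \<le> c" and load_pos: "0 < scaled_load I j" if "j < n" for j
    using valid that job_load_scaled[of j I] by (auto simp: valid_instance_def c_def n_def zero_less_divide_iff)
  have c: "1 \<le> c" using valid by (simp add: valid_instance_def c_def)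
  have b: "0 < b" using parameters by auto
  have core: "(\<Sum>j | j < n \<and> S' j = i. job_load I j) = real (core_load S' i) / 2 ^ ?E" for S' i
    unfolding core_load_def by (simp add: job_load_scaled n_def sum_divide_distrib)
  obtain p S' where opt: "solution n (job_demand I) c (bin_val (cache I)) p S'"
    "makespan n (job_load I) c S' = ?opt"
    using m_opt_attained(1)[OF feasible] by blast
  define M where "M = Max (core_load S' ` {..<c})"
  have M: "core_load S' i \<le> M" if "i < c" for i
    unfolding M_def using that by (intro Max_ge) auto
  have "M \<in> core_load S' ` {..<c}"
    unfolding M_def using c by (intro Max_in) (auto simp: lessThan_empty_iff)
  then obtain i where i: "i < c" "M = core_load S' i" by auto
  have "real M / 2 ^ ?E \<le> makespan n (job_load I) c S'"
    unfolding makespan_def core using i by (intro Max_ge) auto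
  then have M_opt: "real M \<le> ?opt * 2 ^ ?E" using opt(2) w by (simp add: divide_le_eq)
  have S': "S' j < c" if "j < n" for j using opt(1) that by (simp add: solution_def)
  have M_pos: "0 < M" if "j < n" for j
  proof -
    have "scaled_load I j \<le> core_load S' (S' j)"
      unfolding core_load_def using that by (intro member_le_sum) auto
    then show ?thesis using load_pos[OF that] M[OF S'[OF that]] by simp
  qed
  \<comment> \<open>Without jobs \<open>M\<close> is 0, but the search needs a positive
    value.\<close>
  have "accepted_from K (max 1 M)"
    unfolding accepted_from_def
  proof (intro conjI allI impI)
    have "M \<le> sum (scaled_load I) {..<n}"
      unfolding i core_load_def by (intro sum_mono2) auto
    then show "max 1 M \<le> sum (scaled_load I) {..<n} + 1" by simp
    fix m' assume m': "max 1 M \<le> m'"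
    \<comment> \<open>The optimal solution, with its cache scaled by \<open>2 ^ ?E\<close>, serves
      for every \<open>m'\<close> above its makespan.\<close>
    interpret feasible_makespan n c b d "scaled_load I" "scaled_demand I" K m' "\<lambda>i. p i * 2 ^ ?E" S'
    proof
      show "(\<Sum>i<c. p i * 2 ^ ?E) \<le> real K"
        using opt(1) w unfolding sum_distrib_right[symmetric]
        by (simp add: solution_def cache_scaled K_def le_divide_eq)
      show "real (scaled_demand I j) \<le> p (S' j) * 2 ^ ?E" if "j < n" for j
      proof -
        have "job_demand I j \<le> p (S' j)" using opt(1) that by (simp add: solution_def)
        then have "real (scaled_demand I j) / 2 ^ ?E \<le> p (S' j)"
          using job_demand_scaled[OF that[unfolded n_def]] by simp
        then show ?thesis using w by (simp add: divide_le_eq)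
      qed
      show "core_load S' i \<le> m'" if "i < c" for i using M[OF that] m' by simp
    qed (use opt(1) parameters c load_pos in \<open>auto simp: solution_def\<close>)
    show "acceptable K m' (schedule m')" by (rule acceptable_schedule)
  qed simp
  then have m: "m \<le> max 1 M" and acc: "acceptable K m S" using accepted by blast+
  let ?F = "{j. j < n \<and> first_on_core S j}"
  have S: "output_assignment s j = S j" if "j < n" for j
    using out that by (simp add: is_output_def output_assignment_def)
  have p: "bin_val (output_partition s (S j)) = real (scaled_demand I j) / 2 ^ ?E" if "j \<in> ?F" for j
    using out that by (simp add: is_output_def output_partition_def bin_val_def)
  have p0: "bin_val (output_partition s q) = 0" if "q \<notin> S ` ?F" for q
    using out that by (simp add: is_output_def output_partition_def bin_val_def)
  show ?sol
    unfolding solution_def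
  proof (intro conjI allI impI)
    show "0 \<le> bin_val (output_partition s i)" for i by (simp add: bin_val_def)
    have "(\<Sum>i<c. bin_val (output_partition s i)) = (\<Sum>i\<in>S ` ?F. bin_val (output_partition s i))"
      using acc p0 by (intro sum.mono_neutral_right) (auto simp: acceptable_def)
    also have "\<dots> = (\<Sum>j\<in>?F. real (scaled_demand I j) / 2 ^ ?E)"
      using inj_on_first_on_core[of S] p by (simp add: sum.reindex)
    also have "\<dots> = real (\<Sum>j\<in>?F. scaled_demand I j) / 2 ^ ?E" by (simp add: sum_divide_distrib)
    also have "\<dots> \<le> real (b * K) / 2 ^ ?E"
      using acc by (intro divide_right_mono) (simp_all only: acceptable_def of_nat_le_iff, simp)
    finally show "(\<Sum>i<c. bin_val (output_partition s i)) \<le> real b * bin_val (cache I)"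
      by (simp add: cache_scaled K_def)
  next
    fix j assume j: "j < n"
    show "output_assignment s j < c" using acc S[OF j] j by (simp add: acceptable_def)
    obtain i where i: "i < n" "S i = S j" "first_on_core S i" "scaled_demand I j \<le> scaled_demand I i"
      using first_on_core_exists[OF j] by blast
    then have "bin_val (output_partition s (S j)) = real (scaled_demand I i) / 2 ^ ?E"
      using p[of i] by simp
    then show "job_demand I j \<le> bin_val (output_partition s (output_assignment s j))"
      using i(4) j S[OF j] by (simp add: job_demand_scaled n_def divide_right_mono)
  qed
  have "(\<Sum>j | j < n \<and> output_assignment s j = i. job_load I j) \<le> (real b + 1) / real b * ?opt" for i
  proof -
    have eq: "{j. j < n \<and> output_assignment s j = i} = {j. j < n \<and> S j = i}" using S by auto
    \<comment> \<open>A core with a job makes \<open>M\<close> positive, so that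
      \<open>max 1 M\<close> is \<open>M\<close>; an idle core has load 0 and is not covered by the
      test.\<close>
    have "real b * real (core_load S i) \<le> (real b + 1) * real M"
    proof (cases "\<exists>j<n. S j = i")
      case True
      then obtain j where j: "j < n" "S j = i" by blast
      then have "b * core_load S i \<le> (b + 1) * m" using acc by (auto simp: acceptable_def)
      also have "\<dots> \<le> (b + 1) * M" using m M_pos[OF j(1)] by (intro mult_left_mono) simp_all
      finally have "b * core_load S i \<le> (b + 1) * M" .
      then have "real (b * core_load S i) \<le> real ((b + 1) * M)" by (simp only: of_nat_le_iff)
      then show ?thesis by (simp add: algebra_simps)
    next
      case False
      then have "{j. j < n \<and> S j = i} = {}" by auto
      then have "core_load S i = 0" by (simp only: core_load_def sum.empty)
      then show ?thesis by simp
    qed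
    also have "\<dots> \<le> (real b + 1) * (?opt * 2 ^ ?E)" using M_opt by (intro mult_left_mono) auto
    finally show ?thesis unfolding eq core using b w by (simp add: field_simps)
  qed
  then show ?mak unfolding makespan_def using c by (intro Max.boundedI) (auto simp: lessThan_empty_iff)
qed

lemma approximation_program:
  fixes b d :: nat
  assumes parameters: "(b, d) \<in> {(1, 0), (2, 0), (3, 2)}"
  shows "\<exists>(P :: com) (q :: nat poly). \<forall>I. valid_instance I \<longrightarrow>
    (\<exists>t s. exec P (input_state I) t s \<and>
       t \<le> poly q (instance_size I) \<and>
       (\<forall>i < cores I. bin_size (output_partition s i) \<le> poly q (instance_size I)) \<and>
       (feasible (length (jobs I)) (job_demand I) (cores I) (bin_val (cache I)) \<longrightarrow>
          solution (length (jobs I)) (job_demand I) (cores I) (real b * bin_val (cache I))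
            (\<lambda>i. bin_val (output_partition s i)) (output_assignment s) \<and>
          makespan (length (jobs I)) (job_load I) (cores I) (output_assignment s)
            \<le> (real b + 1) / real b *
              m_opt (length (jobs I)) (job_load I) (job_demand I) (cores I) (bin_val (cache I))))"
proof -
  let ?P = "main_prog b d"
  \<comment> \<open>Bounds the number of steps times the weight of the program, that is, the digits
    gained during the run; \<open>[:1, 2:]\<close> substitutes the common iteration bound.\<close>
  define r where "r = pcompose (step_poly ?P) [:1, 2:] * [:weight ?P:]"
  \<comment> \<open>The product bounds the running time. The rest is for the output cells: digits of
    length at most the input size plus \<open>r\<close>, a fraction length of at most the input
    size, and 1.\<close>
  define q where "q = r * ([:1, 1:] + r) + r + [:1, 2:]"
  show ?thesis
  proof (rule exI[of _ ?P], rule exI[of _ q], intro allI impI)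
    fix I :: cache_instance assume valid: "valid_instance I"
    let ?Z = "instance_size I" and ?n = "length (jobs I)" and ?c = "cores I"
    obtain k s m S where k: "steps ?P (input_state I) k s" "k \<le> poly (step_poly ?P) (1 + 2 * ?Z)"
      and out: "scheduling.is_output ?n (scaled_demand I) (total_frac I) S s"
      and acc: "\<And>M. scheduling.accepted_from ?n ?c b d (scaled_load I) (scaled_demand I) (scaled I (cache I)) M \<Longrightarrow>
        m \<le> M \<and> scheduling.acceptable ?n ?c b (scaled_load I) (scaled_demand I) (scaled I (cache I)) m S"
      using runs_main[of I b d] unfolding runs_def by blast
    obtain t where t: "exec ?P (input_state I) t s"
      "t \<le> k * weight ?P * (?Z + k * weight ?P + 1)" "bits_le (?Z + k * weight ?P) s"
      using steps_imp_exec[OF k(1) linear_main_prog le_refl bits_le_input] by blast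
    have "k * weight ?P \<le> poly (step_poly ?P) (1 + 2 * ?Z) * weight ?P"
      using k(2) by (intro mult_right_mono) auto
    also have "\<dots> = poly r ?Z" by (simp add: r_def poly_pcompose mult.commute)
    finally have r: "k * weight ?P \<le> poly r ?Z" .
    have q: "poly q ?Z = poly r ?Z * (?Z + poly r ?Z + 1) + poly r ?Z + (1 + 2 * ?Z)"
      by (simp add: q_def algebra_simps)
    have "t \<le> poly r ?Z * (?Z + poly r ?Z + 1)"
      by (rule order.trans[OF t(2)]) (intro mult_mono add_mono r, auto)
    then have "t \<le> poly q ?Z" by (simp add: q)
    moreover have "bin_size (output_partition s i) \<le> poly q ?Z" for i
    proof -
      have "s ''p_frac'' i \<le> total_frac I"
        using out unfolding scheduling.is_output_def by (cases "i \<in> S ` {j. j < ?n \<and> scheduling.first_on_core ?n (scaled_demand I) S j}") auto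
      moreover have "floorlog 2 (s ''p_digits'' i) \<le> ?Z + k * weight ?P"
        using t(3) by (simp add: bits_le_def)
      ultimately show ?thesis
        using r total_frac_le[of I] by (simp add: bin_size_def output_partition_def q)
    qed
    ultimately show "\<exists>t s. exec ?P (input_state I) t s \<and>
       t \<le> poly q (instance_size I) \<and>
       (\<forall>i < cores I. bin_size (output_partition s i) \<le> poly q (instance_size I)) \<and>
       (feasible (length (jobs I)) (job_demand I) (cores I) (bin_val (cache I)) \<longrightarrow>
          solution (length (jobs I)) (job_demand I) (cores I) (real b * bin_val (cache I))
            (\<lambda>i. bin_val (output_partition s i)) (output_assignment s) \<and>
          makespan (length (jobs I)) (job_load I) (cores I) (output_assignment s)
            \<le> (real b + 1) / real b *
              m_opt (length (jobs I)) (job_load I) (job_demand I) (cores I) (bin_val (cache I)))"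
      using t(1) is_output_correct[OF valid _ parameters out acc] by blast
  qed
qed

theorem theorem8:
  fixes \<alpha> \<beta> :: real
  assumes "(\<alpha>, \<beta>) \<in> {(2, 1), (3/2, 2), (4/3, 3)}"
  shows "\<exists>(P :: com) (q :: nat poly). \<forall>I. valid_instance I \<longrightarrow>
    (\<exists>t s. exec P (input_state I) t s \<and>
       t \<le> poly q (instance_size I) \<and>
       (\<forall>i < cores I. bin_size (output_partition s i) \<le> poly q (instance_size I)) \<and>
       (feasible (length (jobs I)) (job_demand I) (cores I) (bin_val (cache I)) \<longrightarrow>
          solution (length (jobs I)) (job_demand I) (cores I) (\<beta> * bin_val (cache I))
            (\<lambda>i. bin_val (output_partition s i)) (output_assignment s) \<and>
          makespan (length (jobs I)) (job_load I) (cores I) (output_assignment s)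
            \<le> \<alpha> * m_opt (length (jobs I)) (job_load I) (job_demand I) (cores I) (bin_val (cache I))))"
proof -
  \<comment> \<open>All three pairs have the form \<alpha> = (\<beta> + 1) / \<beta> with \<beta> =
    b; pairing is switched on only for b = 3.\<close>
  from assms consider "\<alpha> = (real 1 + 1) / real 1" "\<beta> = real 1"
    | "\<alpha> = (real 2 + 1) / real 2" "\<beta> = real 2" | "\<alpha> = (real 3 + 1) / real 3" "\<beta> = real 3"
    by auto
  then show ?thesis
  proof cases
    case 1
    show ?thesis unfolding 1 by (rule approximation_program[of 1 0]) simp
  next
    case 2
    show ?thesis unfolding 2 by (rule approximation_program[of 2 0]) simp
  next
    case 3
    show ?thesis unfolding 3 by (rule approximation_program[of 3 2]) simp
  qed
qed

end
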